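(* Let $\Omega\subset\mathbb{R}^2$ be an open, bounded, connected set containing $0$, and for $\varepsilon>0$ small let $B_\varepsilon=\{(x_1,x_2)\in\mathbb{R}^2:\sqrt{x_1^2+x_2^2}\le\varepsilon\}$. Let $u$ be an $L^2(\Omega)$-normalized eigenfunction of the Dirichlet Laplacian in $\Omega$, and let $k\in\mathbb{N}\cup\{0\}$, $\beta\in\mathbb{R}\setminus\{0\}$ and $\alpha\in[0,\pi)$ be such that $$r^{-k}u(r(\cos t,\sin t))\to\beta\sin(\alpha-kt)\quad\text{in }C^{1,\tau}([0,2\pi])\text{ (as functions of } t)\text{ as }r\to0^+,\ \text{for every }\tau\in(0,1),$$ $k$ being the order of vanishing of $u$ at $0$. Then, as $\varepsilon\to0^+$, $$\mathrm{Cap}_\Omega(B_\varepsilon,u)=\begin{cases}\dfrac{2\pi}{|\log\varepsilon|}\,u^2(0)\,(1+o(1)),&\text{if }k=0,\\[6pt] 2k\,\pi\,\varepsilon^{2k}\,\beta^2\,(1+o(1)),&\text{if }k\ge1.\end{cases}$$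
   Context: For a compact set $K\subset\Omega$ and $u\in H^1_0(\Omega)$, the $u$-capacity of $K$ in $\Omega$ is $$\mathrm{Cap}_\Omega(K,u)=\inf\Big\{\int_\Omega|\nabla f|^2\,dx:\ f\in H^1_0(\Omega),\ f-u\in H^1_0(\Omega\setminus K)\Big\}.$$ Eigenfunctions are real-valued. It is well known that for every eigenfunction $u$ of the Dirichlet Laplacian one has $u\in C^\infty(\Omega)$ and there exist $k,\beta,\alpha$ as in the claim; one then says that $u$ has a zero of order $k$ at $0$. The limit profile $\beta\sin(\alpha-kt)$ is not identically zero, so $k=0$ corresponds to $u(0)\neq0$ (with $\beta\sin\alpha=u(0)$, $\alpha\neq0$). *)

theory Defs
  imports "HOL-Analysis.Analysis" "HOL-Library.Landau_Symbols"
begin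

section \<open>Smooth functions and test functions\<close>

text \<open>Meant for open \<open>S\<close>; derivatives are two-sided, so nothing depends on values off \<open>S\<close>.\<close>

fun Ck_on :: "nat \<Rightarrow> 'a::euclidean_space set \<Rightarrow> ('a \<Rightarrow> real) \<Rightarrow> bool" where
  "Ck_on 0 S f \<longleftrightarrow> continuous_on S f"
| "Ck_on (Suc n) S f \<longleftrightarrow> (\<forall>x\<in>S. f differentiable (at x)) \<and>
     (\<forall>b\<in>Basis. Ck_on n S (\<lambda>x. frechet_derivative f (at x) b))"

definition smooth_on :: "'a::euclidean_space set \<Rightarrow> ('a \<Rightarrow> real) \<Rightarrow> bool" where
  "smooth_on S f \<longleftrightarrow> (\<forall>n. Ck_on n S f)"

definition gradient :: "('a::euclidean_space \<Rightarrow> real) \<Rightarrow> 'a \<Rightarrow> 'a" where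
  "gradient f x = (\<Sum>b\<in>Basis. frechet_derivative f (at x) b *\<^sub>R b)"

definition test_functions :: "'a::euclidean_space set \<Rightarrow> ('a \<Rightarrow> real) set" where
  "test_functions U = {\<phi>. smooth_on UNIV \<phi> \<and>
     compact (closure {x. \<phi> x \<noteq> 0}) \<and> closure {x. \<phi> x \<noteq> 0} \<subseteq> U}"


section \<open>Sobolev spaces\<close>

definition square_integrable ::
  "'a::euclidean_space set \<Rightarrow> ('a \<Rightarrow> 'b::euclidean_space) \<Rightarrow> bool" where
  "square_integrable U f \<longleftrightarrow> f \<in> borel_measurable (lebesgue_on U) \<and>
     integrable (lebesgue_on U) (\<lambda>x. (norm (f x))\<^sup>2)"

text \<open>\<open>f \<in> H\<^sup>1(U)\<close> and \<open>G\<close> is (a representative of) its weak gradient on \<open>U\<close>.\<close>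

definition has_H1_gradient ::
  "'a::euclidean_space set \<Rightarrow> ('a \<Rightarrow> real) \<Rightarrow> ('a \<Rightarrow> 'a) \<Rightarrow> bool" where
  "has_H1_gradient U f G \<longleftrightarrow> square_integrable U f \<and> square_integrable U G \<and>
     (\<forall>\<phi>\<in>test_functions U.
        (LINT x|lebesgue_on U. f x *\<^sub>R gradient \<phi> x) = - (LINT x|lebesgue_on U. \<phi> x *\<^sub>R G x))"

text \<open>
  Elements of \<open>H\<^sup>1\<^sub>0(U)\<close> are represented by their extensions by zero to the whole space:
  the closure of the test functions on \<open>U\<close> is taken in the norm of \<open>H\<^sup>1\<close> of the whole space,
  so members vanish almost everywhere off \<open>U\<close>. This is what makes \<open>f - u \<in> H\<^sup>1\<^sub>0(\<Omega> - K)\<close>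
  meaningful for functions \<open>f\<close> and \<open>u\<close> on \<open>\<Omega>\<close>; in particular it entails \<open>f = u\<close> a.e. on \<open>K\<close>.
\<close>

definition H10 :: "'a::euclidean_space set \<Rightarrow> ('a \<Rightarrow> real) set" where
  "H10 U = {f. \<exists>G. has_H1_gradient UNIV f G \<and>
     (\<forall>e>0. \<exists>\<phi>\<in>test_functions U.
        (LINT x|lebesgue. (f x - \<phi> x)\<^sup>2) +
        (LINT x|lebesgue. (norm (G x - gradient \<phi> x))\<^sup>2) < e\<^sup>2)}"


section \<open>Capacity and Dirichlet eigenfunctions\<close>

text \<open>The weak gradient is unique up to null sets, so letting \<open>G\<close> range over all of its
  representatives does not change the infimum.\<close>

definition capacity :: "'a::euclidean_space set \<Rightarrow> 'a set \<Rightarrow> ('a \<Rightarrow> real) \<Rightarrow> real" where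
  "capacity \<Omega> K u = Inf {(LINT x|lebesgue_on \<Omega>. (norm (G x))\<^sup>2) | f G.
     f \<in> H10 \<Omega> \<and> has_H1_gradient \<Omega> f G \<and> (\<lambda>x. f x - u x) \<in> H10 (\<Omega> - K)}"

definition dirichlet_eigenfunction :: "'a::euclidean_space set \<Rightarrow> ('a \<Rightarrow> real) \<Rightarrow> bool" where
  "dirichlet_eigenfunction \<Omega> u \<longleftrightarrow> u \<in> H10 \<Omega> \<and>
     \<not> (AE x in lebesgue_on \<Omega>. u x = 0) \<and>
     (\<exists>l::real. \<forall>v\<in>H10 \<Omega>. \<forall>G V. has_H1_gradient \<Omega> u G \<longrightarrow> has_H1_gradient \<Omega> v V \<longrightarrow>
        (LINT x|lebesgue_on \<Omega>. G x \<bullet> V x) = l * (LINT x|lebesgue_on \<Omega>. u x * v x))"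


section \<open>Convergence in \<open>C\<^sup>1\<^sup>,\<^sup>\<tau>\<close>\<close>

definition C1_holder :: "real \<Rightarrow> real set \<Rightarrow> (real \<Rightarrow> real) set" where
  "C1_holder \<tau> S = {h. h differentiable_on S \<and>
     (\<exists>C. \<forall>s\<in>S. \<forall>t\<in>S.
        \<bar>vector_derivative h (at s within S) - vector_derivative h (at t within S)\<bar>
          \<le> C * \<bar>s - t\<bar> powr \<tau>)}"

text \<open>The suprema are those of bounded sets, and hence meaningful, when \<open>h \<in> C1_holder \<tau> S\<close>
  and \<open>S\<close> is a nondegenerate compact interval.\<close>

definition C1_holder_norm :: "real \<Rightarrow> real set \<Rightarrow> (real \<Rightarrow> real) \<Rightarrow> real" where
  "C1_holder_norm \<tau> S h =
     (SUP t\<in>S. \<bar>h t\<bar>) + (SUP t\<in>S. \<bar>vector_derivative h (at t within S)\<bar>) +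
     (SUP (s, t)\<in>{(s, t). s \<in> S \<and> t \<in> S \<and> s \<noteq> t}.
        \<bar>vector_derivative h (at s within S) - vector_derivative h (at t within S)\<bar>
          / \<bar>s - t\<bar> powr \<tau>)"

definition tendsto_C1_holder ::
  "real \<Rightarrow> real set \<Rightarrow> ('i \<Rightarrow> real \<Rightarrow> real) \<Rightarrow> (real \<Rightarrow> real) \<Rightarrow> 'i filter \<Rightarrow> bool" where
  "tendsto_C1_holder \<tau> S f g F \<longleftrightarrow> g \<in> C1_holder \<tau> S \<and> (\<forall>\<^sub>F i in F. f i \<in> C1_holder \<tau> S) \<and>
     ((\<lambda>i. C1_holder_norm \<tau> S (\<lambda>t. f i t - g t)) \<longlongrightarrow> 0) F"

text \<open>
  \<open>u\<close> vanishes at \<open>0\<close> to order \<open>k\<close>, with leading profile \<open>\<beta> sin (\<alpha> - k t)\<close>. The profile must not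
  vanish identically; given \<open>\<beta> \<noteq> 0\<close> and \<open>\<alpha> \<in> [0, \<pi>)\<close> this only excludes \<open>k = 0\<close>, \<open>\<alpha> = 0\<close>.
\<close>

definition zero_of_order :: "(real ^ 2 \<Rightarrow> real) \<Rightarrow> nat \<Rightarrow> real \<Rightarrow> real \<Rightarrow> bool" where
  "zero_of_order u k \<beta> \<alpha> \<longleftrightarrow>
     (\<exists>t\<in>{0..2 * pi}. \<beta> * sin (\<alpha> - real k * t) \<noteq> 0) \<and>
     (\<forall>\<tau>. 0 < \<tau> \<and> \<tau> < 1 \<longrightarrow>
        tendsto_C1_holder \<tau> {0..2 * pi}
          (\<lambda>r t. u (r *\<^sub>R vector [cos t, sin t]) / r ^ k)
          (\<lambda>t. \<beta> * sin (\<alpha> - real k * t)) (at_right 0))"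

end

theory Submission
  imports Defs
begin

text \<open>
  Let \<open>P = \<beta> r\<^sup>k sin (\<alpha> - k t)\<close> be the leading harmonic polynomial of \<open>u\<close> at \<open>0\<close>, \<open>s = \<bar>x\<bar>\<^sup>2\<close>, and
  let \<open>m s\<^sup>k\<close> be the mean of \<open>P\<^sup>2\<close> over the circle \<open>\<bar>x\<bar>\<^sup>2 = s\<close>. For \<open>h' = - \<rho> s\<^sup>-\<^sup>k\<^sup>-\<^sup>1\<close>, \<open>0 \<le> \<rho> \<le> 1\<close>, with
  \<open>h\<close> vanishing at the outer boundary, the function \<open>w = P h(s)\<close> has energy at most \<open>4 \<pi> m h(0)\<close>, and its
  Laplacian is \<open>- 4 P s\<^sup>-\<^sup>k \<rho>'(s)\<close>. If \<open>\<rho>\<close> jumps from 0 to 1 just outside the disc, then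
  \<open>w / h(0) + \<kappa> (u - P)\<close>, with a cutoff \<open>\<kappa>\<close>, is a competitor for the capacity; the energy of \<open>\<kappa> (u - P)\<close>
  is negligible by an identity of Caccioppoli type, which uses the eigenvalue equation and no bound on
  \<open>\<nabla> u\<close>. If \<open>\<rho>\<close> jumps just inside the disc, then pairing a competitor \<open>f\<close> with \<open>w\<close> gives
  \<open>- \<integral> f \<Delta>w = - \<integral> u \<Delta>w\<close>, which is close to \<open>4 \<pi> m\<close>, and the Cauchy-Schwarz inequality is the lower bound.
  Both bounds are asymptotic to \<open>4 \<pi> m\<close> divided by \<open>2 \<bar>log \<epsilon>\<bar>\<close> for \<open>k = 0\<close> and by \<open>\<epsilon>\<^sup>-\<^sup>2\<^sup>k / k\<close> for \<open>k \<ge> 1\<close>.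
\<close>

section \<open>Smooth functions\<close>

text \<open>The hypothesis controls u on circles only: it bounds no radial derivative, and the
  boundary of \<Omega> may be irregular. Weak gradients therefore enter only through pairings with
  test functions. The variable s = |x|^2 keeps radial functions smooth at the origin and turns
  planar Lebesgue measure into \<pi> ds, so radial integrals become one-dimensional. The form of h'
  comes from \<Delta>(P h(s)) = 4 P s^(-k) (s^(k+1) h')'; for \<rho> = 1 it yields the singular
  harmonic solution. Since \<rho> rises from 0 to 1, the integral of 4 P^2 s^(-k) \<rho>' is 4 \<pi>
  m, the constant in both bounds. The side of the jump is forced: inside the disc every competitor
  equals u, which the lower bound exploits; for the upper bound f - u must be a limit of functions
  supported off the disc, so f has to equal u on a slightly larger one. The relative width of the
  annulus stays fixed while \<epsilon> tends to 0, and its cost tends to 1 when the width is shrunk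
  afterwards. The remainder is negligible once sup (u - P)^2 times the potential at \<epsilon>^2
  tends to 0; for k = 0 this has to beat a logarithm.\<close>

definition pd :: "'a::euclidean_space \<Rightarrow> ('a \<Rightarrow> real) \<Rightarrow> 'a \<Rightarrow> real" where
  "pd b f x = frechet_derivative f (at x) b"

lemma pd_eq: "(f has_derivative f') (at x) \<Longrightarrow> pd b f x = f' b"
  unfolding pd_def using frechet_derivative_at by metis

lemma gradient_eq_pd: "gradient f x = (\<Sum>b\<in>Basis. pd b f x *\<^sub>R b)"
  by (simp add: gradient_def pd_def)

lemma gradient_inner_Basis: "b \<in> Basis \<Longrightarrow> gradient f x \<bullet> b = pd b f x"
  by (simp add: gradient_eq_pd)

lemma inner_gradient: "v \<bullet> gradient f x = (\<Sum>b\<in>Basis. (v \<bullet> b) * pd b f x)"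
  by (simp add: gradient_eq_pd inner_sum_right mult.commute)

lemma has_derivative_pd:
  assumes "f differentiable (at x)"
  shows "(f has_derivative (\<lambda>v. \<Sum>b\<in>Basis. (v \<bullet> b) * pd b f x)) (at x)"
proof -
  obtain f' where f': "(f has_derivative f') (at x)"
    using assms by (auto simp: differentiable_def)
  interpret bounded_linear f' using f' by (rule has_derivative_bounded_linear)
  have "f' v = (\<Sum>b\<in>Basis. (v \<bullet> b) * pd b f x)" for v
  proof -
    have "f' v = f' (\<Sum>b\<in>Basis. (v \<bullet> b) *\<^sub>R b)" by (simp add: euclidean_representation)
    then show ?thesis by (simp add: sum scaleR pd_eq[OF f'])
  qed
  then have "f' = (\<lambda>v. \<Sum>b\<in>Basis. (v \<bullet> b) * pd b f x)" by (rule ext)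
  with f' show ?thesis by simp
qed

lemma pd_eq_inner_gradient: 
  assumes "f differentiable (at x)" 
  shows "pd v f x = v \<bullet> gradient f x"
  unfolding inner_gradient by (rule pd_eq[OF has_derivative_pd[OF assms]])

lemma has_derivative_gradient:
  "f differentiable (at x) \<Longrightarrow> (f has_derivative (\<lambda>v. v \<bullet> gradient f x)) (at x)"
  using has_derivative_pd by (simp add: inner_gradient)

lemma gradient_eqI:
  assumes "(f has_derivative (\<lambda>v. v \<bullet> g)) (at x)"
  shows "gradient f x = g"
  by (rule euclidean_eqI) (simp add: gradient_inner_Basis pd_eq[OF assms] inner_commute[of g])

lemma gradient_const [simp]: "gradient (\<lambda>x. c) x = 0"
  by (rule gradient_eqI) simp

lemma gradient_add:
  assumes "f differentiable (at x)" "g differentiable (at x)"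
  shows "gradient (\<lambda>x. f x + g x) x = gradient f x + gradient g x"
  by (rule gradient_eqI)
    (auto intro!: derivative_eq_intros has_derivative_gradient assms simp: inner_add_right)

lemma gradient_diff:
  assumes "f differentiable (at x)" "g differentiable (at x)"
  shows "gradient (\<lambda>x. f x - g x) x = gradient f x - gradient g x"
  by (rule gradient_eqI)
    (auto intro!: derivative_eq_intros has_derivative_gradient assms simp: inner_diff_right)

lemma gradient_mult:
  assumes "f differentiable (at x)" "g differentiable (at x)"
  shows "gradient (\<lambda>x. f x * g x) x = f x *\<^sub>R gradient g x + g x *\<^sub>R gradient f x"
  by (rule gradient_eqI)
    (auto intro!: derivative_eq_intros has_derivative_gradient assms
      simp: inner_add_right algebra_simps)

lemma gradient_compose:
  assumes "f differentiable (at x)" "(g has_real_derivative g') (at (f x))"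
  shows "gradient (\<lambda>x. g (f x)) x = g' *\<^sub>R gradient f x"
proof (rule gradient_eqI)
  show "((\<lambda>x. g (f x)) has_derivative (\<lambda>v. v \<bullet> (g' *\<^sub>R gradient f x))) (at x)"
    using diff_chain_at[OF has_derivative_gradient[OF assms(1)], of g "(*) g'"] assms(2)
    by (simp add: has_field_derivative_def o_def)
qed

lemma gradient_transform:
  assumes "open S" "x \<in> S" "\<And>y. y \<in> S \<Longrightarrow> f y = g y" "f differentiable (at x)"
  shows "gradient g x = gradient f x"
  by (rule gradient_eqI, rule has_derivative_transform_within_open[OF has_derivative_gradient])
     (use assms in auto)

lemma pd_transform:
  assumes "open S" "x \<in> S" "\<And>y. y \<in> S \<Longrightarrow> f y = g y" "f differentiable (at x)"
  shows "pd b g x = pd b f x"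
proof -
  obtain f' where f': "(f has_derivative f') (at x)"
    using assms(4) by (auto simp: differentiable_def)
  then show ?thesis
    using pd_eq[OF f'] pd_eq[OF has_derivative_transform_within_open[OF f' assms(1-3)]] by simp
qed

lemma differentiable_transform_open:
  assumes "open S" "x \<in> S" "\<And>y. y \<in> S \<Longrightarrow> f y = g y" "f differentiable (at x)"
  shows "g differentiable (at x)"
proof -
  obtain f' where f': "(f has_derivative f') (at x)"
    using assms(4) by (auto simp: differentiable_def)
  from has_derivative_transform_within_open[OF f' assms(1-3)] show ?thesis
    by (auto simp: differentiable_def)
qed

lemma gradient_zero_transform:
  assumes "open S" "x \<in> S" "\<And>y. y \<in> S \<Longrightarrow> f y = c"
  shows "gradient f x = 0"
  using gradient_transform[of S x "\<lambda>_. c" f] assms by simp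

section \<open>Closure properties of C^k and smooth functions\<close>

lemma Ck_on_Suc: "Ck_on (Suc n) S f \<longleftrightarrow>
    (\<forall>x\<in>S. f differentiable (at x)) \<and> (\<forall>b\<in>Basis. Ck_on n S (pd b f))"
  by (simp add: pd_def[abs_def])

declare Ck_on.simps(2) [simp del]

text \<open>Derivatives at a point of the open set S depend only on values in S, so equality on S
  passes to the partial derivatives and the induction proceeds.\<close>

lemma Ck_on_cong:
  assumes "open S" "Ck_on n S f" "\<And>x. x \<in> S \<Longrightarrow> f x = g x"
  shows "Ck_on n S g"
  using assms(2,3)
proof (induction n arbitrary: f g)
  case 0 then show ?case using continuous_on_cong by force
next
  case (Suc n)
  have d: "f differentiable (at x)" if "x \<in> S" for x
    using Suc.prems(1) that by (auto simp: Ck_on_Suc)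
  have "Ck_on n S (pd b g)" if "b \<in> Basis" for b
    using Suc.IH[of "pd b f" "pd b g"] Suc.prems that
      pd_transform[OF assms(1), of _ f g b] d by (auto simp: Ck_on_Suc)
  then show ?case
    using differentiable_transform_open[OF assms(1), of _ f g] d Suc.prems(2) by (auto simp: Ck_on_Suc)
qed

lemma Ck_on_subset: "Ck_on n S f \<Longrightarrow> T \<subseteq> S \<Longrightarrow> Ck_on n T f"
  by (induction n arbitrary: f) (auto simp: Ck_on_Suc intro: continuous_on_subset)

lemma Ck_on_SucD: "Ck_on (Suc n) S f \<Longrightarrow> Ck_on n S f"
proof (induction n arbitrary: f)
  case 0 then show ?case
    by (simp add: Ck_on_Suc differentiable_imp_continuous_within continuous_at_imp_continuous_on)
next
  case (Suc n) then show ?case by (metis Ck_on_Suc)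
qed

text \<open>Differentiability is a pointwise two-sided condition; openness serves to glue continuity
  at order 0. With two sets this gives smoothness of products extended by zero.\<close>

lemma Ck_on_UN:
  assumes "\<And>i. i \<in> I \<Longrightarrow> open (U i)" "\<And>i. i \<in> I \<Longrightarrow> Ck_on n (U i) f"
  shows "Ck_on n (\<Union>i\<in>I. U i) f"
  using assms(2)
proof (induction n arbitrary: f)
  case 0 then show ?case using assms(1) by (auto intro!: continuous_on_open_UN)
next
  case (Suc n) then show ?case by (auto simp: Ck_on_Suc)
qed

lemma Ck_on_const: "Ck_on n S (\<lambda>x. c)"
proof (induction n arbitrary: c)
  case (Suc n)
  have "pd b (\<lambda>x. c) = (\<lambda>x. 0)" for b :: 'a by (simp add: pd_def fun_eq_iff)
  then show ?case using Suc by (simp add: Ck_on_Suc)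
qed simp

lemma Ck_on_inner: "Ck_on n S (\<lambda>x. x \<bullet> a)"
proof (cases n)
  case (Suc m)
  have *: "((\<lambda>x. x \<bullet> a) has_derivative (\<lambda>x. x \<bullet> a)) (at x)" for x :: 'a
    by (auto intro!: derivative_eq_intros)
  then have "pd b (\<lambda>x. x \<bullet> a) = (\<lambda>x. b \<bullet> a)" for b by (intro ext pd_eq)
  then show ?thesis using * Suc by (auto simp: Ck_on_Suc Ck_on_const differentiable_def)
qed (simp add: continuous_intros)

lemma pd_add:
  assumes "f differentiable (at x)" "g differentiable (at x)"
  shows "pd b (\<lambda>x. f x + g x) x = pd b f x + pd b g x"
  using pd_eq[OF has_derivative_add[OF has_derivative_gradient[OF assms(1)] has_derivative_gradient[OF assms(2)]]]
  by (simp add: pd_eq_inner_gradient assms)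

lemma pd_mult:
  assumes "f differentiable (at x)" "g differentiable (at x)"
  shows "pd b (\<lambda>x. f x * g x) x = f x * pd b g x + g x * pd b f x"
  using pd_eq[OF has_derivative_mult[OF has_derivative_gradient[OF assms(1)] has_derivative_gradient[OF assms(2)]]]
  by (simp add: pd_eq_inner_gradient assms mult.commute)

lemma Ck_on_add:
  assumes S: "open S" and "Ck_on n S f" "Ck_on n S g"
  shows "Ck_on n S (\<lambda>x. f x + g x)"
  using assms(2,3)
proof (induction n arbitrary: f g)
  case (Suc n)
  have "Ck_on n S (pd b (\<lambda>x. f x + g x))" if "b \<in> Basis" for b
    by (rule Ck_on_cong[OF S Suc.IH[of "pd b f" "pd b g"]])
       (use Suc.prems that in \<open>auto simp: Ck_on_Suc pd_add\<close>)
  then show ?case using Suc.prems by (auto simp: Ck_on_Suc)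
qed (auto intro: continuous_intros)

lemma Ck_on_mult:
  assumes S: "open S" and "Ck_on n S f" "Ck_on n S g"
  shows "Ck_on n S (\<lambda>x. f x * g x)"
  using assms(2,3)
proof (induction n arbitrary: f g)
  case (Suc n)
  have "Ck_on n S (pd b (\<lambda>x. f x * g x))" if "b \<in> Basis" for b
    by (rule Ck_on_cong[OF S Ck_on_add[OF S Suc.IH[of "f" "pd b g"] Suc.IH[of g "pd b f"]]])
       (use Suc.prems that in \<open>auto simp: Ck_on_SucD pd_mult Ck_on_Suc\<close>)
  then show ?case using Suc.prems by (auto simp: Ck_on_Suc)
qed (auto intro: continuous_intros)

lemma smooth_on_differentiable: "smooth_on S f \<Longrightarrow> x \<in> S \<Longrightarrow> f differentiable (at x)"
  unfolding smooth_on_def using Ck_on_Suc[of 0 S f] by blast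

lemma smooth_on_pd: "smooth_on S f \<Longrightarrow> b \<in> Basis \<Longrightarrow> smooth_on S (pd b f)"
  unfolding smooth_on_def using Ck_on_Suc by blast

lemma smooth_on_continuous: "smooth_on S f \<Longrightarrow> continuous_on S f"
  unfolding smooth_on_def using Ck_on.simps(1) by blast

lemma smooth_on_cong:
  "open S \<Longrightarrow> smooth_on S f \<Longrightarrow> (\<And>x. x \<in> S \<Longrightarrow> f x = g x) \<Longrightarrow> smooth_on S g"
  unfolding smooth_on_def using Ck_on_cong by blast

lemma smooth_on_subset: "smooth_on S f \<Longrightarrow> T \<subseteq> S \<Longrightarrow> smooth_on T f"
  unfolding smooth_on_def using Ck_on_subset by blast

lemma smooth_on_Un:
  assumes "open S" "open T" "smooth_on S f" "smooth_on T f"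
  shows "smooth_on (S \<union> T) f"
  unfolding smooth_on_def
proof
  fix n
  show "Ck_on n (S \<union> T) f"
    using Ck_on_UN[of "UNIV :: bool set" "\<lambda>i. if i then S else T" n f] assms
    by (auto simp: smooth_on_def UNIV_bool Un_commute)
qed

lemma smooth_on_const: "smooth_on S (\<lambda>x. c)"
  by (simp add: smooth_on_def Ck_on_const)

lemma smooth_on_inner: "smooth_on S (\<lambda>x. x \<bullet> a)"
  by (simp add: smooth_on_def Ck_on_inner)

lemma smooth_on_add:
  "open S \<Longrightarrow> smooth_on S f \<Longrightarrow> smooth_on S g \<Longrightarrow> smooth_on S (\<lambda>x. f x + g x)"
  by (simp add: smooth_on_def Ck_on_add)

lemma smooth_on_mult:
  "open S \<Longrightarrow> smooth_on S f \<Longrightarrow> smooth_on S g \<Longrightarrow> smooth_on S (\<lambda>x. f x * g x)"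
  by (simp add: smooth_on_def Ck_on_mult)

lemma smooth_on_uminus: "open S \<Longrightarrow> smooth_on S f \<Longrightarrow> smooth_on S (\<lambda>x. - f x)"
  using smooth_on_mult[OF _ smooth_on_const[of _ "-1"], of S f] by simp

lemma smooth_on_diff:
  "open S \<Longrightarrow> smooth_on S f \<Longrightarrow> smooth_on S g \<Longrightarrow> smooth_on S (\<lambda>x. f x - g x)"
  using smooth_on_add[of S f "\<lambda>x. - g x"] smooth_on_uminus[of S g] by simp

lemma smooth_on_sum:
  assumes "open S" "\<And>i. i \<in> I \<Longrightarrow> smooth_on S (f i)"
  shows "smooth_on S (\<lambda>x. \<Sum>i\<in>I. f i x)"
  using assms(2)
proof (induction I rule: infinite_finite_induct)
  case (insert i I) 
  then show ?case using smooth_on_add[OF assms(1), of "f i" "\<lambda>x. \<Sum>i\<in>I. f i x"] by simp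
qed (simp_all add: smooth_on_const)

lemma smooth_on_power: "open S \<Longrightarrow> smooth_on S f \<Longrightarrow> smooth_on S (\<lambda>x. f x ^ n)"
  by (induction n) (auto intro: smooth_on_const smooth_on_mult)

section \<open>Smooth functions of one real variable\<close>

lemma pd_real:
  fixes g :: "real \<Rightarrow> real"
  assumes "(g has_real_derivative g') (at x)"
  shows "pd 1 g x = g'"
  using assms pd_eq[of g "(*) g'" x 1] by (simp add: has_field_derivative_def)

lemma Ck_on_realI:
  fixes g :: "real \<Rightarrow> real"
  assumes "open S" "\<And>x. x \<in> S \<Longrightarrow> (g has_real_derivative g' x) (at x)" "Ck_on n S g'"
  shows "Ck_on (Suc n) S g"
proof -
  have "Ck_on n S (pd 1 g)"
    by (rule Ck_on_cong[OF assms(1,3)]) (simp add: pd_real[OF assms(2)])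
  then show ?thesis
    using assms(2) by (auto simp: Ck_on_Suc differentiable_def has_field_derivative_def)
qed

lemma smooth_on_realI:
  fixes g :: "real \<Rightarrow> real"
  assumes "open S" "\<And>x. x \<in> S \<Longrightarrow> (g has_real_derivative g' x) (at x)" "smooth_on S g'"
  shows "smooth_on S g"
  using Ck_on_realI[OF assms(1,2)] assms(3) Ck_on_SucD unfolding smooth_on_def by blast

lemma smooth_on_real_derivative:
  fixes g :: "real \<Rightarrow> real"
  assumes "smooth_on S g"
  shows "\<exists>g'. (\<forall>x\<in>S. (g has_real_derivative g' x) (at x)) \<and> smooth_on S g'"
proof (intro exI[of _ "pd 1 g"] conjI ballI)
  show "smooth_on S (pd 1 g)" using assms by (simp add: smooth_on_pd)
  show "(g has_real_derivative pd 1 g x) (at x)" if "x \<in> S" for x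
    using has_derivative_pd[OF smooth_on_differentiable[OF assms that]]
    by (simp add: has_field_derivative_def mult_commute_abs)
qed

text \<open>The chain rule produces g' composed with f, so the induction runs over all smooth g
  while f stays fixed.\<close>

lemma Ck_on_compose:
  fixes g :: "real \<Rightarrow> real"
  assumes S: "open S" "open T" and f: "Ck_on n S f" "\<And>x. x \<in> S \<Longrightarrow> f x \<in> T" and g: "smooth_on T g"
  shows "Ck_on n S (\<lambda>x. g (f x))"
  using f(1) g
proof (induction n arbitrary: g)
  case 0 
  then show ?case using f(2) smooth_on_continuous continuous_on_compose2[of T g S f] by auto
next
  case (Suc n)
  obtain g' where g': "\<And>x. x \<in> T \<Longrightarrow> (g has_real_derivative g' x) (at x)" "smooth_on T g'"
    using smooth_on_real_derivative[OF Suc.prems(2)] by blast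
  have *: "((\<lambda>x. g (f x)) has_derivative (\<lambda>v. g' (f x) * pd v f x)) (at x)" if "x \<in> S" for x
  proof -
    have d: "f differentiable (at x)" using Suc.prems(1) that by (simp add: Ck_on_Suc)
    show ?thesis
      using diff_chain_at[OF has_derivative_gradient[OF d], of g "(*) (g' (f x))"] g'(1)[OF f(2)[OF that]]
      by (simp add: has_field_derivative_def o_def pd_eq_inner_gradient d)
  qed
  have "Ck_on n S (pd b (\<lambda>x. g (f x)))" if "b \<in> Basis" for b
    by (rule Ck_on_cong[OF S(1) Ck_on_mult[OF S(1) Suc.IH[OF _ g'(2)], of "pd b f"]])
       (use Suc.prems that in \<open>auto simp: pd_eq[OF *] Ck_on_SucD Ck_on_Suc\<close>)
  then show ?case using * by (auto simp: Ck_on_Suc differentiable_def)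
qed

lemma smooth_on_compose:
  fixes g :: "real \<Rightarrow> real"
  assumes "open S" "open T" "smooth_on S f" "\<And>x. x \<in> S \<Longrightarrow> f x \<in> T" "smooth_on T g"
  shows "smooth_on S (\<lambda>x. g (f x))"
  using Ck_on_compose[OF assms(1,2) _ assms(4,5)] assms(3) by (simp add: smooth_on_def)

text \<open>The derivative -1/x^2 is a polynomial in the function itself, so the induction on the
  order closes.\<close>

lemma smooth_on_inverse: "smooth_on {0<..} (inverse :: real \<Rightarrow> real)"
proof -
  have "Ck_on n {0<..} (inverse :: real \<Rightarrow> real)" for n
  proof (induction n)
    case 0 show ?case by (auto intro!: continuous_intros)
  next
    case (Suc n)
    show ?case
    proof (rule Ck_on_realI[where g' = "\<lambda>x. - 1 * (inverse x * inverse x)"])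
      show "Ck_on n {0<..} (\<lambda>x::real. - 1 * (inverse x * inverse x))"
        by (intro Ck_on_mult Ck_on_const Suc) simp_all
      show "(inverse has_real_derivative - 1 * (inverse x * inverse x)) (at x)" if "x \<in> {0<..}" for x :: real
        using that by (auto intro!: derivative_eq_intros simp: power2_eq_square)
    qed simp
  qed
  then show ?thesis by (simp add: smooth_on_def)
qed

text \<open>All derivatives of the flat function \<open>exp (-1/x)\<close> are combinations of the functions
  \<open>x\<^sup>-\<^sup>n exp (-1/x)\<close>, so these are shown to be smooth simultaneously.\<close>

definition flat :: "nat \<Rightarrow> real \<Rightarrow> real" where
  "flat n x = (if x \<le> 0 then 0 else inverse x ^ n * exp (- inverse x))"

lemma flat_pos: "0 < x \<Longrightarrow> 0 < flat n x"
  by (simp add: flat_def)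

lemma flat_nonneg: "0 \<le> flat n x"
  by (simp add: flat_def)

lemma flat_tendsto_0: "(flat n \<longlongrightarrow> 0) (at 0)"
proof -
  have "((\<lambda>x::real. x ^ n / exp x) \<longlongrightarrow> 0) at_top" by (rule tendsto_power_div_exp_0)
  then have "((\<lambda>x::real. inverse x ^ n / exp (inverse x)) \<longlongrightarrow> 0) (at_right 0)"
    by (rule filterlim_compose[OF _ filterlim_inverse_at_top_right])
  then have "(flat n \<longlongrightarrow> 0) (at_right 0)"
    by (rule Lim_transform_eventually)
       (auto simp: flat_def exp_minus field_simps eventually_at_right_less
          intro!: eventually_mono[OF eventually_at_right_less])
  moreover have "(flat n \<longlongrightarrow> 0) (at_left 0)"
    by (rule tendsto_eventually) (auto simp: flat_def eventually_at_filter)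
  ultimately show ?thesis by (simp add: filterlim_at_split)
qed

lemma flat_has_derivative:
  "(flat n has_real_derivative flat (n + 2) x - real n * flat (n + 1) x) (at x)"
proof -
  consider "x < 0" | "x = 0" | "x > 0" by linarith
  then show ?thesis
  proof cases
    case 1
    have "((\<lambda>x. 0) has_real_derivative 0) (at x)" by simp
    then have "(flat n has_real_derivative 0) (at x)"
      by (rule has_field_derivative_transform_within_open[where S="{..<0}"]) (use 1 in \<open>auto simp: flat_def\<close>)
    then show ?thesis using 1 by (simp add: flat_def)
  next
    case 2
    \<comment> \<open>At the origin the difference quotient of \<open>flat n\<close> is
      \<open>flat (Suc n)\<close>, which tends to 0.\<close>
    have "((\<lambda>h. (flat n (0 + h) - flat n 0) / h) \<longlongrightarrow> 0) (at 0)"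
      by (rule Lim_transform_eventually[OF flat_tendsto_0[of "Suc n"]])
         (auto simp: eventually_at_filter flat_def field_simps)
    then show ?thesis using 2 by (simp add: DERIV_def flat_def)
  next
    case 3
    have "((\<lambda>x. inverse x ^ n * exp (- inverse x)) has_real_derivative
        inverse x ^ (n+2) * exp (- inverse x) - real n * (inverse x ^ (n+1) * exp (- inverse x))) (at x)"
    proof (cases n)
      case (Suc k)
      have d1: "((\<lambda>x. inverse x ^ n) has_real_derivative - (real n * inverse x ^ (n + 1))) (at x)"
        unfolding Suc using 3
        by (intro DERIV_power_Suc[OF DERIV_inverse, THEN DERIV_cong]) (simp_all add: power2_eq_square)
      have d2: "((\<lambda>x. exp (- inverse x)) has_real_derivative inverse x ^ 2 * exp (- inverse x)) (at x)"
        using 3 by (auto intro!: derivative_eq_intros simp: power2_eq_square)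
      show ?thesis
        by (rule DERIV_cong[OF DERIV_mult[OF d1 d2]]) (simp add: power_add power2_eq_square algebra_simps)
    qed (use 3 in \<open>auto intro!: derivative_eq_intros simp: power2_eq_square\<close>)
    then have "(flat n has_real_derivative
        inverse x ^ (n+2) * exp (- inverse x) - real n * (inverse x ^ (n+1) * exp (- inverse x))) (at x)"
      by (rule has_field_derivative_transform_within_open[where S="{0<..}"]) (use 3 in \<open>auto simp: flat_def\<close>)
    then show ?thesis using 3 by (simp add: flat_def)
  qed
qed

lemma smooth_on_flat: "smooth_on UNIV (flat n)"
proof -
  have "Ck_on m UNIV (flat n)" for m n
  proof (induction m arbitrary: n)
    case 0 show ?case
      using DERIV_isCont[OF flat_has_derivative] by (simp add: continuous_on_eq_continuous_at)
  next
    case (Suc m)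
    show ?case
    proof (rule Ck_on_realI[OF open_UNIV flat_has_derivative])
      show "Ck_on m UNIV (\<lambda>x. flat (n + 2) x - real n * flat (n + 1) x)"
        using Ck_on_add[OF open_UNIV Suc Ck_on_mult[OF open_UNIV Ck_on_const[of m UNIV "- real n"] Suc],
            of "n+2" "n+1"] by simp
    qed
  qed
  then show ?thesis by (simp add: smooth_on_def)
qed

lemma smooth_antiderivative:
  fixes f :: "real \<Rightarrow> real"
  assumes "smooth_on UNIV f"
  obtains F where "\<And>x. (F has_real_derivative f x) (at x)" "smooth_on UNIV F"
proof -
  have "isCont f x" for x
    using smooth_on_continuous[OF assms] by (simp add: continuous_on_eq_continuous_at)
  then obtain F where F: "\<And>x. (F has_vector_derivative f x) (at x)"
    using einterval_antiderivative[of "-\<infinity>" \<infinity> f] by auto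
  then have "(F has_real_derivative f x) (at x)" for x
    by (simp add: has_real_derivative_iff_has_vector_derivative)
  with smooth_on_realI[OF open_UNIV _ assms] that show ?thesis by blast
qed

text \<open>A product of two flat functions is positive exactly on (a, b); its antiderivative,
  shifted and normalised, is the step. The derivative is returned as well, because the Laplacians
  below are multiples of it.\<close>

lemma smooth_step:
  fixes a b :: real
  assumes "a < b"
  shows "\<exists>\<rho> \<rho>'. smooth_on UNIV \<rho> \<and> smooth_on UNIV \<rho>' \<and>
    (\<forall>x. (\<rho> has_real_derivative \<rho>' x) (at x)) \<and> (\<forall>x. 0 \<le> \<rho>' x) \<and>
    (\<forall>x. x \<le> a \<longrightarrow> \<rho> x = 0) \<and> (\<forall>x. b \<le> x \<longrightarrow> \<rho> x = 1) \<and> (\<forall>x. 0 \<le> \<rho> x) \<and> (\<forall>x. \<rho> x \<le> 1) \<and>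
    (\<forall>x. x \<notin> {a<..<b} \<longrightarrow> \<rho>' x = 0)"
proof -
  define f where "f x = flat 0 (x - a) * flat 0 (b - x)" for x
  have id: "smooth_on UNIV (\<lambda>x::real. x)" using smooth_on_inner[of UNIV "1::real"] by simp
  have sm: "smooth_on UNIV (\<lambda>x. flat 0 (x - a))" "smooth_on UNIV (\<lambda>x. flat 0 (b - x))"
    using smooth_on_compose[OF open_UNIV open_UNIV, of "\<lambda>x. x - a" "flat 0"]
      smooth_on_compose[OF open_UNIV open_UNIV, of "\<lambda>x. b - x" "flat 0"]
      smooth_on_diff[OF open_UNIV id smooth_on_const[of _ a]]
      smooth_on_diff[OF open_UNIV smooth_on_const[of _ b] id]
    by (simp_all add: smooth_on_flat)
  have sf: "smooth_on UNIV f" unfolding f_def by (intro smooth_on_mult sm) simp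
  have f0: "f x \<ge> 0" and fz: "x \<notin> {a<..<b} \<Longrightarrow> f x = 0" and fp: "x \<in> {a<..<b} \<Longrightarrow> f x > 0" for x
    by (auto simp: f_def flat_nonneg flat_pos) (auto simp: flat_def)
  obtain F where F: "\<And>x. (F has_real_derivative f x) (at x)" "smooth_on UNIV F"
    using smooth_antiderivative[OF sf] by blast
  have mono: "F x \<le> F y" if "x \<le> y" for x y
    using DERIV_nonneg_imp_nondecreasing[of x y F] F(1) f0 that by blast
  have lt: "F a < F b"
  proof (rule DERIV_pos_imp_increasing_open[OF assms])
    show "\<exists>y. DERIV F x :> y \<and> 0 < y" if "a < x" "x < b" for x using F(1) fp that by auto
    show "continuous_on {a..b} F" using F(2) smooth_on_continuous continuous_on_subset by blast
  qed
  have Fa: "F x = F a" if "x \<le> a" for x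
  proof (cases "x = a")
    case False
    with that have "x < a" by simp
    then obtain z where "x < z" "z < a" "F a - F x = (a - x) * f z" using MVT2[of x a F f] F(1) by blast
    then show ?thesis using fz[of z] by simp
  qed simp
  have Fb: "F x = F b" if "b \<le> x" for x
  proof (cases "x = b")
    case False
    with that have "b < x" by simp
    then obtain z where "b < z" "z < x" "F x - F b = (x - b) * f z" using MVT2[of b x F f] F(1) by blast
    then show ?thesis using fz[of z] by simp
  qed simp
  define c where "c = inverse (F b - F a)"
  have c: "c > 0" "c * (F b - F a) = 1" using lt by (auto simp: c_def)
  show ?thesis
  proof (rule exI[of _ "\<lambda>x. c * (F x - F a)"], rule exI[of _ "\<lambda>x. c * f x"], intro conjI allI impI)
    show "smooth_on UNIV (\<lambda>x. c * (F x - F a))" "smooth_on UNIV (\<lambda>x. c * f x)"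
      by (intro smooth_on_mult smooth_on_diff smooth_on_const F sf; simp)+
    show "((\<lambda>x. c * (F x - F a)) has_real_derivative c * f x) (at x)" for x
      using F(1) by (auto intro!: derivative_eq_intros)
    show "0 \<le> c * f x" for x using c f0 by simp
    show "c * (F x - F a) = 0" if "x \<le> a" for x using Fa[OF that] by simp
    show "c * (F x - F a) = 1" if "b \<le> x" for x using Fb[OF that] c by simp
    show "0 \<le> c * (F x - F a)" for x
    proof -
      have "F a \<le> F x" using mono[of a x] Fa[of x] by linarith
      then show ?thesis using c(1) by simp
    qed
    show "c * (F x - F a) \<le> 1" for x
    proof -
      have "F x \<le> F b" using mono[of x b] Fb[of x] by linarith
      then have "c * (F x - F a) \<le> c * (F b - F a)" using c(1) by simp
      then show ?thesis using c(2) by simp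
    qed
    show "c * f x = 0" if "x \<notin> {a<..<b}" for x using fz that by simp
  qed
qed


section \<open>Test functions and weak gradients\<close>

lemma test_functionsI:
  assumes "smooth_on UNIV \<phi>" "compact K" "K \<subseteq> U" "\<And>x. x \<notin> K \<Longrightarrow> \<phi> x = 0"
  shows "\<phi> \<in> test_functions U"
proof -
  have "closure {x. \<phi> x \<noteq> 0} \<subseteq> K"
    using assms(2,4) by (intro closure_minimal) (auto simp: compact_imp_closed)
  then show ?thesis
    using assms compact_Int_closed[OF assms(2) closed_closure, of "{x. \<phi> x \<noteq> 0}"]
    by (auto simp: test_functions_def Int_absorb1)
qed

lemma test_functionsE:
  assumes "\<phi> \<in> test_functions U"
  obtains K where "smooth_on UNIV \<phi>" "compact K" "K \<subseteq> U" "\<And>x. x \<notin> K \<Longrightarrow> \<phi> x = 0"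
    "\<And>x b. x \<notin> K \<Longrightarrow> pd b \<phi> x = 0"
proof (rule that[of "closure {x. \<phi> x \<noteq> 0}"])
  have 0: "\<phi> x = 0" if "x \<notin> closure {x. \<phi> x \<noteq> 0}" for x
  proof (rule ccontr)
    assume "\<phi> x \<noteq> 0"
    then have "x \<in> {x. \<phi> x \<noteq> 0}" by simp
    with that show False using closure_subset[THEN subsetD] by metis
  qed
  show "\<phi> x = 0" if "x \<notin> closure {x. \<phi> x \<noteq> 0}" for x by (rule 0[OF that])
  show "pd b \<phi> x = 0" if "x \<notin> closure {x. \<phi> x \<noteq> 0}" for x b
  proof -
    have "pd b \<phi> x = pd b (\<lambda>x. 0) x"
    proof (rule pd_transform[of "- closure {x. \<phi> x \<noteq> 0}"])
      show "0 = \<phi> y" if "y \<in> - closure {x. \<phi> x \<noteq> 0}" for y using 0[of y] that by simp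
      show "x \<in> - closure {x. \<phi> x \<noteq> 0}" by (rule ComplI) (use that in blast)
    qed (simp_all add: open_Compl)
    then show ?thesis by (simp add: pd_def)
  qed
qed (use assms in \<open>auto simp: test_functions_def\<close>)

lemma test_functions_mono: "\<phi> \<in> test_functions U \<Longrightarrow> U \<subseteq> V \<Longrightarrow> \<phi> \<in> test_functions V"
  by (auto simp: test_functions_def)

lemma test_functions_smooth: "\<phi> \<in> test_functions U \<Longrightarrow> smooth_on UNIV \<phi>"
  by (simp add: test_functions_def)

lemma test_functions_differentiable: "\<phi> \<in> test_functions U \<Longrightarrow> \<phi> differentiable (at x)"
  using smooth_on_differentiable test_functions_smooth by blast

lemma test_functions_vanish: "\<phi> \<in> test_functions U \<Longrightarrow> x \<notin> U \<Longrightarrow> \<phi> x = 0"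
  by (erule test_functionsE) blast

lemma test_functions_gradient_vanish: "\<phi> \<in> test_functions U \<Longrightarrow> x \<notin> U \<Longrightarrow> gradient \<phi> x = 0"
proof (erule test_functionsE)
  fix K assume "x \<notin> U" "K \<subseteq> U" "\<And>x b. x \<notin> K \<Longrightarrow> pd b \<phi> x = 0"
  then have "pd b \<phi> x = 0" for b by blast
  then show ?thesis by (simp add: gradient_eq_pd)
qed

lemma test_functions_pd:
  assumes "\<phi> \<in> test_functions U" "b \<in> Basis"
  shows "pd b \<phi> \<in> test_functions U"
  using assms(1)
proof (rule test_functionsE)
  fix K assume "smooth_on UNIV \<phi>" "compact K" "K \<subseteq> U" "\<And>x b. x \<notin> K \<Longrightarrow> pd b \<phi> x = 0"
  then show ?thesis using assms(2) by (intro test_functionsI[of _ K] smooth_on_pd)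
qed

text \<open>The product is smooth on U, and it is 0 on the complement of the compact support; these
  two open sets cover the space. Cutoffs of u, which is smooth only on \<Omega>, become test
  functions this way.\<close>

lemma test_functions_mult:
  assumes "open U" "\<phi> \<in> test_functions U" "smooth_on U g"
  shows "(\<lambda>x. \<phi> x * g x) \<in> test_functions U"
  using assms(2)
proof (rule test_functionsE)
  fix K assume K: "smooth_on UNIV \<phi>" "compact K" "K \<subseteq> U" "\<And>x. x \<notin> K \<Longrightarrow> \<phi> x = 0"
  have "smooth_on (- K) (\<lambda>x. \<phi> x * g x)"
    by (rule smooth_on_cong[OF _ smooth_on_const[of _ 0]])
       (use K in \<open>auto simp: open_Compl compact_imp_closed\<close>)
  moreover have "smooth_on U (\<lambda>x. \<phi> x * g x)"
    using K(1) assms by (auto intro: smooth_on_mult smooth_on_subset)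
  ultimately have "smooth_on (U \<union> - K) (\<lambda>x. \<phi> x * g x)"
    using K assms by (intro smooth_on_Un) (auto simp: open_Compl compact_imp_closed)
  moreover have "U \<union> - K = UNIV" using K by auto
  ultimately show ?thesis using K by (intro test_functionsI[of _ K]) auto
qed

lemma test_functions_add:
  assumes "\<phi> \<in> test_functions U" "\<psi> \<in> test_functions U"
  shows "(\<lambda>x. \<phi> x + \<psi> x) \<in> test_functions U"
  using assms(1)
proof (rule test_functionsE)
  fix K assume K: "smooth_on UNIV \<phi>" "compact K" "K \<subseteq> U" "\<And>x. x \<notin> K \<Longrightarrow> \<phi> x = 0"
  from assms(2) show ?thesis
  proof (rule test_functionsE)
    fix L assume L: "smooth_on UNIV \<psi>" "compact L" "L \<subseteq> U" "\<And>x. x \<notin> L \<Longrightarrow> \<psi> x = 0"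
    show ?thesis
      by (rule test_functionsI[of _ "K \<union> L"]) (use K L in \<open>auto intro: smooth_on_add\<close>)
  qed
qed

section \<open>Integration by parts with test functions\<close>

lemma integrable_compact_support:
  fixes f :: "'a::euclidean_space \<Rightarrow> 'b::euclidean_space"
  assumes "continuous_on UNIV f" "compact K" "\<And>x. x \<notin> K \<Longrightarrow> f x = 0"
  shows "integrable lborel f" "integrable lebesgue f" "(LINT x|lebesgue. f x) = (LINT x|lborel. f x)"
    "\<exists>B. \<forall>x. norm (f x) \<le> B"
proof -
  have fb: "f \<in> borel_measurable borel" using assms(1) by (rule borel_measurable_continuous_onI)
  have "integrable lborel (\<lambda>x. indicator K x *\<^sub>R f x)"
    using borel_integrable_compact[OF assms(2) continuous_on_subset[OF assms(1)]]
    by (simp add: set_integrable_def indicator_scaleR_eq_if)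
  moreover have "(\<lambda>x. indicator K x *\<^sub>R f x) = f" using assms(3) by (auto simp: indicator_def fun_eq_iff)
  ultimately show i: "integrable lborel f" by simp
  show "integrable lebesgue f" "(LINT x|lebesgue. f x) = (LINT x|lborel. f x)"
    using i fb by (simp_all add: integrable_completion integral_completion)
  have "bounded (f ` K)"
    using assms(2) continuous_on_subset[OF assms(1)] by (intro compact_imp_bounded compact_continuous_image) auto
  then obtain B where "\<And>x. x \<in> K \<Longrightarrow> norm (f x) \<le> B" by (auto simp: bounded_iff)
  then have "norm (f x) \<le> max B 0" for x using assms(3)[of x] by (cases "x \<in> K") force+
  then show "\<exists>B. \<forall>x. norm (f x) \<le> B" by blast
qed

lemma
  assumes "\<phi> \<in> test_functions U"
  shows test_functions_integrable: "integrable lebesgue \<phi>"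
    and test_functions_bounded: "\<exists>B. \<forall>x. \<bar>\<phi> x\<bar> \<le> B"
    and test_functions_integral_lborel: "(LINT x|lebesgue. \<phi> x) = (LINT x|lborel. \<phi> x)"
    and test_functions_integrable_lborel: "integrable lborel \<phi>"
    and test_functions_measurable: "\<phi> \<in> borel_measurable lebesgue"
proof -
  obtain K where K: "smooth_on UNIV \<phi>" "compact K" "\<And>x. x \<notin> K \<Longrightarrow> \<phi> x = 0"
    using assms by (elim test_functionsE) metis
  note * = integrable_compact_support[OF smooth_on_continuous[OF K(1)] K(2) K(3)]
  show "integrable lebesgue \<phi>" "\<exists>B. \<forall>x. \<bar>\<phi> x\<bar> \<le> B" "integrable lborel \<phi>"
    "(LINT x|lebesgue. \<phi> x) = (LINT x|lborel. \<phi> x)"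
    using * by simp_all
  show "\<phi> \<in> borel_measurable lebesgue" using *(2) by (rule borel_measurable_integrable)
qed

text \<open>The integral of the difference quotient of \<open>\<phi>\<close> vanishes by translation invariance.\<close>

lemma integral_pd_test_function:
  assumes \<phi>: "\<phi> \<in> test_functions UNIV" and b: "b \<in> Basis"
  shows "(LINT x|lebesgue. pd b \<phi> x) = 0"
proof -
  obtain K where K: "smooth_on UNIV \<phi>" "compact K" "\<And>x. x \<notin> K \<Longrightarrow> \<phi> x = 0"
    using \<phi> by (elim test_functionsE) metis
  obtain R where R: "\<And>x. x \<in> K \<Longrightarrow> norm x \<le> R"
    using compact_imp_bounded[OF K(2)] by (auto simp: bounded_iff)
  note p = test_functions_pd[OF \<phi> b]
  obtain M where M: "\<And>x. \<bar>pd b \<phi> x\<bar> \<le> M" using test_functions_bounded[OF p] by auto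
  define s where "s n x = (\<phi> (x + inverse (real (Suc n)) *\<^sub>R b) - \<phi> x) * real (Suc n)" for n x
  have line: "((\<lambda>t. \<phi> (x + t *\<^sub>R b)) has_real_derivative pd b \<phi> (x + t *\<^sub>R b)) (at t)" for x t
  proof -
    have d: "\<phi> differentiable (at (x + t *\<^sub>R b))" using \<phi> by (rule test_functions_differentiable)
    have "((\<lambda>t. x + t *\<^sub>R b) has_derivative (\<lambda>t. t *\<^sub>R b)) (at t)"
      by (auto intro!: derivative_eq_intros)
    from diff_chain_at[OF this has_derivative_gradient[OF d]] show ?thesis
      by (simp add: has_field_derivative_def o_def pd_eq_inner_gradient[OF d] mult_commute_abs)
  qed
  \<comment> \<open>The mean value theorem bounds the quotient by the supremum of the derivative; a
    step length of at most 1 keeps the support in the ball of radius R + 1.\<close>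
  have bound: "norm (s n x) \<le> M * indicator (cball 0 (R + 1)) x" for n x
  proof (cases "x \<in> cball 0 (R + 1)")
    case True
    obtain z where "\<phi> (x + inverse (real (Suc n)) *\<^sub>R b) - \<phi> (x + 0 *\<^sub>R b)
      = (inverse (real (Suc n)) - 0) * pd b \<phi> (x + z *\<^sub>R b)"
      using MVT2[of 0 "inverse (real (Suc n))" "\<lambda>t. \<phi> (x + t *\<^sub>R b)" "\<lambda>t. pd b \<phi> (x + t *\<^sub>R b)"] line
      by auto
    then have "s n x = pd b \<phi> (x + z *\<^sub>R b)" by (simp add: s_def)
    then show ?thesis using True M by simp
  next
    case False
    have "norm (x + inverse (real (Suc n)) *\<^sub>R b) \<ge> norm x - norm (inverse (real (Suc n)) *\<^sub>R b)"
      by (metis add_diff_cancel norm_triangle_ineq2 norm_triangle_ineq4 diff_add_cancel add.commute norm_minus_commute le_diff_eq)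
    moreover have "norm (inverse (real (Suc n)) *\<^sub>R b) \<le> 1" using b by (simp add: field_simps)
    ultimately have "x + inverse (real (Suc n)) *\<^sub>R b \<notin> K" "x \<notin> K" using False R by fastforce+
    then show ?thesis using K(3) False by (simp add: s_def)
  qed
  have lim: "(\<lambda>n. s n x) \<longlonglongrightarrow> pd b \<phi> x" for x
  proof -
    have "((\<lambda>t. \<phi> (x + t *\<^sub>R b)) has_real_derivative pd b \<phi> x) (at 0)" using line[of x 0] by simp
    then have "((\<lambda>h. (\<phi> (x + h *\<^sub>R b) - \<phi> x) / h) \<longlongrightarrow> pd b \<phi> x) (at 0)" by (simp add: DERIV_def)
    moreover have "filterlim (\<lambda>n. inverse (real (Suc n))) (at 0) sequentially"
      using LIMSEQ_inverse_real_of_nat by (auto simp: filterlim_at)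
    ultimately have "(\<lambda>n. (\<phi> (x + inverse (real (Suc n)) *\<^sub>R b) - \<phi> x) / inverse (real (Suc n))) \<longlonglongrightarrow> pd b \<phi> x"
      by (rule filterlim_compose)
    then show ?thesis by (simp add: s_def field_simps)
  qed
  have i\<phi>: "integrable lborel \<phi>" using \<phi> by (rule test_functions_integrable_lborel)
  have m: "\<phi> \<in> borel_measurable borel" using i\<phi> by (auto dest: borel_measurable_integrable)
  have tr: "integrable lborel (\<lambda>x. \<phi> (x + c))" "(LINT x|lborel. \<phi> (x + c)) = (LINT x|lborel. \<phi> x)" for c
  proof -
    have "integrable (distr lborel borel ((+) c)) \<phi>" using i\<phi> by (simp add: lborel_distr_plus)
    then show "integrable lborel (\<lambda>x. \<phi> (x + c))" using m by (simp add: integrable_distr_eq add.commute)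
    have "(LINT x|distr lborel borel ((+) c). \<phi> x) = (LINT x|lborel. \<phi> (c + x))"
      using m by (intro integral_distr) auto
    then show "(LINT x|lborel. \<phi> (x + c)) = (LINT x|lborel. \<phi> x)" by (simp add: lborel_distr_plus add.commute)
  qed
  have "(\<lambda>n. LINT x|lborel. s n x) \<longlonglongrightarrow> (LINT x|lborel. pd b \<phi> x)"
  proof (rule integral_dominated_convergence[where w="\<lambda>x. M * indicator (cball 0 (R + 1)) x"])
    show "pd b \<phi> \<in> borel_measurable lborel" 
      using test_functions_integrable_lborel[OF p] by (rule borel_measurable_integrable)
    show "s n \<in> borel_measurable lborel" for n unfolding s_def using m by measurable
    show "integrable lborel (\<lambda>x. M * indicator (cball 0 (R + 1)) x)"
      by (intro integrable_mult_right integrable_real_indicator emeasure_lborel_cball_finite) simp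
  qed (use lim bound in auto)
  moreover have "(LINT x|lborel. s n x) = 0" for n
    using tr i\<phi> by (simp add: s_def)
  ultimately have "(LINT x|lborel. pd b \<phi> x) = 0" using LIMSEQ_unique[OF _ tendsto_const] by auto
  then show ?thesis using test_functions_integral_lborel[OF p] by simp
qed

text \<open>The product \<phi> g is a test function, so its derivative integrates to 0. Only one
  factor has compact support, so that g may be the eigenfunction.\<close>

lemma
  assumes "open U" "\<phi> \<in> test_functions U" "smooth_on U g" "b \<in> Basis"
  shows integrable_test_pd: "integrable lebesgue (\<lambda>x. \<phi> x * pd b g x)"
    and integrable_pd_test: "integrable lebesgue (\<lambda>x. g x * pd b \<phi> x)"
    and integral_by_parts_test: "(LINT x|lebesgue. \<phi> x * pd b g x) = - (LINT x|lebesgue. g x * pd b \<phi> x)"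
proof -
  have t: "(\<lambda>x. \<phi> x * g x) \<in> test_functions U" using assms by (auto intro: test_functions_mult)
  have eq: "pd b (\<lambda>x. \<phi> x * g x) x = \<phi> x * pd b g x + g x * pd b \<phi> x" for x
  proof (cases "x \<in> U")
    case True
    then show ?thesis
      using assms by (intro pd_mult) (auto intro: test_functions_differentiable smooth_on_differentiable)
  next
    \<comment> \<open>Off U the value of \<open>pd b g\<close> is arbitrary, but it is multiplied by
      \<phi> = 0, and the derivatives of \<phi> and of \<phi> g vanish there.\<close>
    case False
    then show ?thesis using t test_functions_pd[OF t assms(4)] test_functions_pd[OF assms(2,4)] assms(2)
      by (simp add: test_functions_vanish)
  qed
  show 1: "integrable lebesgue (\<lambda>x. \<phi> x * pd b g x)"
    using assms by (intro test_functions_integrable[of _ U] test_functions_mult smooth_on_pd)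
  show 2: "integrable lebesgue (\<lambda>x. g x * pd b \<phi> x)"
    using test_functions_integrable[OF test_functions_mult[OF assms(1) test_functions_pd[OF assms(2,4)] assms(3)]]
    by (simp add: mult.commute)
  have "(LINT x|lebesgue. pd b (\<lambda>x. \<phi> x * g x) x) = 0"
    using integral_pd_test_function[OF test_functions_mono[OF t] assms(4)] by simp
  then show "(LINT x|lebesgue. \<phi> x * pd b g x) = - (LINT x|lebesgue. g x * pd b \<phi> x)"
    using 1 2 by (simp add: eq)
qed

definition laplacian :: "('a::euclidean_space \<Rightarrow> real) \<Rightarrow> 'a \<Rightarrow> real" where
  "laplacian f x = (\<Sum>b\<in>Basis. pd b (pd b f) x)"

lemma gradient_inner: "gradient f x \<bullet> gradient g x = (\<Sum>b\<in>Basis. pd b f x * pd b g x)"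
  by (simp add: inner_gradient gradient_inner_Basis)

lemma smooth_on_laplacian: "open S \<Longrightarrow> smooth_on S f \<Longrightarrow> smooth_on S (laplacian f)"
  unfolding laplacian_def[abs_def] by (intro smooth_on_sum smooth_on_pd)

lemma test_functions_laplacian:
  assumes "\<phi> \<in> test_functions U" shows "laplacian \<phi> \<in> test_functions U"
proof -
  obtain K where K: "smooth_on UNIV \<phi>" "compact K" "K \<subseteq> U" "\<And>x. x \<notin> K \<Longrightarrow> \<phi> x = 0"
    using assms by (elim test_functionsE) metis
  have "laplacian \<phi> x = 0" if "x \<notin> K" for x
    unfolding laplacian_def
  proof (rule sum.neutral, rule ballI)
    fix b :: 'a assume "b \<in> Basis"
    have "\<phi> \<in> test_functions K" using K by (auto intro: test_functionsI)
    from test_functions_vanish[OF test_functions_pd[OF test_functions_pd[OF this \<open>b \<in> Basis\<close>] \<open>b \<in> Basis\<close>] that]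
    show "pd b (pd b \<phi>) x = 0" .
  qed
  then show ?thesis using K by (intro test_functionsI[of _ K]) (auto intro: smooth_on_laplacian)
qed

text \<open>Both derivatives can be put on either factor. The first form gives 0 when g is harmonic;
  the second, with g = u, leaves a pairing with u itself, where a weak gradient can take
  over.\<close>

lemma
  assumes "open U" "\<phi> \<in> test_functions U" "smooth_on U g"
  shows green_test: "(LINT x|lebesgue. gradient \<phi> x \<bullet> gradient g x) = - (LINT x|lebesgue. \<phi> x * laplacian g x)"
    and green_test2: "(LINT x|lebesgue. gradient \<phi> x \<bullet> gradient g x) = - (LINT x|lebesgue. g x * laplacian \<phi> x)"
    and integrable_gradient_test: "integrable lebesgue (\<lambda>x. gradient \<phi> x \<bullet> gradient g x)"
proof -
  have i: "integrable lebesgue (\<lambda>x. pd b \<phi> x * pd b g x)" if "b \<in> Basis" for b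
    using integrable_test_pd[OF assms(1) test_functions_pd[OF assms(2)] assms(3)] that by simp
  then show "integrable lebesgue (\<lambda>x. gradient \<phi> x \<bullet> gradient g x)" by (simp add: gradient_inner)
  have "(LINT x|lebesgue. gradient \<phi> x \<bullet> gradient g x) = (\<Sum>b\<in>Basis. LINT x|lebesgue. pd b \<phi> x * pd b g x)"
    using i by (simp add: gradient_inner)
  also have "\<dots> = (\<Sum>b\<in>Basis. - (LINT x|lebesgue. \<phi> x * pd b (pd b g) x))"
    using integral_by_parts_test[OF assms(1,2) smooth_on_pd[OF assms(3)]] by (simp add: mult.commute)
  also have "\<dots> = - (LINT x|lebesgue. \<phi> x * laplacian g x)"
    using integrable_test_pd[OF assms(1,2) smooth_on_pd[OF assms(3)]]
    by (simp add: laplacian_def sum_distrib_left sum_negf)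
  finally show "(LINT x|lebesgue. gradient \<phi> x \<bullet> gradient g x) = - (LINT x|lebesgue. \<phi> x * laplacian g x)" .
  have "(LINT x|lebesgue. gradient \<phi> x \<bullet> gradient g x) = (\<Sum>b\<in>Basis. LINT x|lebesgue. pd b \<phi> x * pd b g x)"
    using i by (simp add: gradient_inner)
  also have "\<dots> = (\<Sum>b\<in>Basis. - (LINT x|lebesgue. g x * pd b (pd b \<phi>) x))"
    using integral_by_parts_test[OF assms(1) test_functions_pd[OF assms(2)] assms(3)] by simp
  also have "\<dots> = - (LINT x|lebesgue. g x * laplacian \<phi> x)"
    using integrable_pd_test[OF assms(1) test_functions_pd[OF assms(2)] assms(3)]
    by (simp add: laplacian_def sum_distrib_left sum_negf)
  finally show "(LINT x|lebesgue. gradient \<phi> x \<bullet> gradient g x) = - (LINT x|lebesgue. g x * laplacian \<phi> x)" .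
qed

section \<open>Square integrable functions over an arbitrary measure\<close>

definition L2 :: "'a measure \<Rightarrow> ('a \<Rightarrow> 'b::euclidean_space) \<Rightarrow> bool" where
  "L2 M f \<longleftrightarrow> f \<in> borel_measurable M \<and> integrable M (\<lambda>x. (norm (f x))\<^sup>2)"

lemma square_integrable_iff_L2: "square_integrable U f \<longleftrightarrow> L2 (lebesgue_on U) f"
  by (simp add: square_integrable_def L2_def)

lemma L2_measurable: "L2 M f \<Longrightarrow> f \<in> borel_measurable M"
  by (simp add: L2_def)

lemma L2_integrable: "L2 M f \<Longrightarrow> integrable M (\<lambda>x. (norm (f x))\<^sup>2)"
  by (simp add: L2_def)

lemma L2_inner_integrable:
  assumes "L2 M f" "L2 M g" shows "integrable M (\<lambda>x. f x \<bullet> g x)"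
proof (rule Bochner_Integration.integrable_bound)
  show "integrable M (\<lambda>x. (norm (f x))\<^sup>2 + (norm (g x))\<^sup>2)" using assms by (simp add: L2_def)
  show "(\<lambda>x. f x \<bullet> g x) \<in> borel_measurable M" using assms[THEN L2_measurable] by measurable
  have "\<bar>f x \<bullet> g x\<bar> \<le> (norm (f x))\<^sup>2 + (norm (g x))\<^sup>2" for x
  proof -
    have "\<bar>f x \<bullet> g x\<bar> \<le> norm (f x) * norm (g x)" by (rule Cauchy_Schwarz_ineq2)
    moreover have "2 * (norm (f x) * norm (g x)) \<le> (norm (f x))\<^sup>2 + (norm (g x))\<^sup>2"
      using sum_squares_bound[of "norm (f x)" "norm (g x)"] by simp
    moreover have "0 \<le> (norm (f x))\<^sup>2 + (norm (g x))\<^sup>2" by simp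
    ultimately show ?thesis by linarith
  qed
  then show "AE x in M. norm (f x \<bullet> g x) \<le> norm ((norm (f x))\<^sup>2 + (norm (g x))\<^sup>2)" by simp
qed

lemma L2_mult_integrable:
  fixes f g :: "'a \<Rightarrow> real"
  shows "L2 M f \<Longrightarrow> L2 M g \<Longrightarrow> integrable M (\<lambda>x. f x * g x)"
  using L2_inner_integrable[of M f g] by simp

lemma norm_add_squared: "(norm (a + b :: 'a::real_inner))\<^sup>2 = (norm a)\<^sup>2 + 2 * (a \<bullet> b) + (norm b)\<^sup>2"
  by (simp add: power2_norm_eq_inner inner_add_left inner_add_right inner_commute)

lemma L2_scaleR: "L2 M f \<Longrightarrow> L2 M (\<lambda>x. c *\<^sub>R f x)"
  unfolding L2_def by (intro conjI borel_measurable_scaleR) (auto simp: power_mult_distrib)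

lemma L2_add:
  assumes "L2 M f" "L2 M g"
  shows "L2 M (\<lambda>x. f x + g x)"
  unfolding L2_def
proof
  show "(\<lambda>x. f x + g x) \<in> borel_measurable M" using assms[THEN L2_measurable] by measurable
  show "integrable M (\<lambda>x. (norm (f x + g x))\<^sup>2)"
    using assms[THEN L2_integrable] L2_inner_integrable[OF assms] by (simp add: norm_add_squared)
qed

lemma L2_diff:
  assumes "L2 M f" "L2 M g"
  shows "L2 M (\<lambda>x. f x - g x)"
  using L2_add[OF assms(1) L2_scaleR[OF assms(2), of "-1"]] by simp

lemma L2_bound:
  assumes "L2 M f" "g \<in> borel_measurable M" "\<And>x. norm (g x) \<le> B * norm (f x)"
  shows "L2 M g"
  unfolding L2_def
proof
  show "integrable M (\<lambda>x. (norm (g x))\<^sup>2)"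
  proof (rule Bochner_Integration.integrable_bound)
    show "integrable M (\<lambda>x. B\<^sup>2 * (norm (f x))\<^sup>2)" using assms(1) by (simp add: L2_def)
    show "(\<lambda>x. (norm (g x))\<^sup>2) \<in> borel_measurable M" using assms(2) by simp
    show "AE x in M. norm ((norm (g x))\<^sup>2) \<le> norm (B\<^sup>2 * (norm (f x))\<^sup>2)"
      using power_mono[OF assms(3) norm_ge_zero, of _ 2] by (simp add: power_mult_distrib)
  qed
qed fact

lemma L2_inner: "L2 M G \<Longrightarrow> L2 M (\<lambda>x. G x \<bullet> b)"
  by (rule L2_bound[of M G _ "norm b"])
     (auto simp: L2_def mult.commute[of "norm b"] intro: Cauchy_Schwarz_ineq2)

lemma L2_sum: "(\<And>i. i \<in> I \<Longrightarrow> L2 M (f i)) \<Longrightarrow> L2 M (\<lambda>x. \<Sum>i\<in>I. f i x)"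
proof (induction I rule: infinite_finite_induct)
  case (insert i I)
  then show ?case using L2_add[of M "f i" "\<lambda>x. \<Sum>i\<in>I. f i x"] by simp
qed (simp_all add: L2_def)

lemma L2_Cauchy_Schwarz:
  assumes "L2 M f" "L2 M g"
  shows "(LINT x|M. f x \<bullet> g x)\<^sup>2 \<le> (LINT x|M. (norm (f x))\<^sup>2) * (LINT x|M. (norm (g x))\<^sup>2)"
proof -
  define A B C where "A = (LINT x|M. (norm (f x))\<^sup>2)" "B = (LINT x|M. f x \<bullet> g x)" "C = (LINT x|M. (norm (g x))\<^sup>2)"
  have q: "0 \<le> A + 2 * t * B + t\<^sup>2 * C" for t
  proof -
    have "0 \<le> (LINT x|M. (norm (f x + t *\<^sub>R g x))\<^sup>2)" by simp
    also have "\<dots> = (LINT x|M. (norm (f x))\<^sup>2 + (2 * t) * (f x \<bullet> g x) + t\<^sup>2 * (norm (g x))\<^sup>2)"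
      by (simp add: norm_add_squared power_mult_distrib mult.assoc)
    also have "\<dots> = A + 2 * t * B + t\<^sup>2 * C"
      using assms L2_inner_integrable[OF assms] by (simp add: L2_def A_B_C_def)
    finally show ?thesis .
  qed
  have "C \<ge> 0" by (simp add: A_B_C_def)
  show ?thesis
  proof (cases "C = 0")
    case True
    have "B = 0"
    proof (rule ccontr)
      assume "B \<noteq> 0"
      \<comment> \<open>This t gives the affine function A + 2 t B the value -1.\<close>
      then show False using q[of "- (A + 1) / (2 * B)"] True by (simp add: field_simps)
    qed
    then show ?thesis using True by (simp flip: A_B_C_def)
  next
    case False
    with \<open>C \<ge> 0\<close> have "C > 0" by simp
    have "0 \<le> A - B\<^sup>2 / C"
      using q[of "- B / C"] \<open>C > 0\<close> by (simp add: power2_eq_square field_simps)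
    then show ?thesis using \<open>C > 0\<close> by (simp add: field_simps flip: A_B_C_def)
  qed
qed

lemma test_functions_L2: "\<phi> \<in> test_functions U \<Longrightarrow> L2 lebesgue \<phi>"
  unfolding L2_def
proof
  assume \<phi>: "\<phi> \<in> test_functions U"
  then show "\<phi> \<in> borel_measurable lebesgue" by (rule test_functions_measurable)
  have "(\<lambda>x. \<phi> x * \<phi> x) \<in> test_functions UNIV"
    using \<phi> by (auto intro: test_functions_mult test_functions_mono dest: test_functions_smooth)
  then show "integrable lebesgue (\<lambda>x. (norm (\<phi> x))\<^sup>2)"
    using test_functions_integrable by (fastforce simp: power2_eq_square)
qed

lemma test_functions_gradient_L2: "\<phi> \<in> test_functions U \<Longrightarrow> L2 lebesgue (gradient \<phi>)"
  unfolding gradient_eq_pd[abs_def]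
proof (rule L2_sum)
  fix b :: 'a assume "\<phi> \<in> test_functions U" "b \<in> Basis"
  then have "L2 lebesgue (pd b \<phi>)" by (metis test_functions_pd test_functions_L2)
  then show "L2 lebesgue (\<lambda>x. pd b \<phi> x *\<^sub>R b)"
    by (rule L2_bound[where B="norm b"]) (use \<open>L2 lebesgue (pd b \<phi>)\<close> in \<open>auto simp: L2_def\<close>)
qed

lemma L2_lebesgue_on:
  assumes "L2 lebesgue f" "S \<in> sets lebesgue" shows "L2 (lebesgue_on S) f"
  unfolding L2_def
proof
  show "f \<in> borel_measurable (lebesgue_on S)"
    using L2_measurable[OF assms(1)] by (rule measurable_restrict_space1)
  show "integrable (lebesgue_on S) (\<lambda>x. (norm (f x))\<^sup>2)"
    using integrable_mult_indicator[OF assms(2) L2_integrable[OF assms(1)]] assms(2)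
    by (subst integrable_restrict_space) auto
qed

section \<open>Weak gradients and membership in \<open>H10\<close>\<close>

lemma has_H1_gradient_iff:
  "has_H1_gradient U f G \<longleftrightarrow> L2 (lebesgue_on U) f \<and> L2 (lebesgue_on U) G \<and>
    (\<forall>\<phi>\<in>test_functions U. \<forall>b\<in>Basis.
      (LINT x|lebesgue_on U. f x * pd b \<phi> x) = - (LINT x|lebesgue_on U. \<phi> x * (G x \<bullet> b)))"
  if U: "U \<in> sets lebesgue"
proof -
  have "((LINT x|lebesgue_on U. f x *\<^sub>R gradient \<phi> x) = - (LINT x|lebesgue_on U. \<phi> x *\<^sub>R G x)) \<longleftrightarrow>
     (\<forall>b\<in>Basis. (LINT x|lebesgue_on U. f x * pd b \<phi> x) = - (LINT x|lebesgue_on U. \<phi> x * (G x \<bullet> b)))"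
    if f: "L2 (lebesgue_on U) f" and G: "L2 (lebesgue_on U) G" and \<phi>: "\<phi> \<in> test_functions U" for \<phi>
  proof -
    have s\<phi>: "L2 (lebesgue_on U) \<phi>" "L2 (lebesgue_on U) (gradient \<phi>)"
      using L2_lebesgue_on U \<phi> test_functions_L2 test_functions_gradient_L2 by blast+
    \<comment> \<open>Integrability is what lets the inner product with b enter the Bochner
      integral; it is obtained component by component.\<close>
    have ip: "integrable (lebesgue_on U) (\<lambda>x. h x *\<^sub>R H x)"
      if "L2 (lebesgue_on U) h" "L2 (lebesgue_on U) H" for h :: "'a \<Rightarrow> real" and H :: "'a \<Rightarrow> 'a"
    proof -
      have "integrable (lebesgue_on U) (\<lambda>x. \<Sum>b\<in>Basis. (h x * (H x \<bullet> b)) *\<^sub>R b)"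
        by (intro Bochner_Integration.integrable_sum integrable_scaleR_left L2_mult_integrable L2_inner that)
      moreover have "(\<Sum>b\<in>Basis. (h x * (H x \<bullet> b)) *\<^sub>R b) = h x *\<^sub>R H x" for x
        using euclidean_representation[of "h x *\<^sub>R H x"] by simp
      ultimately show ?thesis by simp
    qed
    have 1: "(LINT x|lebesgue_on U. f x *\<^sub>R gradient \<phi> x) \<bullet> b = (LINT x|lebesgue_on U. f x * pd b \<phi> x)"
      if "b \<in> Basis" for b
      using integral_inner_left[of b, OF ip[OF f s\<phi>(2)]] that by (simp add: gradient_inner_Basis)
    have 2: "(LINT x|lebesgue_on U. \<phi> x *\<^sub>R G x) \<bullet> b = (LINT x|lebesgue_on U. \<phi> x * (G x \<bullet> b))" for b
      using integral_inner_left[of b, OF ip[OF s\<phi>(1) G]] by simp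
    show ?thesis
      by (subst euclidean_eq_iff) (auto simp: 1 2)
  qed
  then show ?thesis unfolding has_H1_gradient_def square_integrable_iff_L2 by blast
qed

lemma has_H1_gradient_UNIV_iff:
  "has_H1_gradient UNIV f G \<longleftrightarrow> L2 lebesgue f \<and> L2 lebesgue G \<and>
    (\<forall>\<phi>\<in>test_functions UNIV. \<forall>b\<in>Basis.
      (LINT x|lebesgue. f x * pd b \<phi> x) = - (LINT x|lebesgue. \<phi> x * (G x \<bullet> b)))"
  using has_H1_gradient_iff[of UNIV f G] by (simp add: lebesgue_on_UNIV_eq)

lemma integral_lebesgue_on_vanish:
  fixes f :: "'a::euclidean_space \<Rightarrow> real"
  assumes "U \<in> sets lebesgue" "\<And>x. x \<notin> U \<Longrightarrow> f x = 0"
  shows "(LINT x|lebesgue_on U. f x) = (LINT x|lebesgue. f x)"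
proof -
  have "(LINT x|lebesgue_on U. f x) = (LINT x|lebesgue. indicator U x *\<^sub>R f x)"
    using assms(1) by (subst integral_restrict_space) auto
  also have "(\<lambda>x. indicator U x *\<^sub>R f x) = f" using assms(2) by (auto simp: indicator_def fun_eq_iff)
  finally show ?thesis by simp
qed

lemma has_H1_gradient_restrict:
  assumes "has_H1_gradient UNIV f G" "U \<in> sets lebesgue"
  shows "has_H1_gradient U f G"
  unfolding has_H1_gradient_iff[OF assms(2)]
proof (intro conjI ballI)
  show "L2 (lebesgue_on U) f" "L2 (lebesgue_on U) G"
    using assms L2_lebesgue_on by (auto simp: has_H1_gradient_UNIV_iff)
next
  fix \<phi> b assume *: "\<phi> \<in> test_functions U" "b \<in> (Basis :: 'a set)"
  then have "\<phi> \<in> test_functions UNIV" using test_functions_mono by auto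
  then show "(LINT x|lebesgue_on U. f x * pd b \<phi> x) = - (LINT x|lebesgue_on U. \<phi> x * (G x \<bullet> b))"
    using assms * test_functions_vanish[OF test_functions_pd[OF *]] test_functions_vanish[OF *(1)]
    by (simp add: integral_lebesgue_on_vanish has_H1_gradient_UNIV_iff)
qed

text \<open>The shape of the limiting arguments below: D does not depend on the approximating test
  function, and Cauchy-Schwarz bounds its square by e^2 C for every accuracy e.\<close>

lemma eq_0_if_square_le:
  fixes D :: real
  assumes "\<And>e. 0 < e \<Longrightarrow> D\<^sup>2 \<le> e\<^sup>2 * C"
  shows "D = 0"
proof (rule ccontr)
  assume "D \<noteq> 0"
  have "C \<ge> 0" using order_trans[OF zero_le_power2 assms[of 1]] by simp
  define e where "e = \<bar>D\<bar> / sqrt (2 * (C + 1))"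
  have "e > 0" using \<open>D \<noteq> 0\<close> \<open>C \<ge> 0\<close> by (simp add: e_def)
  have "e\<^sup>2 = D\<^sup>2 / (2 * (C + 1))" using \<open>C \<ge> 0\<close> by (simp add: e_def power_divide)
  with assms[OF \<open>e > 0\<close>] have "D\<^sup>2 * (2 * (C + 1)) \<le> D\<^sup>2 * C"
    using \<open>C \<ge> 0\<close> by (simp add: field_simps)
  then show False using \<open>D \<noteq> 0\<close> \<open>C \<ge> 0\<close> by (simp add: mult_le_cancel_left)
qed

text \<open>Integration by parts passes to L2 limits, so a limit of gradients of test functions is
  automatically a weak gradient. Membership then reduces to the approximation property.\<close>

lemma H10I:
  fixes f :: "'a::euclidean_space \<Rightarrow> real"
  assumes f: "L2 lebesgue f" and G: "L2 lebesgue G"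
    and app: "\<And>e. 0 < e \<Longrightarrow> \<exists>\<phi>\<in>test_functions U.
        (LINT x|lebesgue. (f x - \<phi> x)\<^sup>2) + (LINT x|lebesgue. (norm (G x - gradient \<phi> x))\<^sup>2) < e\<^sup>2"
  shows "f \<in> H10 U" "has_H1_gradient UNIV f G"
proof -
  show *: "has_H1_gradient UNIV f G"
    unfolding has_H1_gradient_UNIV_iff
  proof (intro conjI ballI f G)
    fix \<psi> :: "'a \<Rightarrow> real" and b :: 'a assume \<psi>: "\<psi> \<in> test_functions UNIV" and b: "b \<in> Basis"
    have s: "L2 lebesgue \<psi>" "L2 lebesgue (pd b \<psi>)" "L2 lebesgue (\<lambda>x. \<psi> x *\<^sub>R b)"
    proof -
      show s\<psi>: "L2 lebesgue \<psi>" by (rule test_functions_L2[OF \<psi>])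
      show "L2 lebesgue (pd b \<psi>)" by (rule test_functions_L2[OF test_functions_pd[OF \<psi> b]])
      show "L2 lebesgue (\<lambda>x. \<psi> x *\<^sub>R b)"
      proof (rule L2_bound[OF s\<psi>, where B=1])
        show "(\<lambda>x. \<psi> x *\<^sub>R b) \<in> borel_measurable lebesgue"
          using L2_measurable[OF s\<psi>] by measurable
      qed (simp add: b)
    qed
    define C where "C = (LINT x|lebesgue. (norm (pd b \<psi> x))\<^sup>2) + (LINT x|lebesgue. (norm (\<psi> x *\<^sub>R b))\<^sup>2)"
    \<comment> \<open>The defect in the weak gradient identity. For a test function in place of f it
      is 0, so it equals the defect of f - \<phi>, which is small.\<close>
    define D where "D = (LINT x|lebesgue. f x * pd b \<psi> x) + (LINT x|lebesgue. \<psi> x * (G x \<bullet> b))"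
    have "D = 0"
    proof (rule eq_0_if_square_le)
      fix e :: real assume "e > 0"
      obtain \<phi> where \<phi>: "\<phi> \<in> test_functions U"
        "(LINT x|lebesgue. (f x - \<phi> x)\<^sup>2) + (LINT x|lebesgue. (norm (G x - gradient \<phi> x))\<^sup>2) < e\<^sup>2"
        using app[OF \<open>e > 0\<close>] by blast
      note s\<phi> = test_functions_L2[OF \<phi>(1)] test_functions_gradient_L2[OF \<phi>(1)]
      have d: "L2 lebesgue (\<lambda>x. f x - \<phi> x)" "L2 lebesgue (\<lambda>x. G x - gradient \<phi> x)"
        using f G s\<phi> by (auto intro: L2_diff)
      have "(LINT x|lebesgue. \<phi> x * pd b \<psi> x) = - (LINT x|lebesgue. \<psi> x * pd b \<phi> x)"
        using \<phi> \<psi> b by (intro integral_by_parts_test[of UNIV]) (auto intro: test_functions_mono test_functions_smooth)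
      moreover have "(LINT x|lebesgue. f x * pd b \<psi> x) = (LINT x|lebesgue. (f x - \<phi> x) * pd b \<psi> x) + (LINT x|lebesgue. \<phi> x * pd b \<psi> x)"
        using L2_mult_integrable[OF d(1) s(2)] L2_mult_integrable[OF s\<phi>(1) s(2)]
        by (simp flip: Bochner_Integration.integral_add add: algebra_simps)
      moreover have "(LINT x|lebesgue. \<psi> x * (G x \<bullet> b)) = (LINT x|lebesgue. (G x - gradient \<phi> x) \<bullet> (\<psi> x *\<^sub>R b)) + (LINT x|lebesgue. \<psi> x * pd b \<phi> x)"
        using L2_inner_integrable[OF d(2) s(3)] L2_inner_integrable[OF s\<phi>(2) s(3)] b
        by (simp flip: Bochner_Integration.integral_add add: algebra_simps inner_diff_left gradient_inner_Basis)
      ultimately have D: "D = (LINT x|lebesgue. (f x - \<phi> x) * pd b \<psi> x) + (LINT x|lebesgue. (G x - gradient \<phi> x) \<bullet> (\<psi> x *\<^sub>R b))"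
        (is "D = ?a + ?b") by (simp add: D_def)
      have "?a\<^sup>2 \<le> (LINT x|lebesgue. (f x - \<phi> x)\<^sup>2) * (LINT x|lebesgue. (norm (pd b \<psi> x))\<^sup>2)"
        using L2_Cauchy_Schwarz[OF d(1) s(2)] by simp
      also have "\<dots> \<le> e\<^sup>2 * (LINT x|lebesgue. (norm (pd b \<psi> x))\<^sup>2)"
      proof (rule mult_right_mono)
        have "0 \<le> (LINT x|lebesgue. (norm (G x - gradient \<phi> x))\<^sup>2)" by simp
        then show "(LINT x|lebesgue. (f x - \<phi> x)\<^sup>2) \<le> e\<^sup>2" using \<phi>(2) by linarith
      qed simp
      finally have a: "?a\<^sup>2 \<le> e\<^sup>2 * (LINT x|lebesgue. (norm (pd b \<psi> x))\<^sup>2)" .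
      have "?b\<^sup>2 \<le> (LINT x|lebesgue. (norm (G x - gradient \<phi> x))\<^sup>2) * (LINT x|lebesgue. (norm (\<psi> x *\<^sub>R b))\<^sup>2)"
        by (rule L2_Cauchy_Schwarz[OF d(2) s(3)])
      also have "\<dots> \<le> e\<^sup>2 * (LINT x|lebesgue. (norm (\<psi> x *\<^sub>R b))\<^sup>2)"
      proof (rule mult_right_mono)
        have "0 \<le> (LINT x|lebesgue. (f x - \<phi> x)\<^sup>2)" by simp
        then show "(LINT x|lebesgue. (norm (G x - gradient \<phi> x))\<^sup>2) \<le> e\<^sup>2" using \<phi>(2) by linarith
      qed simp
      finally have b': "?b\<^sup>2 \<le> e\<^sup>2 * (LINT x|lebesgue. (norm (\<psi> x *\<^sub>R b))\<^sup>2)" .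
      have "D\<^sup>2 \<le> 2 * ?a\<^sup>2 + 2 * ?b\<^sup>2"
        unfolding D using sum_squares_bound[of ?a ?b] by (simp add: power2_sum)
      also have "\<dots> \<le> e\<^sup>2 * (2 * C)" using a b' by (simp add: C_def algebra_simps)
      finally show "D\<^sup>2 \<le> e\<^sup>2 * (2 * C)" .
    qed
    then show "(LINT x|lebesgue. f x * pd b \<psi> x) = - (LINT x|lebesgue. \<psi> x * (G x \<bullet> b))"
      by (simp add: D_def)
  qed
  then show "f \<in> H10 U" using app unfolding H10_def by blast
qed

lemma
  assumes "\<phi> \<in> test_functions U"
  shows test_functions_H10: "\<phi> \<in> H10 U"
    and test_functions_H1_gradient: "has_H1_gradient UNIV \<phi> (gradient \<phi>)"
proof -
  have "\<exists>\<psi>\<in>test_functions U. (LINT x|lebesgue. (\<phi> x - \<psi> x)\<^sup>2) +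
      (LINT x|lebesgue. (norm (gradient \<phi> x - gradient \<psi> x))\<^sup>2) < e\<^sup>2" if "e > 0" for e :: real
    by (rule bexI[OF _ assms]) (use that in simp)
  note * = H10I[OF test_functions_L2[OF assms] test_functions_gradient_L2[OF assms] this]
  show "\<phi> \<in> H10 U" "has_H1_gradient UNIV \<phi> (gradient \<phi>)" using * by simp_all
qed


section \<open>Bounds for the capacity\<close>

lemma H10E:
  assumes "f \<in> H10 U"
  obtains G where "has_H1_gradient UNIV f G" "L2 lebesgue f" "L2 lebesgue G"
    "\<forall>e>0. \<exists>\<phi>\<in>test_functions U. (LINT x|lebesgue. (f x - \<phi> x)\<^sup>2) < e\<^sup>2 \<and>
        (LINT x|lebesgue. (norm (G x - gradient \<phi> x))\<^sup>2) < e\<^sup>2"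
proof -
  obtain G where G: "has_H1_gradient UNIV f G" "\<And>e. 0 < e \<Longrightarrow> \<exists>\<phi>\<in>test_functions U.
      (LINT x|lebesgue. (f x - \<phi> x)\<^sup>2) + (LINT x|lebesgue. (norm (G x - gradient \<phi> x))\<^sup>2) < e\<^sup>2"
    using assms unfolding H10_def by blast
  show ?thesis
  proof (rule that[of G])
    show "has_H1_gradient UNIV f G" "L2 lebesgue f" "L2 lebesgue G"
      using G(1) by (auto simp: has_H1_gradient_UNIV_iff)
    show "\<forall>e>0. \<exists>\<phi>\<in>test_functions U. (LINT x|lebesgue. (f x - \<phi> x)\<^sup>2) < e\<^sup>2 \<and>
        (LINT x|lebesgue. (norm (G x - gradient \<phi> x))\<^sup>2) < e\<^sup>2"
    proof (intro allI impI)
    fix e :: real assume "0 < e"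
    then obtain \<phi> where \<phi>: "\<phi> \<in> test_functions U"
      "(LINT x|lebesgue. (f x - \<phi> x)\<^sup>2) + (LINT x|lebesgue. (norm (G x - gradient \<phi> x))\<^sup>2) < e\<^sup>2"
      using G(2) by blast
    have "0 \<le> (LINT x|lebesgue. (f x - \<phi> x)\<^sup>2)" "0 \<le> (LINT x|lebesgue. (norm (G x - gradient \<phi> x))\<^sup>2)"
      by simp_all
    then have "(LINT x|lebesgue. (f x - \<phi> x)\<^sup>2) < e\<^sup>2 \<and> (LINT x|lebesgue. (norm (G x - gradient \<phi> x))\<^sup>2) < e\<^sup>2"
      using \<phi>(2) by linarith
    then show "\<exists>\<phi>\<in>test_functions U. (LINT x|lebesgue. (f x - \<phi> x)\<^sup>2) < e\<^sup>2 \<and>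
        (LINT x|lebesgue. (norm (G x - gradient \<phi> x))\<^sup>2) < e\<^sup>2" using \<phi>(1) by blast
    qed
  qed
qed

lemma H10_has_gradient: "f \<in> H10 U \<Longrightarrow> \<exists>G. has_H1_gradient UNIV f G"
  unfolding H10_def by blast

lemma H10_L2: "f \<in> H10 U \<Longrightarrow> L2 lebesgue f"
  using H10_has_gradient has_H1_gradient_UNIV_iff by blast

text \<open>The weak gradient is tested with the partial derivatives of \<phi>. The right side does
  not mention G, so all weak gradients of f pair equally with the gradient of \<phi>.\<close>

lemma weak_gradient_pairing:
  assumes U: "U \<in> sets lebesgue" and f: "has_H1_gradient U f G" and \<phi>: "\<phi> \<in> test_functions U"
  shows "(LINT x|lebesgue_on U. G x \<bullet> gradient \<phi> x) = - (LINT x|lebesgue. f x * laplacian \<phi> x)"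
proof -
  have s: "L2 (lebesgue_on U) f" "L2 (lebesgue_on U) G" using f by (auto simp: has_H1_gradient_iff[OF U])
  have t: "pd b \<phi> \<in> test_functions U" "pd b (pd b \<phi>) \<in> test_functions U" if "b \<in> Basis" for b
    using test_functions_pd[OF \<phi>] test_functions_pd that by blast+
  have q: "L2 (lebesgue_on U) (pd b \<phi>)" "L2 (lebesgue_on U) (pd b (pd b \<phi>))" if "b \<in> Basis" for b
    using t[OF that, THEN test_functions_L2] U by (auto intro: L2_lebesgue_on)
  have "(LINT x|lebesgue_on U. G x \<bullet> gradient \<phi> x) = (LINT x|lebesgue_on U. (\<Sum>b\<in>Basis. pd b \<phi> x * (G x \<bullet> b)))"
    by (simp add: inner_gradient mult.commute)
  also have "\<dots> = (\<Sum>b\<in>Basis. LINT x|lebesgue_on U. pd b \<phi> x * (G x \<bullet> b))"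
    using q s by (intro Bochner_Integration.integral_sum L2_mult_integrable L2_inner)
  also have "\<dots> = (\<Sum>b\<in>Basis. - (LINT x|lebesgue_on U. f x * pd b (pd b \<phi>) x))"
    using f t(1) by (simp add: has_H1_gradient_iff[OF U])
  also have "\<dots> = - (\<Sum>b\<in>Basis. (LINT x|lebesgue_on U. f x * pd b (pd b \<phi>) x))"
    by (simp add: sum_negf)
  also have "(\<Sum>b\<in>Basis. (LINT x|lebesgue_on U. f x * pd b (pd b \<phi>) x)) = (LINT x|lebesgue_on U. (\<Sum>b\<in>Basis. f x * pd b (pd b \<phi>) x))"
    using q s by (intro Bochner_Integration.integral_sum[symmetric] L2_mult_integrable)
  also have "\<dots> = (LINT x|lebesgue_on U. f x * laplacian \<phi> x)"
    by (simp add: laplacian_def sum_distrib_left)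
  also have "\<dots> = (LINT x|lebesgue. f x * laplacian \<phi> x)"
    using U test_functions_vanish[OF test_functions_laplacian[OF \<phi>]] by (intro integral_lebesgue_on_vanish) auto
  finally show ?thesis .
qed

text \<open>Weak gradients on \<open>U\<close> are not compared pointwise: \<open>G\<close> and the approximable gradient \<open>G'\<close>
  have the same pairing with gradients of test functions, so \<open>G'\<close> is a projection of \<open>G\<close>.\<close>

lemma H10_gradient_energy_le:
  assumes U: "U \<in> sets lebesgue" and G: "has_H1_gradient U f G" and G': "has_H1_gradient UNIV f G'"
    and app: "\<And>e. 0 < e \<Longrightarrow> \<exists>\<phi>\<in>test_functions U. (LINT x|lebesgue. (norm (G' x - gradient \<phi> x))\<^sup>2) < e\<^sup>2"
  shows "(LINT x|lebesgue. (norm (G' x))\<^sup>2) \<le> (LINT x|lebesgue_on U. (norm (G x))\<^sup>2)"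
proof -
  define A A' where "A = (LINT x|lebesgue_on U. (norm (G x))\<^sup>2)" and "A' = (LINT x|lebesgue. (norm (G' x))\<^sup>2)"
  have sG: "L2 (lebesgue_on U) G" "L2 lebesgue G'"
    using G G' by (auto simp: has_H1_gradient_iff[OF U] has_H1_gradient_UNIV_iff)
  have "A' \<le> A + e" if "e > 0" for e
  proof -
    have "sqrt e > 0" "(sqrt e)\<^sup>2 = e" using that by simp_all
    then obtain \<phi> where \<phi>: "\<phi> \<in> test_functions U" "(LINT x|lebesgue. (norm (G' x - gradient \<phi> x))\<^sup>2) < e"
      using app[of "sqrt e"] by auto
    have s\<phi>: "L2 lebesgue (gradient \<phi>)" using \<phi>(1) by (rule test_functions_gradient_L2)
    then have s\<phi>': "L2 (lebesgue_on U) (gradient \<phi>)" using U by (rule L2_lebesgue_on)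
    have \<phi>': "\<phi> \<in> test_functions UNIV" using \<phi>(1) test_functions_mono by auto
    have ex: "(norm (a - b))\<^sup>2 = (norm a)\<^sup>2 - 2 * (a \<bullet> b) + (norm b)\<^sup>2" for a b :: 'a
      using norm_add_squared[of a "- b"] by simp
    have p: "(LINT x|lebesgue_on U. G x \<bullet> gradient \<phi> x) = (LINT x|lebesgue. G' x \<bullet> gradient \<phi> x)"
      using weak_gradient_pairing[OF U G \<phi>(1)] weak_gradient_pairing[OF _ G' \<phi>'] by (simp add: lebesgue_on_UNIV_eq)
    have n: "(LINT x|lebesgue_on U. (norm (gradient \<phi> x))\<^sup>2) = (LINT x|lebesgue. (norm (gradient \<phi> x))\<^sup>2)"
      using U \<phi>(1) by (intro integral_lebesgue_on_vanish) (auto simp: test_functions_gradient_vanish)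
    \<comment> \<open>The cross terms of G and G' with the gradient of \<phi> agree, so expanding
      the square gives A - A' plus the approximation error of G'.\<close>
    have "0 \<le> (LINT x|lebesgue_on U. (norm (G x - gradient \<phi> x))\<^sup>2)" by simp
    also have "\<dots> = A - 2 * (LINT x|lebesgue_on U. G x \<bullet> gradient \<phi> x) + (LINT x|lebesgue_on U. (norm (gradient \<phi> x))\<^sup>2)"
      using L2_integrable[OF sG(1)] L2_integrable[OF s\<phi>'] L2_inner_integrable[OF sG(1) s\<phi>'] by (simp add: ex A_def)
    also have "\<dots> = A - A' + (A' - 2 * (LINT x|lebesgue. G' x \<bullet> gradient \<phi> x) + (LINT x|lebesgue. (norm (gradient \<phi> x))\<^sup>2))"
      by (simp add: p n)
    also have "A' - 2 * (LINT x|lebesgue. G' x \<bullet> gradient \<phi> x) + (LINT x|lebesgue. (norm (gradient \<phi> x))\<^sup>2) =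
        (LINT x|lebesgue. (norm (G' x - gradient \<phi> x))\<^sup>2)"
      using L2_integrable[OF sG(2)] L2_integrable[OF s\<phi>] L2_inner_integrable[OF sG(2) s\<phi>] by (simp add: ex A'_def)
    finally show ?thesis using \<phi>(2) by linarith
  qed
  then have "A' \<le> A" by (rule field_le_epsilon)
  then show ?thesis by (simp add: A_def A'_def)
qed

text \<open>Integrated form of the fact that members of \<open>H10 U\<close> vanish almost
  everywhere off U: since L is 0 on U, f may be replaced by f - \<phi>, which is small in
  L2.\<close>

lemma H10_integral_test_eq_0:
  assumes f: "f \<in> H10 U" and L: "L2 lebesgue L" "\<And>x. x \<in> U \<Longrightarrow> L x = 0"
  shows "(LINT x|lebesgue. f x * L x) = 0"
proof (rule eq_0_if_square_le)
  fix e :: real assume "0 < e"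
  obtain G where "has_H1_gradient UNIV f G" and G: "L2 lebesgue f" "L2 lebesgue G" "\<forall>e>0. \<exists>\<phi>\<in>test_functions U. (LINT x|lebesgue. (f x - \<phi> x)\<^sup>2) < e\<^sup>2 \<and>
        (LINT x|lebesgue. (norm (G x - gradient \<phi> x))\<^sup>2) < e\<^sup>2"
    by (rule H10E[OF f])
  then obtain \<phi> where \<phi>: "\<phi> \<in> test_functions U" "(LINT x|lebesgue. (f x - \<phi> x)\<^sup>2) < e\<^sup>2"
    using \<open>0 < e\<close> by blast
  have "f x * L x = (f x - \<phi> x) \<bullet> L x" for x
    using L(2)[of x] test_functions_vanish[OF \<phi>(1), of x] by (cases "x \<in> U") auto
  then have "(LINT x|lebesgue. f x * L x)\<^sup>2 = (LINT x|lebesgue. (f x - \<phi> x) \<bullet> L x)\<^sup>2" by (simp only:)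
  also have "\<dots> \<le> (LINT x|lebesgue. (norm (f x - \<phi> x))\<^sup>2) * (LINT x|lebesgue. (norm (L x))\<^sup>2)"
    by (intro L2_Cauchy_Schwarz L2_diff G(1) test_functions_L2[OF \<phi>(1)] L(1))
  also have "\<dots> \<le> e\<^sup>2 * (LINT x|lebesgue. (norm (L x))\<^sup>2)"
    using \<phi>(2) by (intro mult_right_mono) auto
  finally show "(LINT x|lebesgue. f x * L x)\<^sup>2 \<le> e\<^sup>2 * (LINT x|lebesgue. (norm (L x))\<^sup>2)" .
qed

text \<open>The Laplacian of w vanishes on \<Omega> - K, and elsewhere f = u almost everywhere, so u
  may be replaced by f; integration by parts and Cauchy-Schwarz follow. It is f that vanishes at the
  boundary of \<Omega>, while w is a test function on the whole space.\<close>

lemma capacity_competitor_lower_bound: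
  assumes \<Omega>: "\<Omega> \<in> sets lebesgue" and f: "f \<in> H10 \<Omega>" "has_H1_gradient \<Omega> f G" 
    and u: "(\<lambda>x. f x - u x) \<in> H10 (\<Omega> - K)"
    and w: "w \<in> test_functions UNIV" "\<And>x. x \<in> \<Omega> - K \<Longrightarrow> laplacian w x = 0"
  shows "(LINT x|lebesgue. u x * laplacian w x)\<^sup>2 \<le>
    (LINT x|lebesgue_on \<Omega>. (norm (G x))\<^sup>2) * (LINT x|lebesgue_on \<Omega>. (norm (gradient w x))\<^sup>2)"
proof -
  obtain G' where G': "has_H1_gradient UNIV f G'" "L2 lebesgue f" "L2 lebesgue G'"
    "\<forall>e>0. \<exists>\<phi>\<in>test_functions \<Omega>. (LINT x|lebesgue. (f x - \<phi> x)\<^sup>2) < e\<^sup>2 \<and>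
        (LINT x|lebesgue. (norm (G' x - gradient \<phi> x))\<^sup>2) < e\<^sup>2"
    by (rule H10E[OF f(1)])
  note L = test_functions_L2[OF test_functions_laplacian[OF w(1)]]
  have "L2 lebesgue (\<lambda>x. f x - u x)" by (rule H10_L2[OF u])
  note int = L2_mult_integrable[OF G'(2) L] L2_mult_integrable[OF this L]
  have "(LINT x|lebesgue. (f x - u x) * laplacian w x) = 0"
    using u L w(2) by (rule H10_integral_test_eq_0)
  then have "(LINT x|lebesgue. f x * laplacian w x - (f x - u x) * laplacian w x) = (LINT x|lebesgue. f x * laplacian w x)"
    using int by simp
  then have "(LINT x|lebesgue. u x * laplacian w x) = (LINT x|lebesgue. f x * laplacian w x)"
    by (simp add: algebra_simps)
  also have "\<dots> = - (LINT x|lebesgue. G' x \<bullet> gradient w x)"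
    using weak_gradient_pairing[OF _ G'(1) w(1)] by (simp add: lebesgue_on_UNIV_eq)
  finally have 1: "(LINT x|lebesgue. u x * laplacian w x)\<^sup>2 = (LINT x|lebesgue. G' x \<bullet> gradient w x)\<^sup>2" by simp
  \<comment> \<open>The gradient of w is cut down to \<Omega>, so that the part of w beyond \<Omega>
    contributes no energy. The removed part is orthogonal to G', a limit of gradients vanishing off
    \<Omega>.\<close>
  define H where "H x = indicat_real \<Omega> x *\<^sub>R gradient w x" for x
  have gw: "L2 lebesgue (gradient w)" by (rule test_functions_gradient_L2[OF w(1)])
  have sH: "L2 lebesgue H"
  proof (rule L2_bound[OF gw, where B=1])
    show "H \<in> borel_measurable lebesgue"
      unfolding H_def using L2_measurable[OF gw] \<Omega> by (intro borel_measurable_scaleR borel_measurable_indicator)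
  qed (simp add: H_def indicator_def)
  have sD: "L2 lebesgue (\<lambda>x. gradient w x - H x)" by (rule L2_diff[OF gw sH])
  have "(LINT x|lebesgue. G' x \<bullet> (gradient w x - H x)) = 0"
  proof (rule eq_0_if_square_le)
    fix e :: real assume "0 < e"
    then obtain \<phi> where \<phi>: "\<phi> \<in> test_functions \<Omega>" "(LINT x|lebesgue. (norm (G' x - gradient \<phi> x))\<^sup>2) < e\<^sup>2"
      using G'(4) by blast
    have "G' x \<bullet> (gradient w x - H x) = (G' x - gradient \<phi> x) \<bullet> (gradient w x - H x)" for x
      using test_functions_gradient_vanish[OF \<phi>(1), of x] by (cases "x \<in> \<Omega>") (auto simp: H_def)
    then have "(LINT x|lebesgue. G' x \<bullet> (gradient w x - H x))\<^sup>2 = (LINT x|lebesgue. (G' x - gradient \<phi> x) \<bullet> (gradient w x - H x))\<^sup>2"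
      by simp
    also have "\<dots> \<le> (LINT x|lebesgue. (norm (G' x - gradient \<phi> x))\<^sup>2) * (LINT x|lebesgue. (norm (gradient w x - H x))\<^sup>2)"
      by (intro L2_Cauchy_Schwarz L2_diff[OF G'(3)] test_functions_gradient_L2[OF \<phi>(1)] sD)
    also have "\<dots> \<le> e\<^sup>2 * (LINT x|lebesgue. (norm (gradient w x - H x))\<^sup>2)"
      using \<phi>(2) by (intro mult_right_mono) auto
    finally show "(LINT x|lebesgue. G' x \<bullet> (gradient w x - H x))\<^sup>2 \<le> e\<^sup>2 * (LINT x|lebesgue. (norm (gradient w x - H x))\<^sup>2)" .
  qed
  then have "(LINT x|lebesgue. G' x \<bullet> gradient w x) = (LINT x|lebesgue. G' x \<bullet> H x)"
    using L2_inner_integrable[OF G'(3) gw] L2_inner_integrable[OF G'(3) sH] by (simp add: inner_diff_right)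
  with 1 have "(LINT x|lebesgue. u x * laplacian w x)\<^sup>2 = (LINT x|lebesgue. G' x \<bullet> H x)\<^sup>2" by simp
  also have "\<dots> \<le> (LINT x|lebesgue. (norm (G' x))\<^sup>2) * (LINT x|lebesgue. (norm (H x))\<^sup>2)"
    by (rule L2_Cauchy_Schwarz[OF G'(3) sH])
  also have "\<dots> \<le> (LINT x|lebesgue_on \<Omega>. (norm (G x))\<^sup>2) * (LINT x|lebesgue. (norm (H x))\<^sup>2)"
    using G'(4) by (intro mult_right_mono H10_gradient_energy_le[OF \<Omega> f(2) G'(1)]) (blast, simp)
  also have "(LINT x|lebesgue. (norm (H x))\<^sup>2) = (LINT x|lebesgue_on \<Omega>. (norm (H x))\<^sup>2)"
    using \<Omega> by (intro integral_lebesgue_on_vanish[symmetric]) (auto simp: H_def)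
  also have "\<dots> = (LINT x|lebesgue_on \<Omega>. (norm (gradient w x))\<^sup>2)"
    by (rule Bochner_Integration.integral_cong) (auto simp: H_def)
  finally show ?thesis .
qed

section \<open>The capacity as an infimum over competitors\<close>

definition competitor_energies :: "'a::euclidean_space set \<Rightarrow> 'a set \<Rightarrow> ('a \<Rightarrow> real) \<Rightarrow> real set" where
  "competitor_energies \<Omega> K u = {(LINT x|lebesgue_on \<Omega>. (norm (G x))\<^sup>2) | f G.
     f \<in> H10 \<Omega> \<and> has_H1_gradient \<Omega> f G \<and> (\<lambda>x. f x - u x) \<in> H10 (\<Omega> - K)}"

lemma capacity_eq_Inf: "capacity \<Omega> K u = Inf (competitor_energies \<Omega> K u)"
  by (simp add: capacity_def competitor_energies_def)

text \<open>The function u is itself a competitor. This matters because \<open>Inf\<close> of an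
  empty set of reals carries no information.\<close>

lemma competitor_energies_nonempty:
  assumes \<Omega>: "open \<Omega>" and u: "u \<in> H10 \<Omega>"
  shows "competitor_energies \<Omega> K u \<noteq> {}"
proof -
  obtain G where "has_H1_gradient UNIV u G" using H10_has_gradient[OF u] by blast
  then have "has_H1_gradient \<Omega> u G" by (rule has_H1_gradient_restrict) (simp add: \<Omega> borel_open)
  moreover have "(\<lambda>x. 0) \<in> test_functions (\<Omega> - K)"
    by (rule test_functionsI[of _ "{}"]) (auto intro: smooth_on_const)
  then have "(\<lambda>x. u x - u x) \<in> H10 (\<Omega> - K)" using test_functions_H10 by simp
  ultimately show ?thesis using u unfolding competitor_energies_def by blast
qed

lemma capacity_lower_bound:
  assumes \<Omega>: "open \<Omega>" and u: "u \<in> H10 \<Omega>"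
    and w: "w \<in> test_functions UNIV" "\<And>x. x \<in> \<Omega> - K \<Longrightarrow> laplacian w x = 0"
  shows "(LINT x|lebesgue. u x * laplacian w x)\<^sup>2 \<le>
    capacity \<Omega> K u * (LINT x|lebesgue_on \<Omega>. (norm (gradient w x))\<^sup>2)"
proof -
  define E where "E = (LINT x|lebesgue_on \<Omega>. (norm (gradient w x))\<^sup>2)"
  define N where "N = (LINT x|lebesgue. u x * laplacian w x)\<^sup>2"
  define S where "S = competitor_energies \<Omega> K u"
  have m: "\<Omega> \<in> sets lebesgue" using \<Omega> by (simp add: borel_open)
  have le: "N \<le> s * E" if "s \<in> S" for s
    using that capacity_competitor_lower_bound[OF m _ _ _ w] unfolding S_def competitor_energies_def N_def E_def by blast
  have ne: "S \<noteq> {}" unfolding S_def by (rule competitor_energies_nonempty[OF \<Omega> u])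
  have "E \<ge> 0" by (simp add: E_def)
  show ?thesis
  proof (cases "E = 0")
    case True
    then show ?thesis using le ne by (auto simp: N_def E_def)
  next
    case False
    with \<open>E \<ge> 0\<close> have "E > 0" by simp
    have "N / E \<le> Inf S" using le \<open>E > 0\<close> ne by (intro cInf_greatest) (auto simp: field_simps)
    then have "N \<le> Inf S * E" using \<open>E > 0\<close> by (simp add: field_simps)
    then show ?thesis by (simp add: N_def E_def S_def capacity_eq_Inf)
  qed
qed

lemma capacity_nonneg:
  assumes \<Omega>: "open \<Omega>" and u: "u \<in> H10 \<Omega>"
  shows "0 \<le> capacity \<Omega> K u"
  unfolding capacity_eq_Inf using competitor_energies_nonempty[OF assms]
  by (intro cInf_greatest) (auto simp: competitor_energies_def)

text \<open>Since f - u vanishes on V, it equals (1 - \<kappa>)(f - u), and 1 - \<kappa> vanishes on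
  the open set W around K. Approximating u by \<phi> in \<Omega> yields the test functions (f -
  \<phi>)(1 - \<kappa>), whose supports avoid K.\<close>

lemma capacity_upper_bound:
  assumes \<Omega>: "open \<Omega>" and u: "u \<in> H10 \<Omega>" and f: "f \<in> test_functions \<Omega>"
    and V: "\<And>x. x \<in> V \<Longrightarrow> f x = u x"
    and \<kappa>: "\<kappa> \<in> test_functions V" "open W" "K \<subseteq> W" "\<And>x. x \<in> W \<Longrightarrow> \<kappa> x = 1"
  shows "capacity \<Omega> K u \<le> (LINT x|lebesgue. (norm (gradient f x))\<^sup>2)"
proof -
  have m: "\<Omega> \<in> sets lebesgue" using \<Omega> by (simp add: borel_open)
  obtain G where "has_H1_gradient UNIV u G" and G: "L2 lebesgue u" "L2 lebesgue G"
    "\<forall>e>0. \<exists>\<phi>\<in>test_functions \<Omega>. (LINT x|lebesgue. (u x - \<phi> x)\<^sup>2) < e\<^sup>2 \<and>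
        (LINT x|lebesgue. (norm (G x - gradient \<phi> x))\<^sup>2) < e\<^sup>2"
    by (rule H10E[OF u])
  have s\<kappa>: "smooth_on UNIV \<kappa>" by (rule test_functions_smooth[OF \<kappa>(1)])
  define \<eta> where "\<eta> x = 1 - \<kappa> x" for x
  have s\<eta>: "smooth_on UNIV \<eta>" unfolding \<eta>_def by (intro smooth_on_diff smooth_on_const s\<kappa>) simp
  have g\<eta>: "gradient \<eta> x = - gradient \<kappa> x" for x
    unfolding \<eta>_def using gradient_diff[of "\<lambda>x. 1" x \<kappa>] test_functions_differentiable[OF \<kappa>(1)] by simp
  obtain B0 where B0: "\<And>x. \<bar>\<kappa> x\<bar> \<le> B0" using test_functions_bounded[OF \<kappa>(1)] by blast
  have "\<exists>B. \<forall>x. norm (gradient \<kappa> x) \<le> B"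
  proof -
    obtain L where L: "compact L" "\<And>x b. x \<notin> L \<Longrightarrow> pd b \<kappa> x = 0"
      using \<kappa>(1) by (elim test_functionsE) metis
    have "continuous_on UNIV (gradient \<kappa>)"
      unfolding gradient_eq_pd[abs_def]
      by (intro continuous_on_sum continuous_on_scaleR continuous_on_const smooth_on_continuous smooth_on_pd s\<kappa>)
    then show ?thesis
      using L by (intro integrable_compact_support(4)[where K=L]) (auto simp: gradient_eq_pd)
  qed
  then obtain B1 where B1: "\<And>x. norm (gradient \<kappa> x) \<le> B1" by blast
  define B where "B = 1 + \<bar>B0\<bar> + \<bar>B1\<bar>"
  have B: "\<bar>\<eta> x\<bar> \<le> B" "norm (gradient \<kappa> x) \<le> B" "B > 0" for x
    using B0[of x] B1[of x] by (auto simp: B_def \<eta>_def)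
  define g where "g x = f x - u x" for x
  \<comment> \<open>The product rule for \<eta> (f - u) leaves no term with the gradient of \<eta>:
    on V one has f = u, and off V that gradient vanishes.\<close>
  define G' where "G' x = \<eta> x *\<^sub>R (gradient f x - G x)" for x
  have g\<eta>g: "g x = \<eta> x * g x" for x
    using V[of x] test_functions_vanish[OF \<kappa>(1), of x] by (cases "x \<in> V") (auto simp: g_def \<eta>_def)
  have m\<eta>: "\<eta> \<in> borel_measurable lebesgue"
    using test_functions_measurable[OF \<kappa>(1)] unfolding \<eta>_def[abs_def] by measurable
  have sg: "L2 lebesgue g" unfolding g_def by (intro L2_diff test_functions_L2[OF f] G)
  have sfG: "L2 lebesgue (\<lambda>x. gradient f x - G x)" by (intro L2_diff test_functions_gradient_L2[OF f] G)
  have sG': "L2 lebesgue G'"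
  proof (rule L2_bound[OF sfG, where B=B])
    show "G' \<in> borel_measurable lebesgue" unfolding G'_def using m\<eta> L2_measurable[OF sfG] by measurable
    show "norm (G' x) \<le> B * norm (gradient f x - G x)" for x
      using B(1)[of x] by (simp add: G'_def mult_right_mono)
  qed
  have "g \<in> H10 (\<Omega> - K)"
  proof (rule H10I[OF sg sG'])
    fix e :: real assume "0 < e"
    \<comment> \<open>The two errors together stay below 5 B^2 d^2 = 5 e^2 / 9.\<close>
    define d where "d = e / (3 * B)"
    have "d > 0" using \<open>0 < e\<close> B(3) by (simp add: d_def)
    then obtain \<phi> where \<phi>: "\<phi> \<in> test_functions \<Omega>" "(LINT x|lebesgue. (u x - \<phi> x)\<^sup>2) < d\<^sup>2"
        "(LINT x|lebesgue. (norm (G x - gradient \<phi> x))\<^sup>2) < d\<^sup>2" using G(3) by blast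
    define p where "p x = f x - \<phi> x" for x
    define \<psi> where "\<psi> x = p x * \<eta> x" for x
    have p: "p \<in> test_functions \<Omega>"
      using test_functions_add[OF f, of "\<lambda>x. \<phi> x * (-1)"] test_functions_mult[OF \<Omega> \<phi>(1) smooth_on_const, of "-1"]
      by (simp add: p_def[abs_def])
    have \<psi>\<Omega>: "\<psi> \<in> test_functions \<Omega>"
      unfolding \<psi>_def by (rule test_functions_mult[OF \<Omega> p smooth_on_subset[OF s\<eta>]]) simp
    obtain L where L: "compact L" "L \<subseteq> \<Omega>" "\<And>x. x \<notin> L \<Longrightarrow> p x = 0"
      using p by (elim test_functionsE) metis
    have \<psi>: "\<psi> \<in> test_functions (\<Omega> - K)"
    proof (rule test_functionsI)
      show "smooth_on UNIV \<psi>" by (rule test_functions_smooth[OF \<psi>\<Omega>])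
      show "compact (L - W)" using L(1) \<kappa>(2) by (rule compact_diff)
      show "L - W \<subseteq> \<Omega> - K" using L(2) \<kappa>(3) by blast
      show "\<psi> x = 0" if "x \<notin> L - W" for x
        using that L(3)[of x] \<kappa>(4)[of x] by (auto simp: \<psi>_def \<eta>_def)
    qed
    have g\<psi>: "gradient \<psi> x = \<eta> x *\<^sub>R (gradient f x - gradient \<phi> x) - p x *\<^sub>R gradient \<kappa> x" for x
    proof -
      have "gradient p x = gradient f x - gradient \<phi> x"
        unfolding p_def using f \<phi> by (intro gradient_diff test_functions_differentiable)
      then show ?thesis
        unfolding \<psi>_def using gradient_mult[OF test_functions_differentiable[OF p] smooth_on_differentiable[OF s\<eta>], of x]
        by (simp add: g\<eta>)
    qed
    have s1: "L2 lebesgue (\<lambda>x. u x - \<phi> x)" and s2: "L2 lebesgue (\<lambda>x. G x - gradient \<phi> x)"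
      using G test_functions_L2[OF \<phi>(1)] test_functions_gradient_L2[OF \<phi>(1)] by (auto intro: L2_diff)
    have 1: "(g x - \<psi> x)\<^sup>2 \<le> B\<^sup>2 * (u x - \<phi> x)\<^sup>2" for x
    proof -
      have "g x - \<psi> x = \<eta> x * (\<phi> x - u x)"
        unfolding \<psi>_def p_def by (subst g\<eta>g) (simp add: g_def algebra_simps)
      then have "(g x - \<psi> x)\<^sup>2 = (\<eta> x)\<^sup>2 * (u x - \<phi> x)\<^sup>2" by (simp add: power_mult_distrib power2_commute)
      moreover have "(\<eta> x)\<^sup>2 \<le> B\<^sup>2" using B(1)[of x] B(3) by (metis abs_le_square_iff abs_of_pos)
      ultimately show ?thesis by (simp add: mult_right_mono)
    qed
    have 2: "(norm (G' x - gradient \<psi> x))\<^sup>2 \<le> 2 * B\<^sup>2 * (norm (G x - gradient \<phi> x))\<^sup>2 + 2 * B\<^sup>2 * (u x - \<phi> x)\<^sup>2" for x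
    proof -
      \<comment> \<open>The gradient of \<kappa> lives in V, where f = u, so f - \<phi> can be
        replaced by the small function u - \<phi>.\<close>
      have "p x *\<^sub>R gradient \<kappa> x = (u x - \<phi> x) *\<^sub>R gradient \<kappa> x"
        using V[of x] test_functions_gradient_vanish[OF \<kappa>(1), of x] by (cases "x \<in> V") (auto simp: p_def)
      then have "G' x - gradient \<psi> x = (u x - \<phi> x) *\<^sub>R gradient \<kappa> x - \<eta> x *\<^sub>R (G x - gradient \<phi> x)"
        by (simp add: G'_def g\<psi> algebra_simps)
      then have "norm (G' x - gradient \<psi> x) \<le> \<bar>u x - \<phi> x\<bar> * norm (gradient \<kappa> x) + \<bar>\<eta> x\<bar> * norm (G x - gradient \<phi> x)"
        by (metis norm_triangle_ineq4 norm_scaleR)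
      also have "\<dots> \<le> \<bar>u x - \<phi> x\<bar> * B + B * norm (G x - gradient \<phi> x)"
        using B by (intro add_mono mult_left_mono mult_right_mono) auto
      finally have "(norm (G' x - gradient \<psi> x))\<^sup>2 \<le> (\<bar>u x - \<phi> x\<bar> * B + B * norm (G x - gradient \<phi> x))\<^sup>2"
        by (intro power_mono) auto
      also have "\<dots> \<le> 2 * (\<bar>u x - \<phi> x\<bar> * B)\<^sup>2 + 2 * (B * norm (G x - gradient \<phi> x))\<^sup>2"
        using sum_squares_bound[of "\<bar>u x - \<phi> x\<bar> * B" "B * norm (G x - gradient \<phi> x)"] by (simp add: power2_sum)
      finally show ?thesis by (simp add: power_mult_distrib algebra_simps)
    qed
    note i1 = L2_integrable[OF s1, simplified] and i2 = L2_integrable[OF s2]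
    have "(LINT x|lebesgue. (g x - \<psi> x)\<^sup>2) \<le> (LINT x|lebesgue. B\<^sup>2 * (u x - \<phi> x)\<^sup>2)"
      using L2_integrable[OF L2_diff[OF sg test_functions_L2[OF \<psi>]]] i1 by (intro integral_mono 1) auto
    moreover have "(LINT x|lebesgue. (norm (G' x - gradient \<psi> x))\<^sup>2) \<le> 
        (LINT x|lebesgue. 2 * B\<^sup>2 * (norm (G x - gradient \<phi> x))\<^sup>2 + 2 * B\<^sup>2 * (u x - \<phi> x)\<^sup>2)"
      using L2_integrable[OF L2_diff[OF sG' test_functions_gradient_L2[OF \<psi>]]] i1 i2
      by (intro integral_mono 2 Bochner_Integration.integrable_add integrable_mult_right) auto
    moreover have "\<dots> = 2 * B\<^sup>2 * (LINT x|lebesgue. (norm (G x - gradient \<phi> x))\<^sup>2) + 2 * B\<^sup>2 * (LINT x|lebesgue. (u x - \<phi> x)\<^sup>2)"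
      using i1 i2 by simp
    moreover have "(LINT x|lebesgue. B\<^sup>2 * (u x - \<phi> x)\<^sup>2) = B\<^sup>2 * (LINT x|lebesgue. (u x - \<phi> x)\<^sup>2)" by simp
    moreover have "B\<^sup>2 * (LINT x|lebesgue. (u x - \<phi> x)\<^sup>2) < B\<^sup>2 * d\<^sup>2" "2 * B\<^sup>2 * (LINT x|lebesgue. (u x - \<phi> x)\<^sup>2) < 2 * B\<^sup>2 * d\<^sup>2"
      "2 * B\<^sup>2 * (LINT x|lebesgue. (norm (G x - gradient \<phi> x))\<^sup>2) < 2 * B\<^sup>2 * d\<^sup>2"
      using \<phi>(2,3) B(3) by simp_all
    moreover have "B\<^sup>2 * d\<^sup>2 = e\<^sup>2 / 9" using B(3) by (simp add: d_def power_divide power_mult_distrib)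
    moreover have "e\<^sup>2 > 0" using \<open>0 < e\<close> by simp
    ultimately have "(LINT x|lebesgue. (g x - \<psi> x)\<^sup>2) + (LINT x|lebesgue. (norm (G' x - gradient \<psi> x))\<^sup>2) < e\<^sup>2"
      by linarith
    then show "\<exists>\<psi>\<in>test_functions (\<Omega> - K). (LINT x|lebesgue. (g x - \<psi> x)\<^sup>2) +
        (LINT x|lebesgue. (norm (G' x - gradient \<psi> x))\<^sup>2) < e\<^sup>2"
      using \<psi> by (intro bexI[of _ \<psi>]) auto
  qed
  moreover have "(LINT x|lebesgue_on \<Omega>. (norm (gradient f x))\<^sup>2) = (LINT x|lebesgue. (norm (gradient f x))\<^sup>2)"
    using m f by (intro integral_lebesgue_on_vanish) (auto simp: test_functions_gradient_vanish)
  moreover have "has_H1_gradient \<Omega> f (gradient f)"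
    by (rule has_H1_gradient_restrict[OF test_functions_H1_gradient[OF f] m])
  ultimately show ?thesis
    unfolding capacity_def using test_functions_H10[OF f]
    by (intro cInf_lower bdd_belowI[of _ 0]) (auto simp: g_def[abs_def] intro!: exI[of _ f] exI[of _ "gradient f"])
qed

text \<open>The definition speaks of weak gradients, the claim of the classical one. Both become the
  pairing of u with the Laplacian of \<psi>, so the two gradients are never compared
  pointwise.\<close>

lemma eigenfunction_weak_equation:
  assumes \<Omega>: "open \<Omega>" and u: "dirichlet_eigenfunction \<Omega> u" "smooth_on \<Omega> u"
  obtains l where "\<And>\<psi>. \<psi> \<in> test_functions \<Omega> \<Longrightarrow>
    (LINT x|lebesgue. gradient \<psi> x \<bullet> gradient u x) = l * (LINT x|lebesgue. \<psi> x * u x)"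
proof -
  have m: "\<Omega> \<in> sets lebesgue" using \<Omega> by (simp add: borel_open)
  obtain l where l: "\<And>v G V. v \<in> H10 \<Omega> \<Longrightarrow> has_H1_gradient \<Omega> u G \<Longrightarrow> has_H1_gradient \<Omega> v V \<Longrightarrow>
        (LINT x|lebesgue_on \<Omega>. G x \<bullet> V x) = l * (LINT x|lebesgue_on \<Omega>. u x * v x)"
    and uH: "u \<in> H10 \<Omega>"
    using u(1) unfolding dirichlet_eigenfunction_def by blast
  obtain G where "has_H1_gradient UNIV u G" using H10_has_gradient[OF uH] by blast
  then have G: "has_H1_gradient \<Omega> u G" using m by (rule has_H1_gradient_restrict)
  show ?thesis
  proof (rule that[of l])
    fix \<psi> assume \<psi>: "\<psi> \<in> test_functions \<Omega>"
    have "(LINT x|lebesgue. gradient \<psi> x \<bullet> gradient u x) = - (LINT x|lebesgue. u x * laplacian \<psi> x)"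
      using \<Omega> \<psi> u(2) by (rule green_test2)
    also have "\<dots> = (LINT x|lebesgue_on \<Omega>. G x \<bullet> gradient \<psi> x)"
      using weak_gradient_pairing[OF m G \<psi>] by simp
    also have "\<dots> = l * (LINT x|lebesgue_on \<Omega>. u x * \<psi> x)"
      using test_functions_H10[OF \<psi>] G has_H1_gradient_restrict[OF test_functions_H1_gradient[OF \<psi>] m] by (rule l)
    also have "(LINT x|lebesgue_on \<Omega>. u x * \<psi> x) = (LINT x|lebesgue. \<psi> x * u x)"
      using m \<psi> by (subst integral_lebesgue_on_vanish) (auto simp: test_functions_vanish mult.commute)
    finally show "(LINT x|lebesgue. gradient \<psi> x \<bullet> gradient u x) = l * (LINT x|lebesgue. \<psi> x * u x)" .
  qed
qed

text \<open>The pointwise identity behind this is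
  \<open>\<bar>\<nabla>(\<kappa>v)\<bar>\<^sup>2 = \<nabla>v \<bullet> \<nabla>(\<kappa>\<^sup>2v) + v\<^sup>2\<bar>\<nabla>\<kappa>\<bar>\<^sup>2\<close>; it replaces any estimate of \<open>\<nabla>v\<close>.\<close>

lemma caccioppoli_identity:
  assumes \<Omega>: "open \<Omega>" and u: "smooth_on \<Omega> u"
    and l: "\<And>\<psi>. \<psi> \<in> test_functions \<Omega> \<Longrightarrow>
      (LINT x|lebesgue. gradient \<psi> x \<bullet> gradient u x) = l * (LINT x|lebesgue. \<psi> x * u x)"
    and P: "smooth_on UNIV P" "\<And>x. laplacian P x = 0"
    and \<kappa>: "\<kappa> \<in> test_functions \<Omega>"
  defines "v \<equiv> \<lambda>x. u x - P x"
  shows "(LINT x|lebesgue. (norm (gradient (\<lambda>x. \<kappa> x * v x) x))\<^sup>2) =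
    l * (LINT x|lebesgue. (\<kappa> x)\<^sup>2 * (u x * v x)) + (LINT x|lebesgue. (v x)\<^sup>2 * (norm (gradient \<kappa> x))\<^sup>2)"
proof -
  have sP: "smooth_on \<Omega> P" using P(1) smooth_on_subset by blast
  have sv: "smooth_on \<Omega> v" unfolding v_def by (intro smooth_on_diff \<Omega> u sP)
  \<comment> \<open>The function \<psi> is \<kappa>^2 v; it is tested against the equation of u and
    against the harmonicity of P.\<close>
  define q \<psi> where "q x = \<kappa> x * v x" and "\<psi> x = q x * \<kappa> x" for x
  have q: "q \<in> test_functions \<Omega>" unfolding q_def by (rule test_functions_mult[OF \<Omega> \<kappa> sv])
  have \<psi>: "\<psi> \<in> test_functions \<Omega>" unfolding \<psi>_def
    by (rule test_functions_mult[OF \<Omega> q]) (use smooth_on_subset[OF test_functions_smooth[OF \<kappa>]] in blast)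
  have eq: "(norm (gradient q x))\<^sup>2 = gradient \<psi> x \<bullet> gradient u x - gradient \<psi> x \<bullet> gradient P x + (v x)\<^sup>2 * (norm (gradient \<kappa> x))\<^sup>2" for x
  proof (cases "x \<in> \<Omega>")
    case True
    have dv: "v differentiable (at x)" "u differentiable (at x)" "P differentiable (at x)"
      using sv u sP True by (auto intro: smooth_on_differentiable)
    have d\<kappa>: "\<kappa> differentiable (at x)" using \<kappa> by (rule test_functions_differentiable)
    have dq: "q differentiable (at x)" using q by (rule test_functions_differentiable)
    have gv: "gradient v x = gradient u x - gradient P x" unfolding v_def by (rule gradient_diff[OF dv(2,3)])
    have gq: "gradient q x = \<kappa> x *\<^sub>R gradient v x + v x *\<^sub>R gradient \<kappa> x"
      unfolding q_def by (rule gradient_mult[OF d\<kappa> dv(1)])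
    have g\<psi>: "gradient \<psi> x = q x *\<^sub>R gradient \<kappa> x + \<kappa> x *\<^sub>R gradient q x"
      unfolding \<psi>_def by (rule gradient_mult[OF dq d\<kappa>])
    have "gradient \<psi> x \<bullet> gradient u x - gradient \<psi> x \<bullet> gradient P x = gradient \<psi> x \<bullet> gradient v x"
      by (simp add: gv inner_diff_right)
    then show ?thesis
      unfolding g\<psi> gq q_def power2_norm_eq_inner
      by (simp only: inner_add_left inner_add_right inner_scaleR_left inner_scaleR_right
          inner_commute[of "gradient \<kappa> x" "gradient v x"]) (simp add: algebra_simps power2_eq_square)
  next
    case False
    then show ?thesis using q \<psi> \<kappa> by (simp add: test_functions_gradient_vanish)
  qed
  have i: "integrable lebesgue (\<lambda>x. gradient \<psi> x \<bullet> gradient u x)" "integrable lebesgue (\<lambda>x. gradient \<psi> x \<bullet> gradient P x)"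
    using \<Omega> \<psi> u sP by (auto intro: integrable_gradient_test)
  have i3: "integrable lebesgue (\<lambda>x. (v x)\<^sup>2 * (norm (gradient \<kappa> x))\<^sup>2)"
  proof -
    have "integrable lebesgue (\<lambda>x. \<Sum>b\<in>Basis. (pd b \<kappa> x * v x) * (pd b \<kappa> x * v x))"
      using \<Omega> \<kappa> sv by (intro Bochner_Integration.integrable_sum L2_mult_integrable test_functions_L2[of _ \<Omega>] test_functions_mult test_functions_pd)
    moreover have "(v x)\<^sup>2 * (norm (gradient \<kappa> x))\<^sup>2 = (\<Sum>b\<in>Basis. (pd b \<kappa> x * v x) * (pd b \<kappa> x * v x))" for x
      unfolding power2_norm_eq_inner gradient_inner by (simp add: sum_distrib_left power2_eq_square algebra_simps)
    ultimately show ?thesis by simp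
  qed
  have "(LINT x|lebesgue. gradient \<psi> x \<bullet> gradient P x) = 0"
    using green_test[OF \<Omega> \<psi> sP] P(2) by simp
  then have "(LINT x|lebesgue. (norm (gradient q x))\<^sup>2) = l * (LINT x|lebesgue. \<psi> x * u x) + (LINT x|lebesgue. (v x)\<^sup>2 * (norm (gradient \<kappa> x))\<^sup>2)"
    using i i3 l[OF \<psi>] by (simp add: eq)
  then show ?thesis by (simp add: \<psi>_def q_def[abs_def] power2_eq_square algebra_simps)
qed

text \<open>Young's inequality with weight t. In the application f carries the leading energy and g
  a negligible one, so a small fixed t leaves the first factor near 1 and the large second factor is
  harmless.\<close>

lemma gradient_energy_add_le:
  assumes "f \<in> test_functions U" "g \<in> test_functions V" "0 < t"
  shows "(LINT x|lebesgue. (norm (gradient (\<lambda>x. f x + g x) x))\<^sup>2) \<le>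
    (1 + t) * (LINT x|lebesgue. (norm (gradient f x))\<^sup>2) + (1 + 1 / t) * (LINT x|lebesgue. (norm (gradient g x))\<^sup>2)"
proof -
  note s = test_functions_gradient_L2[OF assms(1)] test_functions_gradient_L2[OF assms(2)]
  have eq: "gradient (\<lambda>x. f x + g x) x = gradient f x + gradient g x" for x
    by (intro gradient_add test_functions_differentiable[OF assms(1)] test_functions_differentiable[OF assms(2)])
  have le: "(norm (a + b))\<^sup>2 \<le> (1 + t) * (norm a)\<^sup>2 + (1 + 1 / t) * (norm b)\<^sup>2" for a b :: 'a
  proof -
    have "a \<bullet> b \<le> norm a * norm b" by (rule norm_cauchy_schwarz)
    moreover have "2 * (norm a * norm b) \<le> t * (norm a)\<^sup>2 + (norm b)\<^sup>2 / t"
    proof -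
      have "0 \<le> (t * norm a - norm b)\<^sup>2 / t" using assms(3) by simp
      also have "\<dots> = t * (norm a)\<^sup>2 + (norm b)\<^sup>2 / t - 2 * (norm a * norm b)"
        using assms(3) by (simp add: power2_diff power_mult_distrib field_simps power2_eq_square)
      finally show ?thesis by simp
    qed
    ultimately show ?thesis by (simp add: norm_add_squared algebra_simps)
  qed
  have "(LINT x|lebesgue. (norm (gradient f x + gradient g x))\<^sup>2) \<le>
      (LINT x|lebesgue. (1 + t) * (norm (gradient f x))\<^sup>2 + (1 + 1 / t) * (norm (gradient g x))\<^sup>2)"
    using s[THEN L2_integrable] L2_integrable[OF L2_add[OF s]] by (intro integral_mono le) auto
  then show ?thesis using s[THEN L2_integrable] by (simp add: eq)
qed


section \<open>Radial integrals and harmonic polynomials\<close>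

text \<open>The disc where \<open>x \<bullet> x \<le> a\<close> has area \<pi> a, which is linear in
  a, and half-lines determine a Borel measure. This takes the place of polar coordinates.\<close>

lemma distr_lborel_inner_self:
  "distr (lborel :: (real^2) measure) borel (\<lambda>x. x \<bullet> x) = density lborel (\<lambda>s. ennreal (pi * indicator {0..} s))"
  (is "?M = ?N")
proof (rule measure_eqI_generator_eq[where E="range (\<lambda>a::real. {..a})" and \<Omega>=UNIV and A="\<lambda>n::nat. {..real n}"])
  have N: "emeasure ?N {..a} = ennreal (if a < 0 then 0 else pi * a)" for a
  proof -
    have "emeasure ?N {..a} = (\<integral>\<^sup>+ s. ennreal (pi * indicator {0..} s) * indicator {..a} s \<partial>lborel)"
      by (subst emeasure_density) auto
    also have "\<dots> = (\<integral>\<^sup>+ s. ennreal pi * indicator {0..a} s \<partial>lborel)"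
      by (rule nn_integral_cong) (auto simp: indicator_def)
    also have "\<dots> = ennreal pi * emeasure lborel {0..a}"
      by (subst nn_integral_cmult_indicator) auto
    also have "\<dots> = ennreal (if a < 0 then 0 else pi * a)" by (simp add: ennreal_mult[symmetric])
    finally show ?thesis .
  qed
  have M: "emeasure ?M {..a} = ennreal (if a < 0 then 0 else pi * a)" for a
  proof -
    have "emeasure ?M {..a} = emeasure lborel ((\<lambda>x::real^2. x \<bullet> x) -` {..a})"
      by (subst emeasure_distr) auto
    also have "\<dots> = ennreal (if a < 0 then 0 else pi * a)"
    proof (cases "a < 0")
      case True
      then have "\<not> x \<bullet> x \<le> a" for x :: "real^2" using inner_ge_zero[of x] by linarith
      then have "(\<lambda>x::real^2. x \<bullet> x) -` {..a} = {}" by auto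
      then show ?thesis using True by simp
    next
      case False
      have "x \<bullet> x \<le> a \<longleftrightarrow> norm x \<le> sqrt a" for x :: "real^2"
        unfolding norm_eq_sqrt_inner by simp
      then have "(\<lambda>x::real^2. x \<bullet> x) -` {..a} = cball 0 (sqrt a)" by auto
      then show ?thesis using False by (simp add: emeasure_cball unit_ball_vol_2)
    qed
    finally show ?thesis .
  qed
  show "emeasure ?M X = emeasure ?N X" if "X \<in> range (\<lambda>a::real. {..a})" for X
    using that M N by auto
  show "emeasure ?M {..real n} \<noteq> \<infinity>" for n by (simp add: M)
  show "Int_stable (range (\<lambda>a::real. {..a}))" by (auto simp: Int_stable_def)
  show "(\<Union>n::nat. {..real n}) = UNIV" using real_arch_simple by auto
  show "sets ?M = sigma_sets UNIV (range (\<lambda>a::real. {..a}))" "sets ?N = sigma_sets UNIV (range (\<lambda>a::real. {..a}))"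
    by (simp_all add: borel_eq_atMost)
qed auto

lemma
  fixes F :: "real \<Rightarrow> real"
  assumes F: "F \<in> borel_measurable borel"
  shows integral_radial: "(LINT x|(lborel :: (real^2) measure). F (x \<bullet> x)) = pi * (LINT s|lborel. indicator {0..} s * F s)"
    and integrable_radial: "integrable (lborel :: (real^2) measure) (\<lambda>x. F (x \<bullet> x)) \<longleftrightarrow> integrable lborel (\<lambda>s. indicator {0..} s * F s)"
proof -
  have "(LINT x|(lborel :: (real^2) measure). F (x \<bullet> x)) = (LINT s|distr (lborel :: (real^2) measure) borel (\<lambda>x. x \<bullet> x). F s)"
    using F by (subst integral_distr) auto
  also have "\<dots> = (LINT s|lborel. (pi * indicator {0..} s) *\<^sub>R F s)"
    unfolding distr_lborel_inner_self using F by (subst integral_density) auto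
  also have "\<dots> = pi * (LINT s|lborel. indicator {0..} s * F s)" by (simp add: mult.assoc)
  finally show "(LINT x|(lborel :: (real^2) measure). F (x \<bullet> x)) = pi * (LINT s|lborel. indicator {0..} s * F s)" .
  have "integrable (lborel :: (real^2) measure) (\<lambda>x. F (x \<bullet> x)) \<longleftrightarrow> integrable (distr (lborel :: (real^2) measure) borel (\<lambda>x. x \<bullet> x)) F"
    using F by (subst integrable_distr_eq) auto
  also have "\<dots> \<longleftrightarrow> integrable lborel (\<lambda>s. (pi * indicator {0..} s) *\<^sub>R F s)"
    unfolding distr_lborel_inner_self using F by (subst integrable_density) auto
  also have "\<dots> \<longleftrightarrow> integrable lborel (\<lambda>s. indicator {0..} s * F s)" by (simp add: mult.assoc)
  finally show "integrable (lborel :: (real^2) measure) (\<lambda>x. F (x \<bullet> x)) \<longleftrightarrow> integrable lborel (\<lambda>s. indicator {0..} s * F s)" .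
qed

section \<open>Rotations and homogeneous harmonic polynomials\<close>

lemma distr_lborel_orthogonal:
  fixes R :: "real^'n::{finite,wellorder} \<Rightarrow> real^'n::_"
  assumes R: "orthogonal_transformation R"
  shows "distr lborel borel R = lborel"
proof (rule lborel_eqI[symmetric])
  have bl: "R \<in> borel_measurable borel"
    using orthogonal_transformation_linear[OF R]
    by (intro borel_measurable_continuous_onI linear_continuous_on) (simp add: linear_conv_bounded_linear)
  fix l u :: "real^'n::{finite,wellorder}" assume lu: "\<And>b. b \<in> Basis \<Longrightarrow> l \<bullet> b \<le> u \<bullet> b"
  have "emeasure (distr lborel borel R) (box l u) = emeasure lborel (R -` box l u)"
    using bl by (subst emeasure_distr) auto
  also have "R -` box l u = inv R ` box l u"
    using bij_vimage_eq_inv_image[OF orthogonal_transformation_bij[OF R]] .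
  also have "emeasure lborel (inv R ` box l u) = emeasure lebesgue (inv R ` box l u)"
  proof -
    have "R -` box l u \<in> sets borel" using measurable_sets[OF bl, of "box l u"] by simp
    then show ?thesis using \<open>R -` box l u = inv R ` box l u\<close> by simp
  qed
  also have "\<dots> = ennreal (measure lebesgue (inv R ` box l u))"
    using measurable_orthogonal_image[OF orthogonal_transformation_inv[OF R] lmeasurable_box]
    by (intro emeasure_eq_measure2) (simp add: fmeasurableD2)
  also have "measure lebesgue (inv R ` box l u) = measure lebesgue (box l u)"
    by (rule measure_orthogonal_image[OF orthogonal_transformation_inv[OF R] lmeasurable_box])
  also have "ennreal \<dots> = ennreal (\<Prod>b\<in>Basis. (u - l) \<bullet> b)"
    using lu by (simp add: measure_lborel_box)
  finally show "emeasure (distr lborel borel R) (box l u) = ennreal (\<Prod>b\<in>Basis. (u - l) \<bullet> b)" .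
qed simp

lemma sum_Basis_2: "(\<Sum>b\<in>(Basis :: (real^2) set). f b) = f (axis 1 1) + f (axis 2 1)"
proof -
  have B: "(Basis :: (real^2) set) = {axis 1 1, axis 2 1}"
    by (auto simp: Basis_vec_def) (metis exhaust_2)
  have "axis 1 1 \<noteq> (axis 2 1 :: real^2)" by (simp add: axis_eq_axis)
  then show ?thesis by (simp add: B)
qed

lemma inner_2: "(x :: real^2) \<bullet> y = x $ 1 * y $ 1 + x $ 2 * y $ 2"
  by (simp add: inner_vec_def sum_2)

text \<open>With \<open>c = \<beta> cis \<alpha>\<close> and \<open>x = r (cos t, sin t)\<close> this is \<open>\<beta> r\<^sup>k sin (\<alpha> - k t)\<close>.\<close>

definition hpoly :: "nat \<Rightarrow> complex \<Rightarrow> real^2 \<Rightarrow> real" where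
  "hpoly k c x = Im (c * Complex (x $ 1) (- x $ 2) ^ k)"

text \<open>The polynomial is the imaginary part of a power of x1 - i x2, whose partial derivatives
  are 1 and -i, so differentiation stays in the family. Smoothness follows by induction and
  harmonicity from (-i)^2 = -1. For k = 0 the truncated exponent \<open>k - 1\<close> is harmless
  because the coefficient is 0.\<close>

lemma has_derivative_hpoly:
  "(hpoly k c has_derivative (\<lambda>v. v $ 1 * hpoly (k - 1) (of_nat k * c) x + v $ 2 * hpoly (k - 1) (- \<i> * of_nat k * c) x)) (at x)"
proof -
  have w: "Complex (x $ 1) (- x $ 2) = of_real (x $ 1) - \<i> * of_real (x $ 2)" for x :: "real^2"
    by (simp add: complex_eq_iff)
  have "((\<lambda>x::real^2. Im (c * (of_real (x $ 1) - \<i> * of_real (x $ 2)) ^ k)) has_derivative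
     (\<lambda>v. Im (c * (of_nat k * (of_real (v $ 1) - \<i> * of_real (v $ 2)) * (of_real (x $ 1) - \<i> * of_real (x $ 2)) ^ (k - 1))))) (at x)"
    by (auto intro!: derivative_eq_intros has_derivative_Im bounded_linear_imp_has_derivative bounded_linear_vec_nth)
  moreover have "Im (c * (of_nat k * (of_real (v $ 1) - \<i> * of_real (v $ 2)) * W)) =
     v $ 1 * Im (of_nat k * c * W) + v $ 2 * Im (- \<i> * of_nat k * c * W)" for v :: "real^2" and W
    by (simp add: algebra_simps)
  ultimately show ?thesis by (simp add: hpoly_def[abs_def] w)
qed

lemma pd_hpoly:
  "pd (axis 1 1) (hpoly k c) = hpoly (k - 1) (of_nat k * c)"
  "pd (axis 2 1) (hpoly k c) = hpoly (k - 1) (- \<i> * of_nat k * c)"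
  using pd_eq[OF has_derivative_hpoly] by (auto simp: fun_eq_iff axis_def)

lemma smooth_on_hpoly: "smooth_on UNIV (hpoly k c)"
proof -
  have "Ck_on n UNIV (hpoly k c)" for n
  proof (induction n arbitrary: k c)
    case 0
    show ?case
      using has_derivative_continuous[OF has_derivative_hpoly] by (simp add: continuous_on_eq_continuous_at)
  next
    case (Suc n)
    have "Ck_on n UNIV (pd b (hpoly k c))" if "b \<in> Basis" for b
    proof -
      have "b = axis 1 1 \<or> b = axis 2 1" using that by (auto simp: Basis_vec_def) (metis exhaust_2)
      then show ?thesis using Suc pd_hpoly by metis
    qed
    moreover have "hpoly k c differentiable (at x)" for x
      using has_derivative_hpoly unfolding differentiable_def by blast
    ultimately show ?case by (simp add: Ck_on_Suc)
  qed
  then show ?thesis by (simp add: smooth_on_def)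
qed

lemma laplacian_hpoly: "laplacian (hpoly k c) x = 0"
  unfolding laplacian_def sum_Basis_2 pd_hpoly by (simp add: hpoly_def algebra_simps)

text \<open>As Im (i z) = Re z, multiplying c by i gives the harmonic conjugate up to sign, and the
  sum of squares is the squared modulus of c (x1 - i x2)^k.\<close>

lemma hpoly_conj: "hpoly k c x ^ 2 + hpoly k (\<i> * c) x ^ 2 = (cmod c)\<^sup>2 * (x \<bullet> x) ^ k"
proof -
  define z where "z = c * Complex (x $ 1) (- x $ 2) ^ k"
  have "hpoly k c x ^ 2 + hpoly k (\<i> * c) x ^ 2 = (Im z)\<^sup>2 + (Re z)\<^sup>2"
    by (simp add: hpoly_def z_def mult.assoc)
  also have "\<dots> = (cmod z)\<^sup>2" by (simp add: cmod_power2)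
  also have "\<dots> = (cmod c)\<^sup>2 * ((cmod (Complex (x $ 1) (- x $ 2)))\<^sup>2) ^ k"
    by (simp add: z_def norm_mult norm_power power_mult_distrib power_mult[symmetric] mult.commute)
  also have "(cmod (Complex (x $ 1) (- x $ 2)))\<^sup>2 = x \<bullet> x"
    unfolding cmod_power2 by (simp add: inner_2 power2_eq_square)
  finally show ?thesis .
qed

lemma hpoly_squared_le: "(hpoly k c x)\<^sup>2 \<le> (cmod c)\<^sup>2 * (x \<bullet> x) ^ k"
  using hpoly_conj[of k c x] zero_le_power2[of "hpoly k (\<i> * c) x"] by linarith

lemma norm_gradient_hpoly: "(norm (gradient (hpoly k c) x))\<^sup>2 = (real k)\<^sup>2 * (cmod c)\<^sup>2 * (x \<bullet> x) ^ (k - 1)"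
proof -
  have "hpoly j (- \<i> * d) x = - hpoly j (\<i> * d) x" for j d by (simp add: hpoly_def)
  then have "(norm (gradient (hpoly k c) x))\<^sup>2 =
      hpoly (k - 1) (of_nat k * c) x ^ 2 + hpoly (k - 1) (\<i> * (of_nat k * c)) x ^ 2"
    unfolding power2_norm_eq_inner gradient_inner sum_Basis_2 pd_hpoly
    by (simp add: power2_eq_square mult.assoc)
  also have "\<dots> = (real k)\<^sup>2 * (cmod c)\<^sup>2 * (x \<bullet> x) ^ (k - 1)"
    unfolding hpoly_conj by (simp add: norm_mult power_mult_distrib)
  finally show ?thesis .
qed

lemma euler_hpoly: "x \<bullet> gradient (hpoly k c) x = real k * hpoly k c x"
proof (cases k)
  case 0
  then show ?thesis by (simp add: inner_gradient sum_Basis_2 pd_hpoly hpoly_def)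
next
  case (Suc j)
  have "x \<bullet> axis 1 1 = x $ 1" "x \<bullet> axis 2 1 = x $ 2" by (simp_all add: inner_axis)
  moreover have "Complex (x $ 1) (- x $ 2) = of_real (x $ 1) - \<i> * of_real (x $ 2)" by (simp add: complex_eq_iff)
  ultimately show ?thesis
    unfolding inner_gradient sum_Basis_2 pd_hpoly
    by (simp add: hpoly_def Suc algebra_simps)
qed

text \<open>Rotating by \<theta> multiplies x1 - i x2 by \<open>cis (- \<theta>)\<close>, and the
  k-th power can be absorbed into the coefficient.\<close>

lemma hpoly_rotation:
  fixes R :: "real \<Rightarrow> real^2 \<Rightarrow> real^2"
  assumes R: "\<And>\<theta> x. R \<theta> x = vector [cos \<theta> * x $ 1 - sin \<theta> * x $ 2, sin \<theta> * x $ 1 + cos \<theta> * x $ 2]"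
  shows "hpoly k c (R \<theta> x) = hpoly k (c * cis (- (real k * \<theta>))) x"
    "orthogonal_transformation (R \<theta>)" "R \<theta> x \<bullet> R \<theta> x = x \<bullet> x"
proof -
  have "Complex (R \<theta> x $ 1) (- R \<theta> x $ 2) = cis (- \<theta>) * Complex (x $ 1) (- x $ 2)"
    by (simp add: R complex_eq_iff algebra_simps)
  then show "hpoly k c (R \<theta> x) = hpoly k (c * cis (- (real k * \<theta>))) x"
    unfolding hpoly_def using Complex.DeMoivre[of "- \<theta>" k] by (simp only: power_mult_distrib mult.assoc mult_minus_right)
  have sc: "(sin \<theta>)\<^sup>2 = 1 - (cos \<theta>)\<^sup>2" by (simp add: sin_squared_eq)
  have in_eq: "R \<theta> v \<bullet> R \<theta> w = v \<bullet> w" for v w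
  proof -
    have "R \<theta> v \<bullet> R \<theta> w = ((cos \<theta>)\<^sup>2 + (sin \<theta>)\<^sup>2) * (v $ 1 * w $ 1 + v $ 2 * w $ 2)"
      by (simp only: R inner_2 vector_2 power2_eq_square) algebra
    then show ?thesis by (simp add: inner_2)
  qed
  then show "R \<theta> x \<bullet> R \<theta> x = x \<bullet> x" by simp
  have "linear (R \<theta>)"
    by (rule linearI) (simp_all add: vec_eq_iff forall_2 R algebra_simps)
  then show "orthogonal_transformation (R \<theta>)" using in_eq by (simp add: orthogonal_transformation_def)
qed

text \<open>For k = 0 the polynomial is the constant Im c and its phase matters; for k \<ge> 1 the
  phase averages out over the circle.\<close>

definition hmean :: "nat \<Rightarrow> complex \<Rightarrow> real" where
  "hmean k c = (if k = 0 then (Im c)\<^sup>2 else (cmod c)\<^sup>2 / 2)"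

lemma hpoly_measurable: "hpoly k c \<in> borel_measurable borel"
  using smooth_on_continuous[OF smooth_on_hpoly] by (rule borel_measurable_continuous_onI)

text \<open>For \<open>k \<ge> 1\<close> rotation by \<open>\<pi>/(2k)\<close> turns the polynomial into its harmonic conjugate, so the
  mean over circles of its square is half of the sum of the two squares.\<close>

lemma integral_hpoly_radial:
  fixes F :: "real \<Rightarrow> real"
  assumes F: "F \<in> borel_measurable borel" and B: "\<And>s. 0 \<le> s \<Longrightarrow> \<bar>F s\<bar> \<le> B" and S: "\<And>s. s > S \<Longrightarrow> F s = 0"
  shows "integrable lborel (\<lambda>x. (hpoly k c x)\<^sup>2 * F (x \<bullet> x))"
    and "(LINT x|lborel. (hpoly k c x)\<^sup>2 * F (x \<bullet> x)) = hmean k c * (LINT x|(lborel :: (real^2) measure). (x \<bullet> x) ^ k * F (x \<bullet> x))"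
proof -
  have int: "integrable lborel (\<lambda>x::real^2. g x * F (x \<bullet> x))"
    if g: "continuous_on UNIV g" for g :: "real^2 \<Rightarrow> real"
  proof -
    have c: "compact (cball 0 (sqrt \<bar>S\<bar>) :: (real^2) set)" by simp
    have "F (x \<bullet> x) = 0" if "x \<notin> cball 0 (sqrt \<bar>S\<bar>)" for x :: "real^2"
    proof (rule S)
      have "sqrt \<bar>S\<bar> < norm x" using that by simp
      then have "(sqrt \<bar>S\<bar>)\<^sup>2 < (norm x)\<^sup>2" by (intro power_strict_mono) auto
      then show "S < x \<bullet> x" by (simp add: dot_square_norm)
    qed
    then have bound: "norm (g x * F (x \<bullet> x)) \<le> norm (B * (indicator (cball 0 (sqrt \<bar>S\<bar>)) x *\<^sub>R \<bar>g x\<bar>))" for x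
      using mult_left_mono[OF B[of "x \<bullet> x"], of "\<bar>g x\<bar>"] B[of 0]
      by (cases "x \<in> cball 0 (sqrt \<bar>S\<bar>)") (auto simp: abs_mult mult.commute)
    have i: "integrable lborel (\<lambda>x. B * (indicator (cball 0 (sqrt \<bar>S\<bar>)) x *\<^sub>R \<bar>g x\<bar>))"
      using borel_integrable_compact[OF c, of "\<lambda>x. \<bar>g x\<bar>"] g
      by (intro integrable_mult_right) (auto simp: set_integrable_def indicator_scaleR_eq_if intro: continuous_intros continuous_on_subset)
    have m: "(\<lambda>x. g x * F (x \<bullet> x)) \<in> borel_measurable lborel"
      using F borel_measurable_continuous_onI[OF g] by measurable
    show ?thesis by (rule Bochner_Integration.integrable_bound[OF i m AE_I2[OF bound]])
  qed
  have intP: "integrable lborel (\<lambda>x. (hpoly k d x)\<^sup>2 * F (x \<bullet> x))" for d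
    by (intro int continuous_on_power smooth_on_continuous[OF smooth_on_hpoly])
  then show "integrable lborel (\<lambda>x. (hpoly k c x)\<^sup>2 * F (x \<bullet> x))" .
  show "(LINT x|lborel. (hpoly k c x)\<^sup>2 * F (x \<bullet> x)) = hmean k c * (LINT x|(lborel :: (real^2) measure). (x \<bullet> x) ^ k * F (x \<bullet> x))"
  proof (cases "k = 0")
    case True
    then show ?thesis by (simp add: hpoly_def hmean_def)
  next
    case False
    define R :: "real \<Rightarrow> real^2 \<Rightarrow> real^2" where
      "R \<theta> x = vector [cos \<theta> * x $ 1 - sin \<theta> * x $ 2, sin \<theta> * x $ 1 + cos \<theta> * x $ 2]" for \<theta> x
    \<comment> \<open>With this sign \<open>- (real k * \<theta>)\<close> is \<pi>/2, so the
      rotation multiplies c by i.\<close>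
    define \<theta> where "\<theta> = - pi / (2 * real k)"
    note r = hpoly_rotation[OF R_def]
    have "- (real k * \<theta>) = pi / 2" using False by (simp add: \<theta>_def)
    then have cis: "cis (- (real k * \<theta>)) = \<i>" by (simp only: cis_pi_half)
    have Rm: "R \<theta> \<in> borel_measurable borel"
      using orthogonal_transformation_linear[OF r(2)]
      by (intro borel_measurable_continuous_onI linear_continuous_on) (simp add: linear_conv_bounded_linear)
    have "(LINT x|lborel. (hpoly k c x)\<^sup>2 * F (x \<bullet> x)) = (LINT x|distr lborel borel (R \<theta>). (hpoly k c x)\<^sup>2 * F (x \<bullet> x))"
      by (simp add: distr_lborel_orthogonal[OF r(2)])
    also have "\<dots> = (LINT x|lborel. (hpoly k c (R \<theta> x))\<^sup>2 * F (R \<theta> x \<bullet> R \<theta> x))"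
      using Rm F hpoly_measurable by (intro integral_distr) auto
    also have "\<dots> = (LINT x|lborel. (hpoly k (\<i> * c) x)\<^sup>2 * F (x \<bullet> x))"
      by (simp only: r(1,3) cis mult.commute[of c])
    finally have "2 * (LINT x|lborel. (hpoly k c x)\<^sup>2 * F (x \<bullet> x)) =
        (LINT x|lborel. (hpoly k c x)\<^sup>2 * F (x \<bullet> x)) + (LINT x|lborel. (hpoly k (\<i> * c) x)\<^sup>2 * F (x \<bullet> x))" by simp
    also have "\<dots> = (LINT x|lborel. ((hpoly k c x)\<^sup>2 + (hpoly k (\<i> * c) x)\<^sup>2) * F (x \<bullet> x))"
      using intP by (simp add: distrib_right)
    also have "\<dots> = (cmod c)\<^sup>2 * (LINT x|(lborel :: (real^2) measure). (x \<bullet> x) ^ k * F (x \<bullet> x))"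
      by (simp add: hpoly_conj mult.assoc)
    finally show ?thesis using False by (simp add: hmean_def)
  qed
qed


section \<open>Radial multiples of a harmonic polynomial\<close>

lemma smooth_on_inner_self: "smooth_on UNIV (\<lambda>x::'a::euclidean_space. x \<bullet> x)"
proof -
  have "smooth_on UNIV (\<lambda>x::'a. \<Sum>b\<in>Basis. (x \<bullet> b) * (x \<bullet> b))"
    by (intro smooth_on_sum smooth_on_mult smooth_on_inner) simp_all
  then show ?thesis by (simp add: euclidean_inner[symmetric])
qed

lemma smooth_on_radial:
  fixes h :: "real \<Rightarrow> real"
  assumes "smooth_on UNIV h" shows "smooth_on UNIV (\<lambda>x::'a::euclidean_space. h (x \<bullet> x))"
  by (rule smooth_on_compose[OF open_UNIV open_UNIV smooth_on_inner_self _ assms]) simp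

lemma gradient_inner_self: "gradient (\<lambda>x. x \<bullet> x) x = 2 *\<^sub>R x"
  by (rule gradient_eqI) (auto intro!: derivative_eq_intros simp: inner_commute)

lemma gradient_radial:
  assumes "(h has_real_derivative h') (at (x \<bullet> x))"
  shows "gradient (\<lambda>x. h (x \<bullet> x)) x = (2 * h') *\<^sub>R x"
  using gradient_compose[OF smooth_on_differentiable[OF smooth_on_inner_self] assms]
  by (simp add: gradient_inner_self)

lemma laplacian_mult:
  assumes f: "smooth_on UNIV f" and g: "smooth_on UNIV g"
  shows "laplacian (\<lambda>x. f x * g x) x = f x * laplacian g x + 2 * (gradient f x \<bullet> gradient g x) + g x * laplacian f x"
proof -
  have "pd b (pd b (\<lambda>x. f x * g x)) x = f x * pd b (pd b g) x + 2 * (pd b f x * pd b g x) + g x * pd b (pd b f) x"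
    if b: "b \<in> Basis" for b
  proof -
    have d: "f differentiable (at y)" "g differentiable (at y)" "pd b f differentiable (at y)" "pd b g differentiable (at y)" for y
      using f g smooth_on_pd[OF f b] smooth_on_pd[OF g b] by (auto intro: smooth_on_differentiable)
    have 1: "pd b (\<lambda>x. f x * g x) = (\<lambda>x. f x * pd b g x + g x * pd b f x)"
      by (rule ext) (rule pd_mult[OF d(1,2)])
    have "pd b (pd b (\<lambda>x. f x * g x)) x = pd b (\<lambda>x. f x * pd b g x) x + pd b (\<lambda>x. g x * pd b f x) x"
      unfolding 1 by (intro pd_add differentiable_mult d)
    then show ?thesis by (simp add: pd_mult[OF d(1,4)] pd_mult[OF d(2,3)])
  qed
  then have "laplacian (\<lambda>x. f x * g x) x = (\<Sum>b\<in>Basis. f x * pd b (pd b g) x + 2 * (pd b f x * pd b g x) + g x * pd b (pd b f) x)"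
    by (simp add: laplacian_def)
  then show ?thesis
    unfolding laplacian_def gradient_inner by (simp add: sum.distrib sum_distrib_left)
qed

lemma laplacian_radial:
  fixes x :: "'a::euclidean_space"
  assumes h: "\<And>s. (h has_real_derivative h' s) (at s)" and h': "\<And>s. (h' has_real_derivative h'' s) (at s)"
  shows "laplacian (\<lambda>x::'a. h (x \<bullet> x)) x = 2 * real DIM('a) * h' (x \<bullet> x) + 4 * (x \<bullet> x) * h'' (x \<bullet> x)"
proof -
  have d: "(\<lambda>x::'a. k (x \<bullet> x)) differentiable (at y)" if "\<And>s. (k has_real_derivative k' s) (at s)" for k k' :: "real \<Rightarrow> real" and y :: 'a
    using differentiable_chain_at[of "\<lambda>x::'a. x \<bullet> x" y k] smooth_on_differentiable[OF smooth_on_inner_self, of y] that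
    by (auto simp: o_def real_differentiable_def)
  have pd_rad: "pd b (\<lambda>x::'a. k (x \<bullet> x)) y = 2 * k' (y \<bullet> y) * (y \<bullet> b)"
    if "\<And>s. (k has_real_derivative k' s) (at s)" for k k' :: "real \<Rightarrow> real" and y b :: 'a
    using pd_eq_inner_gradient[OF d[OF that], of b y] gradient_radial[OF that, of y] by (simp add: inner_commute)
  have "pd b (pd b (\<lambda>x::'a. h (x \<bullet> x))) x = 2 * h' (x \<bullet> x) + 4 * h'' (x \<bullet> x) * ((x \<bullet> b) * (x \<bullet> b))"
    if b: "b \<in> Basis" for b
  proof -
    have 1: "pd b (\<lambda>x::'a. h (x \<bullet> x)) = (\<lambda>y. h' (y \<bullet> y) * (2 * (y \<bullet> b)))"
      using pd_rad[OF h] by (simp add: fun_eq_iff)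
    have lin: "((\<lambda>y::'a. 2 * (y \<bullet> b)) has_derivative (\<lambda>v. 2 * (v \<bullet> b))) (at x)"
      by (auto intro!: derivative_eq_intros)
    have "pd b (\<lambda>y. h' (y \<bullet> y) * (2 * (y \<bullet> b))) x = h' (x \<bullet> x) * pd b (\<lambda>y. 2 * (y \<bullet> b)) x + 2 * (x \<bullet> b) * pd b (\<lambda>y::'a. h' (y \<bullet> y)) x"
      by (intro pd_mult d[OF h']) (use lin in \<open>auto simp: differentiable_def\<close>)
    also have "\<dots> = h' (x \<bullet> x) * (2 * (b \<bullet> b)) + 2 * (x \<bullet> b) * (2 * h'' (x \<bullet> x) * (x \<bullet> b))"
      unfolding pd_eq[OF lin] pd_rad[OF h'] by simp
    finally show ?thesis unfolding 1 using b by (simp add: algebra_simps)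
  qed
  then have "laplacian (\<lambda>x::'a. h (x \<bullet> x)) x = (\<Sum>b\<in>(Basis :: 'a set). 2 * h' (x \<bullet> x) + 4 * h'' (x \<bullet> x) * ((x \<bullet> b) * (x \<bullet> b)))"
    by (simp add: laplacian_def)
  also have "\<dots> = 2 * real DIM('a) * h' (x \<bullet> x) + 4 * h'' (x \<bullet> x) * (\<Sum>b\<in>(Basis :: 'a set). (x \<bullet> b) * (x \<bullet> b))"
    by (simp add: sum.distrib sum_distrib_left)
  also have "(\<Sum>b\<in>(Basis :: 'a set). (x \<bullet> b) * (x \<bullet> b)) = x \<bullet> x" by (rule euclidean_inner[symmetric])
  finally show ?thesis by (simp add: algebra_simps)
qed

text \<open>In the plane the radial part contributes 4 s h'' + 4 h', and the cross term contributes
  4 k h' by Euler's identity for homogeneous functions.\<close>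

lemma laplacian_hpoly_radial:
  assumes h: "\<And>s. (h has_real_derivative h' s) (at s)" and h': "\<And>s. (h' has_real_derivative h'' s) (at s)"
    and sm: "smooth_on UNIV h"
  shows "laplacian (\<lambda>x. hpoly k c x * h (x \<bullet> x)) x =
    hpoly k c x * (4 * (x \<bullet> x) * h'' (x \<bullet> x) + 4 * (real k + 1) * h' (x \<bullet> x))"
proof -
  have "laplacian (\<lambda>x::real^2. h (x \<bullet> x)) x = 4 * h' (x \<bullet> x) + 4 * (x \<bullet> x) * h'' (x \<bullet> x)"
    using laplacian_radial[OF h h', of x] by simp
  moreover have "gradient (hpoly k c) x \<bullet> gradient (\<lambda>x. h (x \<bullet> x)) x = 2 * h' (x \<bullet> x) * (real k * hpoly k c x)"
    using gradient_radial[OF h, of x] euler_hpoly[of x k c] by (simp add: inner_commute)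
  ultimately show ?thesis
    using laplacian_mult[OF smooth_on_hpoly smooth_on_radial[OF sm], of k c x]
    by (simp add: laplacian_hpoly algebra_simps)
qed

lemma norm_gradient_hpoly_radial:
  assumes h: "\<And>s. (h has_real_derivative h' s) (at s)" and sm: "smooth_on UNIV h"
  shows "(norm (gradient (\<lambda>x. hpoly k c x * h (x \<bullet> x)) x))\<^sup>2 =
    (hpoly k c x)\<^sup>2 * (4 * real k * h (x \<bullet> x) * h' (x \<bullet> x) + 4 * (x \<bullet> x) * (h' (x \<bullet> x))\<^sup>2) +
    (real k)\<^sup>2 * (cmod c)\<^sup>2 * ((x \<bullet> x) ^ (k - 1) * (h (x \<bullet> x))\<^sup>2)"
proof -
  have g: "gradient (\<lambda>x. hpoly k c x * h (x \<bullet> x)) x =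
      (hpoly k c x * (2 * h' (x \<bullet> x))) *\<^sub>R x + h (x \<bullet> x) *\<^sub>R gradient (hpoly k c) x"
    using gradient_mult[OF smooth_on_differentiable[OF smooth_on_hpoly] smooth_on_differentiable[OF smooth_on_radial[OF sm]], of x k c]
      gradient_radial[OF h, of x] by simp
  have "(norm (gradient (\<lambda>x. hpoly k c x * h (x \<bullet> x)) x))\<^sup>2 =
      (hpoly k c x * (2 * h' (x \<bullet> x)))\<^sup>2 * (x \<bullet> x) + 2 * ((hpoly k c x * (2 * h' (x \<bullet> x))) * (h (x \<bullet> x) * (x \<bullet> gradient (hpoly k c) x)))
      + (h (x \<bullet> x))\<^sup>2 * (norm (gradient (hpoly k c) x))\<^sup>2"
    unfolding g norm_add_squared by (simp add: power_mult_distrib power2_norm_eq_inner)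
  then show ?thesis
    unfolding euler_hpoly norm_gradient_hpoly by (simp add: power2_eq_square algebra_simps)
qed

text \<open>Both sides are 0 for k = 0, so the energy depends on c only through \<open>hmean\<close>
  without a case distinction.\<close>

lemma real_sq_cmod_sq: "(real k)\<^sup>2 * (cmod c)\<^sup>2 = 2 * (real k)\<^sup>2 * hmean k c"
  by (simp add: hmean_def)

text \<open>The integrand is \<open>m \<pi> (2k (h\<^sup>2 s\<^sup>k)' + 4 s\<^sup>k\<^sup>+\<^sup>1 h'\<^sup>2)\<close> in the variable \<open>s = \<bar>x\<bar>\<^sup>2\<close>.\<close>

lemma energy_hpoly_radial:
  fixes h g :: "real \<Rightarrow> real" and c :: complex
  assumes h: "\<And>s. (h has_real_derivative - g s) (at s)" and sm: "smooth_on UNIV h"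
    and g: "continuous_on UNIV g" "\<And>s. 0 \<le> s \<Longrightarrow> 0 \<le> g s" "\<And>s. 0 \<le> s \<Longrightarrow> s ^ (k + 1) * g s \<le> 1"
    and S: "0 < S" "h S = 0"
  defines "e \<equiv> \<lambda>x. indicator {..S} (x \<bullet> x) * (norm (gradient (\<lambda>x. hpoly k c x * h (x \<bullet> x)) x))\<^sup>2"
  shows "integrable lborel e" "(LINT x|lborel. e x) \<le> 4 * pi * hmean k c * h 0"
proof -
  define m where "m = hmean k c"
  have m0: "m \<ge> 0" by (simp add: m_def hmean_def)
  have hc: "continuous_on UNIV h" by (rule smooth_on_continuous[OF sm])
  have bm: "h \<in> borel_measurable borel" "g \<in> borel_measurable borel"
    using hc g(1) by (auto intro: borel_measurable_continuous_onI)
  \<comment> \<open>The term f2 accompanies P^2, whose circle mean brings a factor s^k; f1 comes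
    from the squared gradient of P, which is already radial. Both are cut off at S, since only h(S)
    = 0 is known and h may be nonzero beyond.\<close>
  define f1 f2 where "f1 s = (h s)\<^sup>2" and "f2 s = 4 * s * (g s)\<^sup>2 - 4 * real k * h s * g s" for s
  define F1 F2 where "F1 s = indicator {..S} s * f1 s" and "F2 s = indicator {..S} s * f2 s" for s
  have fc: "continuous_on UNIV f1" "continuous_on UNIV f2"
    unfolding f1_def f2_def by (intro continuous_intros hc g(1))+
  have Fm: "F1 \<in> borel_measurable borel" "F2 \<in> borel_measurable borel"
    using fc[THEN borel_measurable_continuous_onI] unfolding F1_def F2_def by measurable
  have e: "e x = (hpoly k c x)\<^sup>2 * F2 (x \<bullet> x) + 2 * (real k)\<^sup>2 * m * ((x \<bullet> x) ^ (k - 1) * F1 (x \<bullet> x))" for x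
    unfolding e_def norm_gradient_hpoly_radial[OF h sm] real_sq_cmod_sq
    by (simp add: F1_def F2_def f1_def f2_def m_def algebra_simps)
  have "bounded (f2 ` {0..S})"
    by (intro compact_imp_bounded compact_continuous_image continuous_on_subset[OF fc(2)]) auto
  then have "\<exists>B. \<forall>s\<in>{0..S}. \<bar>f2 s\<bar> \<le> B" by (auto simp: bounded_iff)
  then obtain B where B: "\<And>s. s \<in> {0..S} \<Longrightarrow> \<bar>f2 s\<bar> \<le> B" by blast
  have "\<bar>F2 s\<bar> \<le> max B 0" if "0 \<le> s" for s
    using B[of s] that by (auto simp: F2_def indicator_def)
  note P = integral_hpoly_radial[where S=S and k=k and c=c, OF Fm(2) this]
  have F2z: "F2 s = 0" if "s > S" for s using that by (simp add: F2_def)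
  have setint: "integrable lborel (\<lambda>s. indicator {0..} s * (f s * (indicator {..S} s * k s)))"
    if "continuous_on UNIV f" "continuous_on UNIV k" for f k :: "real \<Rightarrow> real"
  proof -
    have "set_integrable lborel {0..S} (\<lambda>s. f s * k s)"
      by (intro borel_integrable_atLeastAtMost' continuous_on_mult continuous_on_subset[OF that(1)] continuous_on_subset[OF that(2)]) auto
    moreover have "indicator {0..S} s *\<^sub>R (f s * k s) = indicator {0..} s * (f s * (indicator {..S} s * k s))" for s
      by (simp add: indicator_def)
    ultimately show ?thesis by (simp only: set_integrable_def)
  qed
  have sc: "continuous_on UNIV (\<lambda>s::real. s ^ j)" for j by (intro continuous_intros)
  note i1 = setint[OF sc fc(1), of "k - 1", folded F1_def]
  note i2 = setint[OF sc fc(2), of k, folded F2_def]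
  have m1: "(\<lambda>s. s ^ (k - 1) * F1 s) \<in> borel_measurable borel" "(\<lambda>s. s ^ k * F2 s) \<in> borel_measurable borel"
    using Fm by measurable
  have I1: "integrable lborel (\<lambda>x::real^2. (x \<bullet> x) ^ (k - 1) * F1 (x \<bullet> x))"
    using integrable_radial[OF m1(1)] i1 by simp
  show "integrable lborel e"
    unfolding e using P(1) I1 F2z by (intro Bochner_Integration.integrable_add integrable_mult_right) auto
  have "(LINT x|lborel. e x) = (LINT x|lborel. (hpoly k c x)\<^sup>2 * F2 (x \<bullet> x)) + 2 * (real k)\<^sup>2 * m * (LINT x|(lborel::(real^2) measure). (x \<bullet> x) ^ (k - 1) * F1 (x \<bullet> x))"
    unfolding e using P(1) I1 F2z by simp
  also have "(LINT x|lborel. (hpoly k c x)\<^sup>2 * F2 (x \<bullet> x)) = m * (pi * (LINT s|lborel. indicator {0..} s * (s ^ k * F2 s)))"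
    using P(2) F2z integral_radial[OF m1(2)] by (simp add: m_def)
  also have "(LINT x|(lborel::(real^2) measure). (x \<bullet> x) ^ (k - 1) * F1 (x \<bullet> x)) = pi * (LINT s|lborel. indicator {0..} s * (s ^ (k - 1) * F1 s))"
    by (rule integral_radial[OF m1(1)])
  also have "m * (pi * (LINT s|lborel. indicator {0..} s * (s ^ k * F2 s))) + 2 * (real k)\<^sup>2 * m * (pi * (LINT s|lborel. indicator {0..} s * (s ^ (k - 1) * F1 s)))
      = m * pi * (LINT s|lborel. indicator {0..} s * (s ^ k * F2 s) + 2 * (real k)\<^sup>2 * (indicator {0..} s * (s ^ (k - 1) * F1 s)))"
    using i1 i2 by (simp add: distrib_left)
  also have "\<dots> \<le> m * pi * (4 * h 0)"
  proof (rule mult_left_mono)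
    \<comment> \<open>The part 2 k (h^2 s^k)' is exact. In 4 s^(k+1) g^2 one factor is removed by
      s^(k+1) g \<le> 1, and the remaining 4 g is the derivative of -4 h.\<close>
    define G where "G s = 2 * real k * (h s)\<^sup>2 * s ^ k - 4 * h s" for s
    define G' where "G' s = 2 * real k * (2 * h s * (- g s) * s ^ k + (h s)\<^sup>2 * (real k * s ^ (k - 1))) + 4 * g s" for s
    have dG: "(G has_real_derivative G' s) (at s)" for s
      unfolding G_def G'_def by (auto intro!: derivative_eq_intros h simp: algebra_simps)
    have cG': "continuous_on UNIV G'" unfolding G'_def by (intro continuous_intros hc g(1))
    have "(LINT s|lborel. indicator {0..} s * (s ^ k * F2 s) + 2 * (real k)\<^sup>2 * (indicator {0..} s * (s ^ (k - 1) * F1 s)))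
        \<le> (LINT s|lborel. G' s * indicator {0..S} s)"
    proof (rule integral_mono)
      show "integrable lborel (\<lambda>s. G' s * indicator {0..S} s)"
        using borel_integrable_atLeastAtMost'[OF continuous_on_subset[OF cG'], of 0 S] by (simp add: set_integrable_def mult.commute)
      show "indicator {0..} s * (s ^ k * F2 s) + 2 * (real k)\<^sup>2 * (indicator {0..} s * (s ^ (k - 1) * F1 s)) \<le> G' s * indicator {0..S} s" for s
      proof (cases "s \<in> {0..S}")
        case True
        then have s: "0 \<le> s" "s \<le> S" by auto
        have "s ^ (k + 1) * g s * g s \<le> g s" using mult_right_mono[OF g(3) g(2)] s by force
        then have "s ^ k * f2 s + 2 * (real k)\<^sup>2 * (s ^ (k - 1) * f1 s) \<le> G' s"
          by (simp add: f1_def f2_def G'_def power2_eq_square algebra_simps)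
        then show ?thesis using True s by (simp add: F1_def F2_def)
      qed (auto simp: F1_def F2_def indicator_def)
    qed (use i1 i2 in auto)
    also have "\<dots> = G S - G 0"
      using S(1) dG cG' by (intro integral_FTC_Icc_real) (auto simp: continuous_on_eq_continuous_at)
    \<comment> \<open>At 0 the first term of G vanishes, through its factor k when k = 0 and through
      s^k otherwise.\<close>
    also have "\<dots> = 4 * h 0" using S(2) by (cases k) (auto simp: G_def)
    finally show "(LINT s|lborel. indicator {0..} s * (s ^ k * F2 s) + 2 * (real k)\<^sup>2 * (indicator {0..} s * (s ^ (k - 1) * F1 s))) \<le> 4 * h 0" .
  qed (use m0 in simp)
  finally show "(LINT x|lborel. e x) \<le> 4 * pi * hmean k c * h 0" by (simp add: m_def algebra_simps)
qed

text \<open>The factor s^k of the circle mean cancels the weight s^(-k), and the total increase of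
  \<rho> is 1, so the measure \<pi> ds gives \<pi>. As \<rho>' lives in (p, q) with p > 0, the
  weight is bounded there.\<close>

lemma integral_hpoly_step:
  fixes \<rho> \<rho>' :: "real \<Rightarrow> real"
  assumes \<rho>: "\<And>s. (\<rho> has_real_derivative \<rho>' s) (at s)" "continuous_on UNIV \<rho>'" "\<rho> 0 = 0" "\<rho> q = 1"
    and pq: "0 < p" "p < q" "\<And>s. s \<notin> {p<..<q} \<Longrightarrow> \<rho>' s = 0"
  shows "(LINT x|(lborel :: (real^2) measure). \<rho>' (x \<bullet> x)) = pi"
    and "(LINT x|lborel. (hpoly k c x)\<^sup>2 * (inverse (x \<bullet> x) ^ k * \<rho>' (x \<bullet> x))) = hmean k c * pi"
    and "integrable lborel (\<lambda>x. (hpoly k c x)\<^sup>2 * (inverse (x \<bullet> x) ^ k * \<rho>' (x \<bullet> x)))"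
proof -
  have m: "\<rho>' \<in> borel_measurable borel" using \<rho>(2) by (rule borel_measurable_continuous_onI)
  have "(LINT x|(lborel :: (real^2) measure). \<rho>' (x \<bullet> x)) = pi * (LINT s|lborel. indicator {0..} s * \<rho>' s)"
    by (rule integral_radial[OF m])
  also have "(\<lambda>s. indicator {0..} s * \<rho>' s) = (\<lambda>s. \<rho>' s * indicator {0..q} s)"
    using pq by (auto simp: fun_eq_iff indicator_def)
  also have "(LINT s|lborel. \<rho>' s * indicator {0..q} s) = \<rho> q - \<rho> 0"
    using \<rho> pq by (intro integral_FTC_Icc_real) (auto simp: continuous_on_eq_continuous_at)
  finally show 1: "(LINT x|(lborel :: (real^2) measure). \<rho>' (x \<bullet> x)) = pi" using \<rho> by simp
  define F where "F s = inverse s ^ k * \<rho>' s" for s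
  have Fm: "F \<in> borel_measurable borel" unfolding F_def using m by measurable
  have "continuous_on {p..q} F"
    unfolding F_def using pq by (intro continuous_intros continuous_on_subset[OF \<rho>(2)]) auto
  then have "bounded (F ` {p..q})" by (intro compact_imp_bounded compact_continuous_image) auto
  then have "\<exists>B. \<forall>s\<in>{p..q}. \<bar>F s\<bar> \<le> B" by (auto simp: bounded_iff)
  then obtain B where B: "\<And>s. s \<in> {p..q} \<Longrightarrow> \<bar>F s\<bar> \<le> B" by blast
  have Fz: "F s = 0" if "s \<notin> {p<..<q}" for s using pq(3)[OF that] by (simp add: F_def)
  have b: "\<bar>F s\<bar> \<le> max B 0" for s
    using B[of s] Fz[of s] by (cases "s \<in> {p<..<q}") auto
  have z: "F s = 0" if "s > q" for s using Fz[of s] that by simp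
  note P = integral_hpoly_radial[where S=q and k=k and c=c, OF Fm b z]
  have "s ^ k * F s = \<rho>' s" for s
    using pq(1) pq(3)[of 0] by (cases "s = 0") (auto simp: F_def power_mult_distrib[symmetric] mult.assoc[symmetric])
  then show "(LINT x|lborel. (hpoly k c x)\<^sup>2 * (inverse (x \<bullet> x) ^ k * \<rho>' (x \<bullet> x))) = hmean k c * pi"
    using P(2) 1 by (simp only: F_def[symmetric])
  show "integrable lborel (\<lambda>x. (hpoly k c x)\<^sup>2 * (inverse (x \<bullet> x) ^ k * \<rho>' (x \<bullet> x)))"
    using P(1) by (simp add: F_def)
qed

text \<open>An antiderivative of - s^(-k-1). Composed with |x|^2 and multiplied by P it is harmonic
  off the origin: for k \<ge> 1 a multiple of the Kelvin transform of P, for k = 0 a multiple of the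
  logarithm.\<close>

definition radial_pot :: "nat \<Rightarrow> real \<Rightarrow> real" where
  "radial_pot k s = (if k = 0 then - ln s else inverse s ^ k / real k)"

lemma has_derivative_radial_pot:
  assumes "0 < s"
  shows "(radial_pot k has_real_derivative - (inverse s ^ (k + 1))) (at s)"
proof (cases k)
  case 0
  have "((\<lambda>s. - ln s) has_real_derivative - inverse s) (at s)"
    using assms by (auto intro!: derivative_eq_intros simp: field_simps)
  then show ?thesis using 0 by (simp add: radial_pot_def[abs_def])
next
  case (Suc j)
  have "((\<lambda>s. inverse s ^ Suc j) has_real_derivative (1 + real j) * (- (inverse s ^ Suc (Suc 0)) * inverse s ^ j)) (at s)"
    using assms by (intro DERIV_power_Suc DERIV_inverse) auto
  then have "((\<lambda>s. inverse s ^ Suc j / real (Suc j)) has_real_derivative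
      (1 + real j) * (- (inverse s ^ Suc (Suc 0)) * inverse s ^ j) / real (Suc j)) (at s)"
    by (rule DERIV_cdivide)
  moreover have "(1 + real j) * (- (inverse s ^ Suc (Suc 0)) * inverse s ^ j) / real (Suc j) = - (inverse s ^ (k + 1))"
    using of_nat_Suc[of j] by (simp add: Suc add_eq_0_iff)
  ultimately show ?thesis using Suc by (simp add: radial_pot_def[abs_def] mult.assoc)
qed

lemma radial_pot_strict_antimono:
  assumes "0 < a" "a < b" shows "radial_pot k b < radial_pot k a"
proof (rule DERIV_neg_imp_decreasing[OF assms(2)])
  fix x assume "a \<le> x" "x \<le> b"
  then have "0 < x" using assms(1) by simp
  then show "\<exists>y. DERIV (radial_pot k) x :> y \<and> y < 0"
    using has_derivative_radial_pot[of x k] by (intro exI[of _ "- (inverse x ^ (k + 1))"]) simp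
qed

text \<open>The difference of h and the potential has derivative (1 - \<rho>) s^(-k-1), whose sign
  decides. The first bound limits the energy of the function tested in the lower estimate, the
  second makes h(0) large for the competitor.\<close>

lemma
  fixes h \<rho> :: "real \<Rightarrow> real"
  assumes h: "\<And>s. (h has_real_derivative - (\<rho> s * inverse s ^ (k + 1))) (at s)" and ab: "0 < a" "a \<le> b"
  shows radial_profile_le: "(\<And>s. a \<le> s \<Longrightarrow> s \<le> b \<Longrightarrow> \<rho> s \<le> 1) \<Longrightarrow> h a - h b \<le> radial_pot k a - radial_pot k b"
    and radial_profile_ge: "(\<And>s. a \<le> s \<Longrightarrow> s \<le> b \<Longrightarrow> \<rho> s = 1) \<Longrightarrow> radial_pot k a - radial_pot k b \<le> h a - h b"
proof -
  have d: "((\<lambda>s. h s - radial_pot k s) has_real_derivative (1 - \<rho> s) * inverse s ^ (k + 1)) (at s)" if "0 < s" for s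
    by (rule DERIV_cong[OF DERIV_diff[OF h has_derivative_radial_pot[OF that]]]) (simp add: algebra_simps)
  show "h a - h b \<le> radial_pot k a - radial_pot k b" if \<rho>: "\<And>s. a \<le> s \<Longrightarrow> s \<le> b \<Longrightarrow> \<rho> s \<le> 1"
  proof -
    have "h a - radial_pot k a \<le> h b - radial_pot k b"
    proof (rule DERIV_nonneg_imp_nondecreasing[OF ab(2)])
      fix x assume x: "a \<le> x" "x \<le> b"
      then have "0 < x" using ab by simp
      then show "\<exists>y. ((\<lambda>s. h s - radial_pot k s) has_real_derivative y) (at x) \<and> 0 \<le> y"
        using d[of x] \<rho>[OF x] by (intro exI[of _ "(1 - \<rho> x) * inverse x ^ (k + 1)"]) simp
    qed
    then show ?thesis by simp
  qed
  show "radial_pot k a - radial_pot k b \<le> h a - h b" if \<rho>: "\<And>s. a \<le> s \<Longrightarrow> s \<le> b \<Longrightarrow> \<rho> s = 1"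
  proof -
    have "h b - radial_pot k b \<le> h a - radial_pot k a"
    proof (rule DERIV_nonpos_imp_nonincreasing[OF ab(2)])
      fix x assume x: "a \<le> x" "x \<le> b"
      then have "0 < x" using ab by simp
      then show "\<exists>y. ((\<lambda>s. h s - radial_pot k s) has_real_derivative y) (at x) \<and> y \<le> 0"
        using d[of x] \<rho>[OF x] by (intro exI[of _ "(1 - \<rho> x) * inverse x ^ (k + 1)"]) simp
    qed
    then show ?thesis by simp
  qed
qed

text \<open>The singular factor is harmless because \<rho> vanishes up to p > 0: g is 0 on the left
  of p and smooth on the positive axis. Constancy of h up to p makes P h / h(0) equal to P near the
  disc, and the last clause yields compact support.\<close>

lemma radial_profile:
  fixes \<rho> :: "real \<Rightarrow> real" and k :: nat
  assumes \<rho>: "smooth_on UNIV \<rho>" "\<And>s. s \<le> p \<Longrightarrow> \<rho> s = 0" "\<And>s. 0 \<le> \<rho> s" "\<And>s. \<rho> s \<le> 1" and p: "0 < p"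
  defines "g \<equiv> \<lambda>s. \<rho> s * inverse s ^ (k + 1)"
  shows "smooth_on UNIV g" "0 \<le> s \<Longrightarrow> 0 \<le> g s" "0 \<le> s \<Longrightarrow> s ^ (k + 1) * g s \<le> 1"
    and "\<exists>h. smooth_on UNIV h \<and> (\<forall>s. (h has_real_derivative - g s) (at s)) \<and> h S = 0 \<and>
      (\<forall>s. s \<le> p \<longrightarrow> h s = h 0) \<and> (\<forall>s t. s \<le> t \<longrightarrow> h t \<le> h s) \<and>
      (\<forall>b s. (\<forall>t. b \<le> t \<longrightarrow> \<rho> t = 0) \<longrightarrow> b \<le> S \<longrightarrow> b \<le> s \<longrightarrow> h s = 0)"
proof -
  have "smooth_on ({..<p} \<union> {0<..}) g"
  proof (rule smooth_on_Un)
    show "smooth_on {..<p} g"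
      by (rule smooth_on_cong[OF _ smooth_on_const[of _ 0]]) (use \<rho>(2) in \<open>auto simp: g_def\<close>)
    show "smooth_on {0<..} g"
      unfolding g_def by (intro smooth_on_mult smooth_on_power smooth_on_inverse smooth_on_subset[OF \<rho>(1)]) auto
  qed auto
  moreover have "{..<p} \<union> {0<..} = UNIV" using p by auto
  ultimately show sg: "smooth_on UNIV g" by simp
  obtain h0 where h0: "\<And>s. (h0 has_real_derivative - g s) (at s)" "smooth_on UNIV h0"
    using smooth_antiderivative[OF smooth_on_uminus[OF open_UNIV sg]] by metis
  have g0: "0 \<le> g s" for s
  proof (cases "s \<le> 0")
    case True then show ?thesis using \<rho>(2)[of s] p by (simp add: g_def)
  next
    case False then show ?thesis using \<rho>(3)[of s] by (simp add: g_def)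
  qed
  then show "0 \<le> g s" .
  show "s ^ (k + 1) * g s \<le> 1" if "0 \<le> s"
  proof (cases "s = 0")
    case False
    then have "s ^ (k + 1) * g s = \<rho> s" by (simp add: g_def field_simps)
    then show ?thesis using \<rho>(4) by simp
  qed simp
  have mono: "h0 t \<le> h0 s" if "s \<le> t" for s t
  proof (rule DERIV_nonpos_imp_nonincreasing[OF that])
    show "\<exists>y. DERIV h0 x :> y \<and> y \<le> 0" for x using h0(1)[of x] g0[of x] by (intro exI[of _ "- g x"]) auto
  qed
  have const: "h0 s = h0 t" if "s < t" "\<And>z. s < z \<Longrightarrow> z < t \<Longrightarrow> \<rho> z = 0" for s t
  proof -
    obtain z where "s < z" "z < t" "h0 t - h0 s = (t - s) * (- g z)" using MVT2[OF \<open>s < t\<close>, of h0 "\<lambda>s. - g s"] h0(1) by blast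
    moreover have "g z = 0" using that(2)[of z] \<open>s < z\<close> \<open>z < t\<close> by (simp add: g_def)
    ultimately show ?thesis by simp
  qed
  show "\<exists>h. smooth_on UNIV h \<and> (\<forall>s. (h has_real_derivative - g s) (at s)) \<and> h S = 0 \<and>
      (\<forall>s. s \<le> p \<longrightarrow> h s = h 0) \<and> (\<forall>s t. s \<le> t \<longrightarrow> h t \<le> h s) \<and>
      (\<forall>b s. (\<forall>t. b \<le> t \<longrightarrow> \<rho> t = 0) \<longrightarrow> b \<le> S \<longrightarrow> b \<le> s \<longrightarrow> h s = 0)"
  proof (rule exI[of _ "\<lambda>s. h0 s - h0 S"], intro conjI allI impI)
    show "smooth_on UNIV (\<lambda>s. h0 s - h0 S)" by (intro smooth_on_diff smooth_on_const h0) simp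
    show "((\<lambda>s. h0 s - h0 S) has_real_derivative - g s) (at s)" for s
      by (auto intro!: derivative_eq_intros h0(1))
    show "h0 s - h0 S = h0 0 - h0 S" if "s \<le> p" for s
      using const[of s p] const[of 0 p] \<rho>(2) p that by (cases "s = p") auto
    show "h0 s - h0 S = 0" if "\<forall>t. b \<le> t \<longrightarrow> \<rho> t = 0" "b \<le> S" "b \<le> s" for b s
    proof (cases s S rule: linorder_cases)
      case less
      then show ?thesis using const[OF less] that by force
    next
      case greater
      then show ?thesis using const[OF greater] that by force
    qed simp
  qed (use mono in auto)
qed


section \<open>Capacity of small discs\<close>

lemma laplacian_transform:
  assumes S: "open S" "x \<in> S" and eq: "\<And>y. y \<in> S \<Longrightarrow> f y = g y" and f: "smooth_on S f"
  shows "laplacian g x = laplacian f x"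
  unfolding laplacian_def
proof (rule sum.cong[OF refl])
  fix b :: 'a assume b: "b \<in> Basis"
  have "pd b g y = pd b f y" if "y \<in> S" for y
    by (rule pd_transform[OF S(1) that eq smooth_on_differentiable[OF f that]])
  then show "pd b (pd b g) x = pd b (pd b f) x"
    by (intro pd_transform[OF S] smooth_on_differentiable[OF smooth_on_pd[OF f b] S(2)]) simp
qed

lemma open_inner_self_less: "open {x::'a::real_inner. x \<bullet> x < r}"
  by (intro open_Collect_less continuous_intros)

lemma compact_inner_self_le: "compact {x::'a::euclidean_space. x \<bullet> x \<le> r}"
proof -
  have "x \<bullet> x \<le> r \<longleftrightarrow> norm x \<le> sqrt r" for x :: 'a unfolding norm_eq_sqrt_inner by simp
  then have "{x::'a. x \<bullet> x \<le> r} = cball 0 (sqrt r)"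
    by (intro set_eqI) (simp only: mem_Collect_eq mem_cball_0)
  then show ?thesis by simp
qed

text \<open>The test function is \<open>P h(\<bar>x\<bar>\<^sup>2)\<close> with \<open>h' = - \<rho> s\<^sup>-\<^sup>(\<^sup>k\<^sup>+\<^sup>1\<^sup>)\<close>: its Laplacian is
  \<open>- 4 P s\<^sup>-\<^sup>k \<rho>'\<close>, which lives in the thin annulus where \<open>\<rho>\<close> increases from 0 to 1.\<close>

lemma capacity_lower_estimate:
  fixes \<Omega> :: "(real^2) set"
  assumes \<Omega>: "open \<Omega>" "\<And>x. x \<in> \<Omega> \<Longrightarrow> x \<bullet> x < S" and u: "u \<in> H10 \<Omega>"
    and \<epsilon>: "0 < \<epsilon>" "\<epsilon>\<^sup>2 < S" and a: "0 < a" "a < 1"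
    and \<eta>: "0 \<le> \<eta>" "\<And>x. norm x \<le> \<epsilon> \<Longrightarrow> \<bar>u x - hpoly k c x\<bar> \<le> \<eta> * norm x ^ k"
      "\<eta> * cmod c \<le> hmean k c"
  shows "(4 * pi * (hmean k c - \<eta> * cmod c))\<^sup>2 \<le>
    capacity \<Omega> (cball 0 \<epsilon>) u * (4 * pi * hmean k c * (radial_pot k (a * \<epsilon>\<^sup>2) - radial_pot k S))"
proof -
  \<comment> \<open>In the variable |x|^2 the step of \<rho> runs from a \<epsilon>^2 to
    \<epsilon>^2, hence inside the disc; a is later taken close to 1.\<close>
  define p q where "p = a * \<epsilon>\<^sup>2" and "q = \<epsilon>\<^sup>2"
  have "0 < q" using \<epsilon>(1) by (simp add: q_def)
  moreover have "q < S" using \<epsilon>(2) by (simp add: q_def)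
  moreover have "0 < p" "p < q" using a \<open>0 < q\<close> by (simp_all add: p_def flip: q_def)
  ultimately have pq: "0 < p" "p < q" "q < S" "0 < S" by simp_all
  define m where "m = hmean k c"
  have m0: "m \<ge> 0" by (simp add: m_def hmean_def)
  obtain \<rho> \<rho>' where \<rho>: "smooth_on UNIV \<rho>" "smooth_on UNIV \<rho>'"
    "\<And>x. (\<rho> has_real_derivative \<rho>' x) (at x)" "\<And>x. 0 \<le> \<rho>' x"
    "\<And>x. x \<le> p \<Longrightarrow> \<rho> x = 0" "\<And>x. q \<le> x \<Longrightarrow> \<rho> x = 1" "\<And>x. 0 \<le> \<rho> x" "\<And>x. \<rho> x \<le> 1"
    "\<And>x. x \<notin> {p<..<q} \<Longrightarrow> \<rho>' x = 0"
    using smooth_step[OF pq(2)] by blast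
  define g where "g s = \<rho> s * inverse s ^ (k + 1)" for s
  note rp = radial_profile[OF \<rho>(1,5,7,8) pq(1), where k=k, folded g_def]
  obtain h where h: "smooth_on UNIV h" "\<And>s. (h has_real_derivative - g s) (at s)" "h S = 0"
    "\<And>s. s \<le> p \<Longrightarrow> h s = h 0"
    using rp(4)[of S] by blast
  define w0 where "w0 x = hpoly k c x * h (x \<bullet> x)" for x
  have sw0: "smooth_on UNIV w0" unfolding w0_def by (intro smooth_on_mult smooth_on_hpoly smooth_on_radial h) simp
  \<comment> \<open>As h is constant up to p, h(0) = h(p), and \<rho> \<le> 1 compares h with the
    potential between p and S.\<close>
  have h0: "h 0 \<le> radial_pot k p - radial_pot k S"
    using radial_profile_le[of h \<rho> k p S] h(2,3) h(4)[of p] \<rho>(8) pq by (simp add: g_def)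
  obtain g' where g': "\<And>s. (g has_real_derivative g' s) (at s)"
    using smooth_on_real_derivative[OF rp(1)] by blast
  \<comment> \<open>This is s^(k+1) g = \<rho> differentiated. At s = 0 both sides vanish because
    \<rho> and \<rho>' do.\<close>
  have ode: "4 * s * (- g' s) + 4 * (real k + 1) * (- g s) = - 4 * (inverse s ^ k * \<rho>' s)" if "0 \<le> s" for s
  proof (cases "s = 0")
    case True
    then show ?thesis using \<rho>(5,9)[of 0] pq by (simp add: g_def)
  next
    case False
    with that have s: "0 < s" by simp
    have "((\<lambda>s. inverse s ^ Suc k) has_real_derivative (1 + real k) * (- (inverse s ^ Suc (Suc 0)) * inverse s ^ k)) (at s)"
      using s by (intro DERIV_power_Suc DERIV_inverse) auto
    from DERIV_mult[OF \<rho>(3) this] have "(g has_real_derivative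
        \<rho>' s * inverse s ^ Suc k + (1 + real k) * (- (inverse s ^ Suc (Suc 0)) * inverse s ^ k) * \<rho> s) (at s)"
      by (simp add: g_def[abs_def])
    from DERIV_unique[OF g' this] have "s * g' s = \<rho>' s * inverse s ^ k - (1 + real k) * g s"
      using s by (simp add: g_def field_simps)
    then show ?thesis by (simp add: algebra_simps)
  qed
  define L where "L x = - 4 * (hpoly k c x * (inverse (x \<bullet> x) ^ k * \<rho>' (x \<bullet> x)))" for x
  have Lw0: "laplacian w0 = L"
  proof
    fix x
    have "laplacian w0 x = hpoly k c x * (4 * (x \<bullet> x) * (- g' (x \<bullet> x)) + 4 * (real k + 1) * (- g (x \<bullet> x)))"
      unfolding w0_def by (rule laplacian_hpoly_radial[OF h(2) _ h(1)]) (rule DERIV_minus[OF g'])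
    then show "laplacian w0 x = L x" by (simp only: ode[OF inner_ge_zero] L_def)
  qed
  have Lz: "L x = 0" if "x \<bullet> x \<notin> {p<..<q}" for x using \<rho>(9)[OF that] by (simp add: L_def)
  have "smooth_on UNIV L" using smooth_on_laplacian[OF open_UNIV sw0] Lw0 by simp
  then have L: "L \<in> test_functions UNIV"
    by (rule test_functionsI[OF _ compact_inner_self_le[of q]]) (use Lz in auto)
  \<comment> \<open>Multiplying w0 by a cutoff gives compact support. The cutoff is 1 where |x|^2
    \<le> S, so gradient and Laplacian are unchanged on \<Omega>.\<close>
  obtain \<sigma> where \<sigma>: "smooth_on UNIV \<sigma>" "\<And>x. x \<le> S \<Longrightarrow> \<sigma> x = 0" "\<And>x. S + 1 \<le> x \<Longrightarrow> \<sigma> x = (1::real)"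
    using smooth_step[of S "S + 1"] by auto
  have "smooth_on UNIV (\<lambda>x::real^2. 1 - \<sigma> (x \<bullet> x))"
    by (intro smooth_on_diff smooth_on_const smooth_on_radial \<sigma>) simp
  then have cut: "(\<lambda>x::real^2. 1 - \<sigma> (x \<bullet> x)) \<in> test_functions UNIV"
    by (rule test_functionsI[OF _ compact_inner_self_le[of "S + 1"]]) (use \<sigma>(3) in auto)
  define w where "w x = (1 - \<sigma> (x \<bullet> x)) * w0 x" for x
  have w: "w \<in> test_functions UNIV" unfolding w_def by (rule test_functions_mult[OF open_UNIV cut sw0])
  define B where "B = {x::real^2. x \<bullet> x < S}"
  have B: "open B" "\<Omega> \<subseteq> B" "\<And>x. x \<in> B \<Longrightarrow> w0 x = w x"
    using \<Omega>(2) \<sigma>(2) open_inner_self_less by (auto simp: B_def w_def)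
  have lw: "laplacian w x = L x" if "x \<in> \<Omega>" for x
    using laplacian_transform[OF B(1) _ B(3) smooth_on_subset[OF sw0], of x] that B(2) Lw0 by auto
  have gw: "gradient w x = gradient w0 x" if "x \<in> \<Omega>" for x
    using gradient_transform[OF B(1) _ B(3) smooth_on_differentiable[OF sw0], of x] that B(2) by auto
  have "laplacian w x = 0" if "x \<in> \<Omega> - cball 0 \<epsilon>" for x
  proof -
    have "\<epsilon> < norm x" using that by simp
    then have "\<epsilon>\<^sup>2 < (norm x)\<^sup>2" using \<epsilon>(1) by (intro power_strict_mono) auto
    then have "L x = 0" by (intro Lz) (simp add: q_def dot_square_norm)
    then show ?thesis using lw that by simp
  qed
  from capacity_lower_bound[OF \<Omega>(1) u w this]
  have main: "(LINT x|lebesgue. u x * laplacian w x)\<^sup>2 \<le>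
    capacity \<Omega> (cball 0 \<epsilon>) u * (LINT x|lebesgue_on \<Omega>. (norm (gradient w x))\<^sup>2)" .
  note su = H10_L2[OF u]
  note sL = test_functions_L2[OF L] and slw = test_functions_L2[OF test_functions_laplacian[OF w]]
  \<comment> \<open>The cutoff alters the Laplacian only off \<Omega>, where u vanishes almost
    everywhere.\<close>
  have "(LINT x|lebesgue. u x * (laplacian w x - L x)) = 0"
    using u L2_diff[OF slw sL] by (rule H10_integral_test_eq_0) (simp add: lw)
  then have D1: "(LINT x|lebesgue. u x * laplacian w x) = (LINT x|lebesgue. u x * L x)"
    using L2_mult_integrable[OF su slw] L2_mult_integrable[OF su sL] by (simp add: right_diff_distrib)
  have \<rho>c: "continuous_on UNIV \<rho>'" by (rule smooth_on_continuous[OF \<rho>(2)])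
  have \<rho>0: "\<rho> 0 = 0" "\<rho> q = 1" using \<rho>(5)[of 0] \<rho>(6)[of q] pq by auto
  note st = integral_hpoly_step(1)[OF \<rho>(3) \<rho>c \<rho>0 pq(1,2) \<rho>(9)]
    integral_hpoly_step(2,3)[OF \<rho>(3) \<rho>c \<rho>0 pq(1,2) \<rho>(9), where k=k and c=c]
  have PL: "(\<lambda>x. L x * hpoly k c x) \<in> test_functions UNIV"
    by (rule test_functions_mult[OF open_UNIV L smooth_on_hpoly])
  have PLeq: "hpoly k c x * L x = - 4 * ((hpoly k c x)\<^sup>2 * (inverse (x \<bullet> x) ^ k * \<rho>' (x \<bullet> x)))" for x
    by (simp add: L_def power2_eq_square)
  have "(LINT x|lebesgue. hpoly k c x * L x) = (LINT x|lborel. hpoly k c x * L x)"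
    using test_functions_integral_lborel[OF PL] by (simp add: mult.commute)
  also have "\<dots> = - 4 * (m * pi)" unfolding PLeq using st(2,3) by (simp add: m_def)
  finally have I1: "(LINT x|lebesgue. hpoly k c x * L x) = - 4 * (m * pi)" .
  have iPL: "integrable lebesgue (\<lambda>x. hpoly k c x * L x)"
    using test_functions_integrable[OF PL] by (simp add: mult.commute)
  have iuL: "integrable lebesgue (\<lambda>x. u x * L x)" by (rule L2_mult_integrable[OF su sL])
  have \<rho>'t: "(\<lambda>x::real^2. \<rho>' (x \<bullet> x)) \<in> test_functions UNIV"
    by (rule test_functionsI[OF smooth_on_radial[OF \<rho>(2)] compact_inner_self_le[of q]]) (use \<rho>(9) in auto)
  \<comment> \<open>On the disc |u - P| \<le> \<eta> |x|^k and |P| \<le> |c| |x|^k; the product of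
    the powers is s^k and cancels the weight in L.\<close>
  have bound: "\<bar>(u x - hpoly k c x) * L x\<bar> \<le> 4 * \<eta> * cmod c * \<rho>' (x \<bullet> x)" for x
  proof (cases "x \<bullet> x \<in> {p<..<q}")
    case False
    then show ?thesis using Lz[OF False] \<rho>(9)[OF False] by simp
  next
    case True
    define s where "s = x \<bullet> x"
    have s: "0 < s" "s < q" using True pq by (auto simp: s_def)
    have n: "(norm x)\<^sup>2 = s" by (simp add: s_def dot_square_norm)
    have "(norm x)\<^sup>2 \<le> \<epsilon>\<^sup>2" using n s by (simp add: q_def)
    then have "norm x \<le> \<epsilon>" using \<epsilon>(1) by (simp add: power2_le_iff_abs_le)
    then have 1: "\<bar>u x - hpoly k c x\<bar> \<le> \<eta> * norm x ^ k" by (rule \<eta>(2))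
    have "(hpoly k c x)\<^sup>2 \<le> (cmod c * norm x ^ k)\<^sup>2"
    proof -
      have "s ^ k = (norm x ^ k)\<^sup>2" by (simp add: n[symmetric] power_mult[symmetric] mult.commute)
      then show ?thesis using hpoly_squared_le[of k c x] by (simp add: s_def[symmetric] power_mult_distrib)
    qed
    then have 2: "\<bar>hpoly k c x\<bar> \<le> cmod c * norm x ^ k" by (simp add: power2_le_iff_abs_le)
    have "\<bar>u x - hpoly k c x\<bar> * \<bar>hpoly k c x\<bar> \<le> (\<eta> * norm x ^ k) * (cmod c * norm x ^ k)"
      using \<eta>(1) by (intro mult_mono 1 2) auto
    also have "\<dots> = \<eta> * cmod c * s ^ k"
      by (simp add: n[symmetric] power_mult[symmetric] power_mult_distrib power2_eq_square algebra_simps)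
    finally have "\<bar>u x - hpoly k c x\<bar> * \<bar>hpoly k c x\<bar> * (4 * (inverse s ^ k * \<rho>' s)) \<le> \<eta> * cmod c * s ^ k * (4 * (inverse s ^ k * \<rho>' s))"
      using s \<rho>(4) by (intro mult_right_mono) auto
    moreover have "s ^ k * inverse s ^ k = 1" using s by (simp add: power_mult_distrib[symmetric])
    then have "\<eta> * cmod c * s ^ k * (4 * (inverse s ^ k * \<rho>' s)) = 4 * \<eta> * cmod c * \<rho>' s"
      by (simp add: algebra_simps)
    moreover have "\<bar>(u x - hpoly k c x) * L x\<bar> = \<bar>u x - hpoly k c x\<bar> * \<bar>hpoly k c x\<bar> * (4 * (inverse s ^ k * \<rho>' s))"
      using s \<rho>(4)[of s] by (simp add: L_def abs_mult s_def)
    ultimately show ?thesis unfolding s_def by linarith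
  qed
  have id: "integrable lebesgue (\<lambda>x. (u x - hpoly k c x) * L x)"
    using iuL iPL by (simp add: left_diff_distrib)
  have "\<bar>LINT x|lebesgue. (u x - hpoly k c x) * L x\<bar> \<le> (LINT x|lebesgue. \<bar>(u x - hpoly k c x) * L x\<bar>)"
    by (rule integral_abs_bound)
  also have "\<dots> \<le> (LINT x::real^2|lebesgue. 4 * \<eta> * cmod c * \<rho>' (x \<bullet> x))"
    using id test_functions_integrable[OF \<rho>'t] by (intro integral_mono bound) auto
  also have "\<dots> = 4 * \<eta> * cmod c * pi"
    using test_functions_integral_lborel[OF \<rho>'t] st(1) by simp
  finally have I2: "\<bar>LINT x|lebesgue. (u x - hpoly k c x) * L x\<bar> \<le> 4 * \<eta> * cmod c * pi" .
  have "(LINT x|lebesgue. u x * L x) = (LINT x|lebesgue. (u x - hpoly k c x) * L x) + (LINT x|lebesgue. hpoly k c x * L x)"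
    using iuL iPL by (simp add: left_diff_distrib)
  then have "4 * pi * (m - \<eta> * cmod c) \<le> - (LINT x|lebesgue. u x * L x)"
    using I1 I2 by (simp add: algebra_simps)
  \<comment> \<open>The smallness of \<eta> enters here: the inequality can be squared because its
    left side is nonnegative.\<close>
  moreover have "0 \<le> 4 * pi * (m - \<eta> * cmod c)" using \<eta>(3) by (simp add: m_def)
  ultimately have "(4 * pi * (m - \<eta> * cmod c))\<^sup>2 \<le> (- (LINT x|lebesgue. u x * L x))\<^sup>2" by (rule power_mono)
  then have low: "(4 * pi * (m - \<eta> * cmod c))\<^sup>2 \<le> (LINT x|lebesgue. u x * laplacian w x)\<^sup>2" by (simp add: D1)
  \<comment> \<open>The energy density on the disc |x|^2 \<le> S, which contains \<Omega>; enlarging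
    the domain to a disc makes the radial computation available.\<close>
  define e where "e x = indicator {..S} (x \<bullet> x) * (norm (gradient w0 x))\<^sup>2" for x
  have e: "integrable lborel e" "(LINT x|lborel. e x) \<le> 4 * pi * m * h 0"
    using energy_hpoly_radial[OF h(2,1) smooth_on_continuous[OF rp(1)] rp(2,3) pq(4) h(3), of c]
    by (simp_all add: e_def[abs_def] w0_def[abs_def] m_def)
  have m\<Omega>: "\<Omega> \<in> sets lebesgue" using \<Omega>(1) by (simp add: borel_open)
  have sgw: "L2 (lebesgue_on \<Omega>) (gradient w)" by (rule L2_lebesgue_on[OF test_functions_gradient_L2[OF w] m\<Omega>])
  have el: "integrable lebesgue e" "(LINT x|lebesgue. e x) = (LINT x|lborel. e x)"
    using e(1) by (auto intro: integrable_completion[THEN iffD2] integral_completion dest: borel_measurable_integrable)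
  have "(LINT x|lebesgue_on \<Omega>. (norm (gradient w x))\<^sup>2) = (LINT x|lebesgue. indicator \<Omega> x *\<^sub>R (norm (gradient w x))\<^sup>2)"
    using m\<Omega> by (subst integral_restrict_space) auto
  also have "\<dots> \<le> (LINT x|lebesgue. e x)"
  proof (rule integral_mono[OF _ el(1)])
    show "integrable lebesgue (\<lambda>x. indicator \<Omega> x *\<^sub>R (norm (gradient w x))\<^sup>2)"
      using L2_integrable[OF sgw] m\<Omega> by (subst (asm) integrable_restrict_space) auto
    show "indicator \<Omega> x *\<^sub>R (norm (gradient w x))\<^sup>2 \<le> e x" for x
      using \<Omega>(2)[of x] gw[of x] by (auto simp: e_def indicator_def)
  qed
  also have "\<dots> \<le> 4 * pi * m * h 0" using e(2) el(2) by simp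
  also have "\<dots> \<le> 4 * pi * m * (radial_pot k p - radial_pot k S)"
    using h0 m0 by (intro mult_left_mono) auto
  finally have "(LINT x|lebesgue_on \<Omega>. (norm (gradient w x))\<^sup>2) \<le> 4 * pi * m * (radial_pot k p - radial_pot k S)" .
  then have "capacity \<Omega> (cball 0 \<epsilon>) u * (LINT x|lebesgue_on \<Omega>. (norm (gradient w x))\<^sup>2) \<le>
      capacity \<Omega> (cball 0 \<epsilon>) u * (4 * pi * m * (radial_pot k p - radial_pot k S))"
    using capacity_nonneg[OF \<Omega>(1) u] by (intro mult_left_mono)
  then show ?thesis using low main by (simp add: m_def p_def)
qed

lemma gradient_cmult:
  "f differentiable (at x) \<Longrightarrow> gradient (\<lambda>x. a * f x) x = a *\<^sub>R gradient f x"
  using gradient_mult[of "\<lambda>x. a" x f] by simp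

text \<open>The bound at the centre shows C \<ge> 0. A non-integrable function has integral 0 by
  convention, which the estimate covers too.\<close>

lemma integral_le_on_cball:
  fixes f :: "real^2 \<Rightarrow> real"
  assumes b: "\<And>x. \<bar>f x\<bar> \<le> C * indicator (cball 0 r) x" and r: "0 \<le> r"
  shows "\<bar>LINT x|lebesgue. f x\<bar> \<le> C * (pi * r\<^sup>2)"
proof -
  have C: "C \<ge> 0" using b[of 0] r by (simp add: indicator_def split: if_splits)
  have I: "measure lborel (cball (0::real^2) r) = pi * r\<^sup>2"
    using r by (simp add: content_cball unit_ball_vol_2)
  show ?thesis
  proof (cases "integrable lebesgue f")
    case True
    have "\<bar>LINT x|lebesgue. f x\<bar> \<le> (LINT x|lebesgue. \<bar>f x\<bar>)" by (rule integral_abs_bound)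
    also have "\<dots> \<le> (LINT x::real^2|lebesgue. C * indicator (cball 0 r) x)"
    proof (rule integral_mono)
      show "\<bar>f x\<bar> \<le> C * indicator (cball 0 r) x" for x by (rule b)
      show "integrable lebesgue (\<lambda>x::real^2. C * indicator (cball 0 r) x)"
        using emeasure_lborel_cball_finite by (intro integrable_mult_right integrable_real_indicator) auto
    qed (use True in simp)
    finally show ?thesis by (simp add: I)
  next
    case False
    then show ?thesis using C by (simp add: not_integrable_integral_eq)
  qed
qed

text \<open>The competitor is \<open>P h(\<bar>x\<bar>\<^sup>2) / h(0) + \<kappa> (u - P)\<close>; it equals \<open>u\<close> near the disc.\<close>

lemma capacity_upper_estimate:
  fixes \<Omega> :: "(real^2) set"
  assumes \<Omega>: "open \<Omega>" "\<And>x. x \<bullet> x \<le> S \<Longrightarrow> x \<in> \<Omega>" and u: "u \<in> H10 \<Omega>" "smooth_on \<Omega> u"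
    and l: "\<And>\<psi>. \<psi> \<in> test_functions \<Omega> \<Longrightarrow>
      (LINT x|lebesgue. gradient \<psi> x \<bullet> gradient u x) = l * (LINT x|lebesgue. \<psi> x * u x)"
  shows "\<exists>M\<ge>0. \<forall>\<epsilon> \<delta> t N N'. 0 < \<epsilon> \<longrightarrow> 8 * \<epsilon>\<^sup>2 \<le> S \<longrightarrow> 0 < \<delta> \<longrightarrow> \<delta> \<le> 1 \<longrightarrow> 0 < t \<longrightarrow>
    (\<forall>x. norm x \<le> 2 * \<epsilon> \<longrightarrow> (u x - hpoly k c x)\<^sup>2 \<le> N) \<longrightarrow>
    (\<forall>x. norm x \<le> 2 * \<epsilon> \<longrightarrow> (hpoly k c x)\<^sup>2 \<le> N') \<longrightarrow>
    capacity \<Omega> (cball 0 \<epsilon>) u \<le>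
      (1 + t) * (4 * pi * hmean k c / (radial_pot k ((1 + \<delta>) * \<epsilon>\<^sup>2) - radial_pot k (S / 2))) +
      (1 + 1 / t) * (\<bar>l\<bar> * ((2 * N + N') * (4 * pi * \<epsilon>\<^sup>2)) + M * N)"
proof -
  \<comment> \<open>One cutoff profile in the variable |x|^2 / \<epsilon>^2, fixed before
    \<epsilon>, so that M does not depend on \<epsilon>.\<close>
  obtain \<sigma> \<sigma>' where \<sigma>: "smooth_on UNIV \<sigma>" "smooth_on UNIV \<sigma>'" "\<And>x. (\<sigma> has_real_derivative \<sigma>' x) (at x)"
    "\<And>x. x \<le> 2 \<Longrightarrow> \<sigma> x = 0" "\<And>x. 3 \<le> x \<Longrightarrow> \<sigma> x = (1::real)" "\<And>x. 0 \<le> \<sigma> x" "\<And>x. \<sigma> x \<le> 1"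
    "\<And>x. x \<notin> {2<..<3} \<Longrightarrow> \<sigma>' x = 0"
    using smooth_step[of 2 "3::real"] by auto
  have "bounded (\<sigma>' ` {2..3})"
    by (intro compact_imp_bounded compact_continuous_image continuous_on_subset[OF smooth_on_continuous[OF \<sigma>(2)]]) auto
  then have "\<exists>M. \<forall>s\<in>{2..3}. \<bar>\<sigma>' s\<bar> \<le> M" by (auto simp: bounded_iff)
  then obtain M0 where M0: "\<And>s. s \<in> {2..3} \<Longrightarrow> \<bar>\<sigma>' s\<bar> \<le> M0" by blast
  define M1 where "M1 = max M0 0"
  have M1: "\<bar>\<sigma>' s\<bar> \<le> M1" "0 \<le> M1" for s using M0[of s] \<sigma>(8)[of s] by (cases "s \<in> {2<..<3}"; force simp: M1_def)+
  define m where "m = hmean k c"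
  have m0: "m \<ge> 0" by (simp add: m_def hmean_def)
  define P where "P = hpoly k c"
  show ?thesis
  \<comment> \<open>The squared gradient of \<kappa> is at most 16 M1^2 / \<epsilon>^2, and the disc
    of radius 2 \<epsilon> has area 4 \<pi> \<epsilon>^2.\<close>
  proof (intro exI[of _ "64 * pi * M1\<^sup>2"] conjI allI impI)
    fix \<epsilon> \<delta> t N N' :: real
    assume \<epsilon>: "0 < \<epsilon>" "8 * \<epsilon>\<^sup>2 \<le> S" and \<delta>: "0 < \<delta>" "\<delta> \<le> 1" and t: "0 < t"
      and N: "\<forall>x. norm x \<le> 2 * \<epsilon> \<longrightarrow> (u x - hpoly k c x)\<^sup>2 \<le> N"
      and N': "\<forall>x. norm x \<le> 2 * \<epsilon> \<longrightarrow> (hpoly k c x)\<^sup>2 \<le> N'"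
    define q where "q = \<epsilon>\<^sup>2"
    have q: "0 < q" "8 * q \<le> S" using \<epsilon> by (auto simp: q_def)
    have "\<delta> * q \<le> q" using \<delta> q by simp
    then have q': "(1 + \<delta>) * q \<le> 2 * q" "0 < \<delta> * q" using \<delta> q by (simp_all add: algebra_simps)
    have ball: "norm x \<le> 2 * \<epsilon>" if "x \<bullet> x \<le> 4 * q" for x :: "real^2"
    proof -
      have "(norm x)\<^sup>2 \<le> (2 * \<epsilon>)\<^sup>2" using that by (simp add: dot_square_norm q_def power_mult_distrib)
      then show ?thesis by (rule power2_le_imp_le) (use \<epsilon>(1) in simp)
    qed
    \<comment> \<open>The rise starts at (1 + 3 \<delta> / 4) \<epsilon>^2 and not at \<epsilon>^2,
      which leaves a collar around the disc where the competitor equals u.\<close>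
    obtain \<rho>1 where \<rho>1: "smooth_on UNIV \<rho>1" "\<And>x. x \<le> (1 + 3 * \<delta> / 4) * q \<Longrightarrow> \<rho>1 x = 0" "\<And>x. (1 + \<delta>) * q \<le> x \<Longrightarrow> \<rho>1 x = 1"
      "\<And>x. 0 \<le> \<rho>1 x" "\<And>x. \<rho>1 x \<le> (1::real)"
    proof -
      have "(1 + 3 * \<delta> / 4) * q < (1 + \<delta>) * q" using \<delta> q by simp
      from smooth_step[OF this] that show thesis by blast
    qed
    \<comment> \<open>Switching \<rho> off by 3 S / 4 makes h vanish from there on, so the leading
      part is supported in \<Omega>. The stretch up to S / 2 is left untouched and already makes
      h(0) large enough.\<close>
    obtain \<rho>2 where \<rho>2: "smooth_on UNIV \<rho>2" "\<And>x. x \<le> S / 2 \<Longrightarrow> \<rho>2 x = 0" "\<And>x. 3 * S / 4 \<le> x \<Longrightarrow> \<rho>2 x = 1"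
      "\<And>x. 0 \<le> \<rho>2 x" "\<And>x. \<rho>2 x \<le> (1::real)"
    proof -
      have "S / 2 < 3 * S / 4" using q by simp
      from smooth_step[OF this] that show thesis by blast
    qed
    define \<rho> where "\<rho> s = \<rho>1 s * (1 - \<rho>2 s)" for s
    have s\<rho>: "smooth_on UNIV \<rho>"
      unfolding \<rho>_def by (intro smooth_on_mult smooth_on_diff smooth_on_const \<rho>1(1) \<rho>2(1)) simp_all
    have \<rho>: "\<And>s. s \<le> (1 + 3 * \<delta> / 4) * q \<Longrightarrow> \<rho> s = 0" "\<And>s. 0 \<le> \<rho> s" "\<And>s. \<rho> s \<le> 1"
      using \<rho>1 \<rho>2 by (auto simp: \<rho>_def intro!: mult_le_one)
    define g where "g s = \<rho> s * inverse s ^ (k + 1)" for s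
    have p0: "0 < (1 + 3 * \<delta> / 4) * q" using \<delta> q by simp
    note rp = radial_profile[OF s\<rho> \<rho> p0, where k=k, folded g_def]
    obtain h where h: "smooth_on UNIV h" "\<And>s. (h has_real_derivative - g s) (at s)" "h S = 0"
      "\<And>s. s \<le> (1 + 3 * \<delta> / 4) * q \<Longrightarrow> h s = h 0" "\<And>s t. s \<le> t \<Longrightarrow> h t \<le> h s"
      "\<forall>b s. (\<forall>t. b \<le> t \<longrightarrow> \<rho> t = 0) \<longrightarrow> b \<le> S \<longrightarrow> b \<le> s \<longrightarrow> h s = 0"
      using rp(4)[of S] by blast
    have hz: "h s = 0" if "3 * S / 4 \<le> s" for s
      using h(6)[rule_format, of "3 * S / 4" s] \<rho>2(3) that q by (simp add: \<rho>_def)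
    define T where "T = radial_pot k ((1 + \<delta>) * q) - radial_pot k (S / 2)"
    have ord: "0 < (1 + \<delta>) * q" "(1 + \<delta>) * q < S / 2"
    proof -
      show "0 < (1 + \<delta>) * q" using q \<delta> by simp
      show "(1 + \<delta>) * q < S / 2" using q q'(1) by linarith
    qed
    have T: "0 < T" using radial_pot_strict_antimono[OF ord] by (simp add: T_def)
    \<comment> \<open>Here \<rho> = 1, so h drops at least as much as the potential does. Thus T
      bounds h(0) from below and the energy 4 \<pi> m / h(0) from above.\<close>
    have "T \<le> h ((1 + \<delta>) * q) - h (S / 2)"
      unfolding T_def by (rule radial_profile_ge[where \<rho>=\<rho>]) (use h(2) ord \<rho>1(3) \<rho>2(2) in \<open>auto simp: g_def \<rho>_def\<close>)
    also have "\<dots> \<le> h 0" using h(5)[of 0 "(1 + \<delta>) * q"] h(5)[of "S / 2" S] h(3) ord q by simp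
    finally have Th: "T \<le> h 0" .
    with T have h0: "0 < h 0" by simp
    define w where "w x = P x * h (x \<bullet> x)" for x
    have sw: "smooth_on UNIV w" unfolding w_def P_def by (intro smooth_on_mult smooth_on_hpoly smooth_on_radial h) simp
    define f1 where "f1 x = inverse (h 0) * w x" for x
    have sf1: "smooth_on UNIV f1" unfolding f1_def by (intro smooth_on_mult smooth_on_const sw) simp
    have f1: "f1 \<in> test_functions \<Omega>"
      by (rule test_functionsI[OF sf1 compact_inner_self_le[of "3 * S / 4"]])
         (use \<Omega>(2) hz q in \<open>auto simp: f1_def w_def\<close>)
    define e where "e x = indicator {..S} (x \<bullet> x) * (norm (gradient w x))\<^sup>2" for x
    have e: "integrable lborel e" "(LINT x|lborel. e x) \<le> 4 * pi * m * h 0"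
      using energy_hpoly_radial[OF h(2,1) smooth_on_continuous[OF rp(1)] rp(2,3) _ h(3), of c] q
      by (simp_all add: e_def[abs_def] w_def[abs_def] m_def P_def)
    have "gradient w x = 0" if "x \<bullet> x > S" for x
    proof (rule gradient_zero_transform[of "{x. S < x \<bullet> x}"])
      show "open {x::real^2. S < x \<bullet> x}" by (intro open_Collect_less continuous_intros)
      show "w y = 0" if "y \<in> {x. S < x \<bullet> x}" for y using that hz[of "y \<bullet> y"] q by (simp add: w_def)
    qed (use that in simp)
    then have ew: "(norm (gradient f1 x))\<^sup>2 = (inverse (h 0))\<^sup>2 * e x" for x
      unfolding f1_def gradient_cmult[OF smooth_on_differentiable[OF sw UNIV_I]]
      by (cases "x \<bullet> x \<le> S") (use h0 in \<open>auto simp: e_def power_mult_distrib\<close>)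
    have E1: "(LINT x|lebesgue. (norm (gradient f1 x))\<^sup>2) \<le> 4 * pi * m / T"
    proof -
      have "(LINT x|lebesgue. e x) = (LINT x|lborel. e x)"
        using e(1) by (auto intro: integral_completion dest: borel_measurable_integrable)
      then have "(LINT x|lebesgue. (norm (gradient f1 x))\<^sup>2) \<le> (inverse (h 0))\<^sup>2 * (4 * pi * m * h 0)"
        using e(2) by (simp add: ew mult_left_mono)
      also have "\<dots> = 4 * pi * m / h 0" using h0 by (simp add: power2_eq_square field_simps)
      also have "\<dots> \<le> 4 * pi * m / T" using Th T m0 by (intro divide_left_mono) auto
      finally show ?thesis .
    qed
    define \<kappa> where "\<kappa> x = 1 - \<sigma> (inverse q * (x \<bullet> x))" for x :: "real^2"
    have s\<sigma>: "smooth_on UNIV (\<lambda>x::real^2. \<sigma> (inverse q * (x \<bullet> x)))"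
      by (rule smooth_on_compose[OF open_UNIV open_UNIV _ _ \<sigma>(1)])
         (auto intro!: smooth_on_mult smooth_on_const smooth_on_inner_self)
    have s\<kappa>: "smooth_on UNIV \<kappa>" unfolding \<kappa>_def by (intro smooth_on_diff smooth_on_const s\<sigma>) simp
    have \<kappa>z: "\<kappa> x = 0" if "3 * q \<le> x \<bullet> x" for x
      using that q \<sigma>(5)[of "inverse q * (x \<bullet> x)"] by (simp add: \<kappa>_def field_simps)
    have \<kappa>1: "\<kappa> x = 1" if "x \<bullet> x \<le> 2 * q" for x
      using that q \<sigma>(4)[of "inverse q * (x \<bullet> x)"] by (simp add: \<kappa>_def field_simps)
    have \<kappa>b: "0 \<le> \<kappa> x" "\<kappa> x \<le> 1" for x using \<sigma>(6,7) by (auto simp: \<kappa>_def)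
    have \<kappa>: "\<kappa> \<in> test_functions \<Omega>"
      by (rule test_functionsI[OF s\<kappa> compact_inner_self_le[of "3 * q"]]) (use \<Omega>(2) q \<kappa>z in auto)
    have g\<kappa>: "gradient \<kappa> x = - (2 * \<sigma>' (inverse q * (x \<bullet> x)) / q) *\<^sub>R x" for x
    proof -
      have "((\<lambda>s. 1 - \<sigma> (inverse q * s)) has_real_derivative - (\<sigma>' (inverse q * (x \<bullet> x)) * inverse q)) (at (x \<bullet> x))"
        by (rule derivative_eq_intros DERIV_chain2[OF \<sigma>(3)] refl | simp)+
      from gradient_radial[OF this] show ?thesis unfolding \<kappa>_def by (simp add: divide_inverse)
    qed
    define v where "v x = u x - P x" for x
    define f2 where "f2 x = \<kappa> x * v x" for x
    have sP: "smooth_on UNIV P" unfolding P_def by (rule smooth_on_hpoly)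
    have f2: "f2 \<in> test_functions \<Omega>"
      unfolding f2_def v_def using smooth_on_subset[OF sP] by (intro test_functions_mult \<Omega>(1) \<kappa> smooth_on_diff u(2)) simp
    have E2: "(LINT x|lebesgue. (norm (gradient f2 x))\<^sup>2) =
        l * (LINT x|lebesgue. (\<kappa> x)\<^sup>2 * (u x * v x)) + (LINT x|lebesgue. (v x)\<^sup>2 * (norm (gradient \<kappa> x))\<^sup>2)"
      unfolding f2_def v_def by (rule caccioppoli_identity[OF \<Omega>(1) u(2) l sP _ \<kappa>]) (simp_all add: P_def laplacian_hpoly)
    have vN: "(v x)\<^sup>2 \<le> N" "(P x)\<^sup>2 \<le> N'" if "norm x \<le> 2 * \<epsilon>" for x
      using N N' that by (auto simp: v_def P_def)
    have NN: "0 \<le> N" "0 \<le> N'" using vN[of 0] \<epsilon>(1) order_trans[OF zero_le_power2] by auto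
    have out: "x \<bullet> x > 4 * q" if "x \<notin> cball 0 (2 * \<epsilon>)" for x :: "real^2"
      using ball[of x] that by force
    \<comment> \<open>Writing u v = v^2 + P v and 2 |P v| \<le> P^2 + v^2 expresses the bound
      through N and N' alone.\<close>
    have "\<bar>LINT x|lebesgue. (\<kappa> x)\<^sup>2 * (u x * v x)\<bar> \<le> (2 * N + N') * (pi * (2 * \<epsilon>)\<^sup>2)"
    proof (rule integral_le_on_cball)
      show "\<bar>(\<kappa> x)\<^sup>2 * (u x * v x)\<bar> \<le> (2 * N + N') * indicator (cball 0 (2 * \<epsilon>)) x" for x
      proof (cases "x \<in> cball 0 (2 * \<epsilon>)")
        case True
        then have x: "norm x \<le> 2 * \<epsilon>" by simp
        have "u x * v x = (v x)\<^sup>2 + P x * v x" by (simp add: v_def power2_eq_square algebra_simps)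
        moreover have "2 * \<bar>P x * v x\<bar> \<le> (P x)\<^sup>2 + (v x)\<^sup>2"
          using sum_squares_bound[of "\<bar>P x\<bar>" "\<bar>v x\<bar>"] by (simp add: abs_mult)
        ultimately have "\<bar>u x * v x\<bar> \<le> 2 * N + N'" using vN[OF x] NN by (simp add: abs_le_iff) linarith
        moreover have "(\<kappa> x)\<^sup>2 \<le> 1" using \<kappa>b[of x] by (simp add: power_le_one)
        ultimately have "(\<kappa> x)\<^sup>2 * \<bar>u x * v x\<bar> \<le> 1 * (2 * N + N')" by (intro mult_mono) auto
        then show ?thesis using True by (simp add: abs_mult)
      next
        case False
        then show ?thesis using \<kappa>z[of x] out[OF False] q by simp
      qed
    qed (use \<epsilon> in simp)
    then have "\<bar>l\<bar> * \<bar>LINT x|lebesgue. (\<kappa> x)\<^sup>2 * (u x * v x)\<bar> \<le> \<bar>l\<bar> * ((2 * N + N') * (pi * (2 * \<epsilon>)\<^sup>2))"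
      by (intro mult_left_mono) auto
    then have A1: "l * (LINT x|lebesgue. (\<kappa> x)\<^sup>2 * (u x * v x)) \<le> \<bar>l\<bar> * ((2 * N + N') * (4 * pi * \<epsilon>\<^sup>2))"
      using abs_ge_self[of "l * (LINT x|lebesgue. (\<kappa> x)\<^sup>2 * (u x * v x))"] by (simp add: abs_mult power_mult_distrib algebra_simps)
    have "\<bar>LINT x|lebesgue. (v x)\<^sup>2 * (norm (gradient \<kappa> x))\<^sup>2\<bar> \<le> (N * (16 * M1\<^sup>2 / q)) * (pi * (2 * \<epsilon>)\<^sup>2)"
    proof (rule integral_le_on_cball)
      show "\<bar>(v x)\<^sup>2 * (norm (gradient \<kappa> x))\<^sup>2\<bar> \<le> (N * (16 * M1\<^sup>2 / q)) * indicator (cball 0 (2 * \<epsilon>)) x" for x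
      proof (cases "x \<in> cball 0 (2 * \<epsilon>)")
        case True
        then have x: "norm x \<le> 2 * \<epsilon>" by simp
        then have "(norm x)\<^sup>2 \<le> (2 * \<epsilon>)\<^sup>2" by (intro power_mono) auto
        then have nx: "(norm x)\<^sup>2 \<le> 4 * q" by (simp add: q_def power_mult_distrib)
        have "(\<sigma>' (inverse q * (x \<bullet> x)))\<^sup>2 \<le> M1\<^sup>2"
          using M1(1)[of "inverse q * (x \<bullet> x)"] M1(2) by (simp add: power2_le_iff_abs_le)
        then have "(\<sigma>' (inverse q * (x \<bullet> x)))\<^sup>2 * (norm x)\<^sup>2 \<le> M1\<^sup>2 * (4 * q)" using nx by (intro mult_mono) auto
        moreover have "(norm (gradient \<kappa> x))\<^sup>2 = (4 / q\<^sup>2) * ((\<sigma>' (inverse q * (x \<bullet> x)))\<^sup>2 * (norm x)\<^sup>2)"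
          unfolding g\<kappa> by (simp add: power_mult_distrib power_divide)
        ultimately have "(norm (gradient \<kappa> x))\<^sup>2 \<le> (4 / q\<^sup>2) * (M1\<^sup>2 * (4 * q))" by (simp only:) (intro mult_left_mono; simp)
        also have "\<dots> = 16 * M1\<^sup>2 / q" using q by (simp add: power2_eq_square)
        finally have "(v x)\<^sup>2 * (norm (gradient \<kappa> x))\<^sup>2 \<le> N * (16 * M1\<^sup>2 / q)"
          using vN(1)[OF x] NN by (intro mult_mono) auto
        then show ?thesis using True by simp
      next
        case False
        have "inverse q * (x \<bullet> x) \<notin> {2<..<3}" using out[OF False] q by (simp add: field_simps)
        then show ?thesis using False \<sigma>(8) by (simp add: g\<kappa>)
      qed
    qed (use \<epsilon> in simp)
    also have "(N * (16 * M1\<^sup>2 / q)) * (pi * (2 * \<epsilon>)\<^sup>2) = 64 * pi * M1\<^sup>2 * N"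
      using \<epsilon>(1) by (simp add: q_def power_mult_distrib field_simps)
    finally have A2: "(LINT x|lebesgue. (v x)\<^sup>2 * (norm (gradient \<kappa> x))\<^sup>2) \<le> 64 * pi * M1\<^sup>2 * N" by simp
    \<comment> \<open>In units of \<epsilon>^2 the thresholds for |x|^2 are 1 for the disc, 1 +
      \<delta>/4 for W, 1 + \<delta>/2 for the support of the auxiliary cutoff and 1 + 3 \<delta>/4
      for V. On V one has h = h(0) and \<kappa> = 1, so the competitor is P + (u - P).\<close>
    define V where "V = {x::real^2. x \<bullet> x < (1 + 3 * \<delta> / 4) * q}"
    define W where "W = {x::real^2. x \<bullet> x < (1 + \<delta> / 4) * q}"
    have V: "f1 x + f2 x = u x" if "x \<in> V" for x
    proof -
      have "x \<bullet> x \<le> (1 + 3 * \<delta> / 4) * q" using that by (simp add: V_def)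
      then have "h (x \<bullet> x) = h 0" by (rule h(4))
      moreover have "(1 + 3 * \<delta> / 4) * q \<le> 2 * q" using q \<delta> by (intro mult_right_mono) auto
      then have "\<kappa> x = 1" using that by (intro \<kappa>1) (simp add: V_def)
      ultimately show ?thesis using h0 by (simp add: f1_def w_def f2_def v_def)
    qed
    have lt: "(1 + \<delta> / 4) * q < (1 + \<delta> / 2) * q" "(1 + \<delta> / 2) * q < (1 + 3 * \<delta> / 4) * q" "q < (1 + \<delta> / 4) * q"
      using q \<delta> by (simp_all add: algebra_simps)
    obtain \<tau> where \<tau>: "smooth_on UNIV \<tau>" "\<And>x. x \<le> (1 + \<delta> / 4) * q \<Longrightarrow> \<tau> x = 0" "\<And>x. (1 + \<delta> / 2) * q \<le> x \<Longrightarrow> \<tau> x = (1::real)"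
      using smooth_step[OF lt(1)] by blast
    have "smooth_on UNIV (\<lambda>x::real^2. 1 - \<tau> (x \<bullet> x))"
      by (intro smooth_on_diff smooth_on_const smooth_on_radial \<tau>) simp
    then have \<tau>V: "(\<lambda>x::real^2. 1 - \<tau> (x \<bullet> x)) \<in> test_functions V"
      by (rule test_functionsI[OF _ compact_inner_self_le[of "(1 + \<delta> / 2) * q"]]) (use lt \<tau>(3) in \<open>auto simp: V_def\<close>)
    have oW: "open W" unfolding W_def by (rule open_inner_self_less)
    have KW: "cball 0 \<epsilon> \<subseteq> W"
    proof
      fix x :: "real^2" assume "x \<in> cball 0 \<epsilon>"
      then have "(norm x)\<^sup>2 \<le> \<epsilon>\<^sup>2" by (intro power_mono) auto
      then show "x \<in> W" using lt(3) by (simp add: W_def q_def dot_square_norm)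
    qed
    have W1: "1 - \<tau> (x \<bullet> x) = 1" if "x \<in> W" for x using that \<tau>(2)[of "x \<bullet> x"] by (simp add: W_def)
    have "capacity \<Omega> (cball 0 \<epsilon>) u \<le> (LINT x|lebesgue. (norm (gradient (\<lambda>x. f1 x + f2 x) x))\<^sup>2)"
      by (rule capacity_upper_bound[OF \<Omega>(1) u(1) test_functions_add[OF f1 f2] V \<tau>V oW KW W1])
    also have "\<dots> \<le> (1 + t) * (LINT x|lebesgue. (norm (gradient f1 x))\<^sup>2) + (1 + 1 / t) * (LINT x|lebesgue. (norm (gradient f2 x))\<^sup>2)"
      by (rule gradient_energy_add_le[OF f1 f2 t])
    also have "\<dots> \<le> (1 + t) * (4 * pi * m / T) + (1 + 1 / t) * (\<bar>l\<bar> * ((2 * N + N') * (4 * pi * \<epsilon>\<^sup>2)) + 64 * pi * M1\<^sup>2 * N)"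
      using E1 E2 A1 A2 t by (intro add_mono mult_left_mono) auto
    finally show "capacity \<Omega> (cball 0 \<epsilon>) u \<le>
      (1 + t) * (4 * pi * hmean k c / (radial_pot k ((1 + \<delta>) * \<epsilon>\<^sup>2) - radial_pot k (S / 2))) +
      (1 + 1 / t) * (\<bar>l\<bar> * ((2 * N + N') * (4 * pi * \<epsilon>\<^sup>2)) + 64 * pi * M1\<^sup>2 * N)"
      by (simp add: T_def m_def q_def)
  qed simp
qed


section \<open>Asymptotics\<close>

lemma radial_pot_scale:
  assumes "0 < a" "0 < s"
  shows "radial_pot k (a * s) = inverse a ^ k * radial_pot k s + (if k = 0 then - ln a else 0)"
  using assms by (simp add: radial_pot_def ln_mult power_mult_distrib)

text \<open>On the disc of radius 2 \<epsilon> the square of P is of order \<epsilon>^(2k). Against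
  an area of order \<epsilon>^2 this crude bound leaves a term of order \<epsilon>; for k = 0 it is
  log (1/\<epsilon>) \<le> 1/\<epsilon>.\<close>

lemma radial_pot_upper:
  assumes "0 < \<epsilon>" "\<epsilon> \<le> 1"
  shows "(\<epsilon>\<^sup>2) ^ k * radial_pot k (\<epsilon>\<^sup>2) \<le> 2 / \<epsilon>"
proof (cases "k = 0")
  case True
  have "ln (1 / \<epsilon>) \<le> 1 / \<epsilon> - 1" using assms by (intro ln_le_minus_one) simp
  then have "- ln \<epsilon> \<le> 1 / \<epsilon>" using assms by (simp add: ln_div)
  then show ?thesis using True assms by (simp add: radial_pot_def ln_realpow)
next
  case False
  have "(\<epsilon>\<^sup>2) ^ k * radial_pot k (\<epsilon>\<^sup>2) = ((\<epsilon>\<^sup>2) ^ k * inverse (\<epsilon>\<^sup>2) ^ k) / real k" using False by (simp add: radial_pot_def)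
  also have "(\<epsilon>\<^sup>2) ^ k * inverse (\<epsilon>\<^sup>2) ^ k = 1"
    using assms by (simp add: power_mult_distrib[symmetric])
  also have "1 / real k \<le> 1" using False by simp
  also have "1 \<le> 2 / \<epsilon>" using assms by simp
  finally show ?thesis .
qed

lemma square_le_if_abs_le: "\<bar>a\<bar> \<le> b \<Longrightarrow> a\<^sup>2 \<le> (b::real)\<^sup>2"
  using power_mono[of "\<bar>a\<bar>" b 2] by simp

lemma eventually_small: "0 < (b::real) \<Longrightarrow> eventually (\<lambda>\<epsilon>. 0 < \<epsilon> \<and> \<epsilon> < b) (at_right 0)"
  by (auto simp: eventually_at_right_field)

lemma radial_pot_at_top: "filterlim (\<lambda>\<epsilon>. radial_pot k (\<epsilon>\<^sup>2)) at_top (at_right 0)"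
proof -
  have inv: "filterlim (\<lambda>\<epsilon>::real. inverse (\<epsilon>\<^sup>2)) at_top (at_right 0)"
  proof -
    have "filterlim (\<lambda>\<epsilon>::real. \<epsilon>\<^sup>2) (at_right 0) (at_right 0)"
      unfolding filterlim_at
    proof
      have "((\<lambda>\<epsilon>::real. \<epsilon>\<^sup>2) \<longlongrightarrow> 0\<^sup>2) (at_right 0)" by (intro tendsto_intros)
      then show "((\<lambda>\<epsilon>::real. \<epsilon>\<^sup>2) \<longlongrightarrow> 0) (at_right 0)" by simp
      show "\<forall>\<^sub>F \<epsilon>::real in at_right 0. \<epsilon>\<^sup>2 \<in> {0<..} \<and> \<epsilon>\<^sup>2 \<noteq> 0"
        by (rule eventually_mono[OF eventually_small[of 1]]) auto
    qed
    then show ?thesis by (rule filterlim_compose[OF filterlim_inverse_at_top_right])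
  qed
  show ?thesis
  proof (cases "k = 0")
    case True
    have "filterlim (\<lambda>\<epsilon>::real. ln (inverse (\<epsilon>\<^sup>2))) at_top (at_right 0)"
      by (rule filterlim_compose[OF ln_at_top inv])
    then show ?thesis
      using True by (simp add: radial_pot_def ln_inverse)
  next
    case False
    have "filterlim (\<lambda>\<epsilon>::real. inverse (\<epsilon>\<^sup>2) ^ k) at_top (at_right 0)"
      using False by (intro filterlim_pow_at_top inv) simp
    then have "filterlim (\<lambda>\<epsilon>::real. inverse (real k) * inverse (\<epsilon>\<^sup>2) ^ k) at_top (at_right 0)"
      using False by (intro filterlim_tendsto_pos_mult_at_top[OF tendsto_const]) auto
    then show ?thesis using False by (simp add: radial_pot_def divide_inverse mult.commute)
  qed
qed

text \<open>Scaling the argument by a multiplies the potential by a^(-k) up to an additive constant,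
  and constants are lost against the divergent denominator. For k = 0 the limit is 1 for every
  a.\<close>

lemma radial_pot_ratio:
  assumes "0 < a"
  shows "((\<lambda>\<epsilon>. (radial_pot k (a * \<epsilon>\<^sup>2) - C) / radial_pot k (\<epsilon>\<^sup>2)) \<longlongrightarrow> inverse a ^ k) (at_right 0)"
proof -
  define D where "D = (if k = 0 then - ln a else 0) - C"
  have "((\<lambda>\<epsilon>. D / radial_pot k (\<epsilon>\<^sup>2)) \<longlongrightarrow> 0) (at_right 0)"
    by (rule real_tendsto_divide_at_top[OF tendsto_const radial_pot_at_top])
  then have "((\<lambda>\<epsilon>. inverse a ^ k + D / radial_pot k (\<epsilon>\<^sup>2)) \<longlongrightarrow> inverse a ^ k + 0) (at_right 0)"
    by (intro tendsto_intros)
  then have "((\<lambda>\<epsilon>. inverse a ^ k + D / radial_pot k (\<epsilon>\<^sup>2)) \<longlongrightarrow> inverse a ^ k) (at_right 0)" by simp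
  moreover have "\<forall>\<^sub>F \<epsilon> in at_right 0. 0 < radial_pot k (\<epsilon>\<^sup>2)"
    using radial_pot_at_top[of k] unfolding filterlim_at_top_dense by blast
  then have "\<forall>\<^sub>F \<epsilon> in at_right 0. inverse a ^ k + D / radial_pot k (\<epsilon>\<^sup>2) = (radial_pot k (a * \<epsilon>\<^sup>2) - C) / radial_pot k (\<epsilon>\<^sup>2)"
    using eventually_small[of 1, simplified]
  proof eventually_elim
    case (elim \<epsilon>)
    have "radial_pot k (a * \<epsilon>\<^sup>2) = inverse a ^ k * radial_pot k (\<epsilon>\<^sup>2) + (if k = 0 then - ln a else 0)"
      using elim assms by (intro radial_pot_scale) auto
    then show ?case using elim by (simp add: D_def field_simps)
  qed
  ultimately show ?thesis by (rule Lim_transform_eventually)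
qed

lemma C1_holder_norm_upper:
  fixes f g :: "real \<Rightarrow> real"
  assumes ab: "a < b" and \<tau>: "0 < \<tau>" and f: "f \<in> C1_holder \<tau> {a..b}" and g: "g \<in> C1_holder \<tau> {a..b}" and t: "t \<in> {a..b}"
  shows "\<bar>f t - g t\<bar> \<le> C1_holder_norm \<tau> {a..b} (\<lambda>t. f t - g t)"
proof -
  let ?S = "{a..b}"
  define h where "h t = f t - g t" for t
  define d where "d k t = vector_derivative k (at t within ?S)" for k :: "real \<Rightarrow> real" and t
  obtain C1 where C1: "\<And>s t. s \<in> ?S \<Longrightarrow> t \<in> ?S \<Longrightarrow> \<bar>d f s - d f t\<bar> \<le> C1 * \<bar>s - t\<bar> powr \<tau>"
    using f unfolding C1_holder_def d_def by blast
  obtain C2 where C2: "\<And>s t. s \<in> ?S \<Longrightarrow> t \<in> ?S \<Longrightarrow> \<bar>d g s - d g t\<bar> \<le> C2 * \<bar>s - t\<bar> powr \<tau>"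
    using g unfolding C1_holder_def d_def by blast
  have df: "f differentiable_on ?S" "g differentiable_on ?S" using f g by (auto simp: C1_holder_def)
  have dh: "d h t = d f t - d g t" if "t \<in> ?S" for t
    unfolding d_def
  proof (rule vector_derivative_within_closed_interval[OF ab that])
    have "(f has_vector_derivative vector_derivative f (at t within ?S)) (at t within ?S)"
      "(g has_vector_derivative vector_derivative g (at t within ?S)) (at t within ?S)"
      using df that by (auto simp: differentiable_on_def vector_derivative_works[symmetric])
    then show "(h has_vector_derivative vector_derivative f (at t within ?S) - vector_derivative g (at t within ?S)) (at t within ?S)"
      unfolding h_def by (rule has_vector_derivative_diff)
  qed
  define C where "C = \<bar>C1\<bar> + \<bar>C2\<bar>"
  have C: "\<bar>d h s - d h t\<bar> \<le> C * \<bar>s - t\<bar> powr \<tau>" if "s \<in> ?S" "t \<in> ?S" for s t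
  proof -
    have "\<bar>d h s - d h t\<bar> \<le> \<bar>d f s - d f t\<bar> + \<bar>d g s - d g t\<bar>" using that by (simp add: dh)
    also have "\<dots> \<le> C1 * \<bar>s - t\<bar> powr \<tau> + C2 * \<bar>s - t\<bar> powr \<tau>" using C1 C2 that by (intro add_mono)
    also have "\<dots> \<le> \<bar>C1\<bar> * \<bar>s - t\<bar> powr \<tau> + \<bar>C2\<bar> * \<bar>s - t\<bar> powr \<tau>" by (intro add_mono mult_right_mono) auto
    finally show ?thesis by (simp add: C_def algebra_simps)
  qed
  have "continuous_on ?S h" unfolding h_def by (intro continuous_intros differentiable_imp_continuous_on df)
  then have "bounded (h ` ?S)" by (intro compact_imp_bounded compact_continuous_image) auto
  then have "\<exists>B. \<forall>t\<in>?S. \<bar>h t\<bar> \<le> B" by (auto simp: bounded_iff)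
  then have b1: "bdd_above ((\<lambda>t. \<bar>h t\<bar>) ` ?S)" by (auto simp: bdd_above_def)
  \<comment> \<open>Hoelder continuity bounds the derivative through its value at the left
    endpoint.\<close>
  have "\<bar>d h t\<bar> \<le> \<bar>d h a\<bar> + C * (b - a) powr \<tau>" if "t \<in> ?S" for t
  proof -
    have "\<bar>d h t\<bar> \<le> \<bar>d h a\<bar> + \<bar>d h t - d h a\<bar>" by simp
    also have "\<bar>d h t - d h a\<bar> \<le> C * \<bar>t - a\<bar> powr \<tau>" using C[OF that, of a] ab by simp
    also have "\<dots> \<le> C * (b - a) powr \<tau>"
      using that \<tau> by (intro mult_left_mono powr_mono2) (auto simp: C_def)
    finally show ?thesis by simp
  qed
  then have b2: "bdd_above ((\<lambda>t. \<bar>d h t\<bar>) ` ?S)" by (intro bdd_aboveI2)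
  define X where "X = {(s, t). s \<in> ?S \<and> t \<in> ?S \<and> s \<noteq> t}"
  define Q where "Q = (\<lambda>(s, t). \<bar>d h s - d h t\<bar> / \<bar>s - t\<bar> powr \<tau>)"
  have "Q p \<le> C" if "p \<in> X" for p
    using that C[of "fst p" "snd p"] by (auto simp: X_def Q_def field_simps)
  then have b3: "bdd_above (Q ` X)" by (intro bdd_aboveI2)
  have "\<bar>h t\<bar> \<le> (SUP t\<in>?S. \<bar>h t\<bar>)" by (rule cSUP_upper[OF t b1])
  moreover have "0 \<le> (SUP t\<in>?S. \<bar>d h t\<bar>)" using cSUP_upper[OF t b2] by (rule order_trans[rotated]) simp
  moreover have "0 \<le> (SUP p\<in>X. Q p)"
  proof -
    have ab': "(a, b) \<in> X" using ab by (simp add: X_def)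
    have "0 \<le> Q (a, b)" by (simp add: Q_def)
    also have "\<dots> \<le> (SUP p\<in>X. Q p)" by (rule cSUP_upper[OF ab' b3])
    finally show ?thesis .
  qed
  moreover have "C1_holder_norm \<tau> ?S h = (SUP t\<in>?S. \<bar>h t\<bar>) + (SUP t\<in>?S. \<bar>d h t\<bar>) + (SUP p\<in>X. Q p)"
    unfolding C1_holder_norm_def d_def X_def Q_def ..
  ultimately have "\<bar>h t\<bar> \<le> C1_holder_norm \<tau> ?S h" by linarith
  then show ?thesis by (simp add: h_def[abs_def])
qed

section \<open>From the angular profile to bounds near the origin\<close>

lemma polar_real_2:
  fixes x :: "real^2"
  assumes "x \<noteq> 0"
  obtains t where "0 \<le> t" "t \<le> 2 * pi" "x = norm x *\<^sub>R vector [cos t, sin t]"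
proof -
  define r where "r = norm x"
  have "r\<^sup>2 = (x $ 1)\<^sup>2 + (x $ 2)\<^sup>2"
    unfolding r_def power2_norm_eq_inner inner_2 by (simp add: power2_eq_square)
  then have r: "0 < r" "r\<^sup>2 = (x $ 1)\<^sup>2 + (x $ 2)\<^sup>2" using assms by (simp_all add: r_def)
  have "(x $ 1 / r)\<^sup>2 + (x $ 2 / r)\<^sup>2 = 1"
    unfolding power_divide add_divide_distrib[symmetric] r(2)[symmetric] using r(1) by simp
  then obtain t where t: "0 \<le> t" "t < 2 * pi" "x $ 1 / r = cos t" "x $ 2 / r = sin t"
    using sincos_total_2pi by metis
  have "x = r *\<^sub>R vector [cos t, sin t]"
    using r(1) by (simp add: vec_eq_iff forall_2 t(3,4)[symmetric])
  then show thesis using that[of t] t by (simp add: r_def)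
qed

lemma hpoly_polar:
  "hpoly k (of_real \<beta> * cis \<alpha>) (r *\<^sub>R vector [cos t, sin t]) = r ^ k * (\<beta> * sin (\<alpha> - real k * t))"
proof -
  have "Complex (r * cos t) (- (r * sin t)) = of_real r * cis (- t)" by (simp add: complex_eq_iff)
  then have "hpoly k (of_real \<beta> * cis \<alpha>) (r *\<^sub>R vector [cos t, sin t]) =
      Im (of_real (\<beta> * r ^ k) * (cis \<alpha> * cis (real k * (- t))))"
    unfolding hpoly_def by (simp only: vector_scaleR_component vector_2 real_scaleR_def power_mult_distrib
        Complex.DeMoivre of_real_mult of_real_power mult_ac)
  then show ?thesis unfolding cis_mult by simp
qed

text \<open>The sup part of the Hoelder norm, taken at exponent 1/2, makes u / r^k uniformly close
  to the profile on small circles; multiplication by r^k gives the bound.\<close>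

lemma zero_of_order_near:
  assumes z: "zero_of_order u k \<beta> \<alpha>" and \<eta>: "0 < \<eta>"
  shows "\<exists>\<delta>>0. \<forall>x. 0 < norm x \<longrightarrow> norm x < \<delta> \<longrightarrow>
    \<bar>u x - hpoly k (of_real \<beta> * cis \<alpha>) x\<bar> \<le> \<eta> * norm x ^ k"
proof -
  define f where "f r t = u (r *\<^sub>R vector [cos t, sin t]) / r ^ k" for r t
  define g where "g t = \<beta> * sin (\<alpha> - real k * t)" for t
  have "tendsto_C1_holder (1/2) {0..2 * pi} f g (at_right 0)"
    using z unfolding zero_of_order_def f_def[abs_def] g_def[abs_def] by simp
  then have g: "g \<in> C1_holder (1/2) {0..2 * pi}" and f: "\<forall>\<^sub>F r in at_right 0. f r \<in> C1_holder (1/2) {0..2 * pi}"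
    and lim: "((\<lambda>r. C1_holder_norm (1/2) {0..2 * pi} (\<lambda>t. f r t - g t)) \<longlongrightarrow> 0) (at_right 0)"
    by (auto simp: tendsto_C1_holder_def)
  have "\<forall>\<^sub>F r in at_right 0. C1_holder_norm (1/2) {0..2 * pi} (\<lambda>t. f r t - g t) < \<eta>"
    by (rule order_tendstoD(2)[OF lim \<eta>])
  with f have "\<forall>\<^sub>F r in at_right 0. \<forall>t\<in>{0..2 * pi}. \<bar>f r t - g t\<bar> \<le> \<eta>"
  proof eventually_elim
    case (elim r)
    then show ?case using C1_holder_norm_upper[of 0 "2 * pi" "1/2" "f r" g] g by force
  qed
  then obtain \<delta> where \<delta>: "\<delta> > 0" "\<And>r t. 0 < r \<Longrightarrow> r < \<delta> \<Longrightarrow> t \<in> {0..2 * pi} \<Longrightarrow> \<bar>f r t - g t\<bar> \<le> \<eta>"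
    by (auto simp: eventually_at_right_field)
  show ?thesis
  proof (intro exI[of _ \<delta>] conjI allI impI \<delta>(1))
    fix x :: "real^2" assume x: "0 < norm x" "norm x < \<delta>"
    define r where "r = norm x"
    have r: "0 < r" "r < \<delta>" using x by (simp_all add: r_def)
    obtain t where t: "0 \<le> t" "t \<le> 2 * pi" "x = r *\<^sub>R vector [cos t, sin t]"
      using polar_real_2[of x] x unfolding r_def by auto
    have "\<bar>f r t - g t\<bar> \<le> \<eta>" using \<delta>(2) r t by simp
    then have "\<bar>f r t - g t\<bar> * r ^ k \<le> \<eta> * r ^ k" using r by (intro mult_right_mono) auto
    moreover have "u x = f r t * r ^ k" using r t by (simp add: f_def)
    moreover have "hpoly k (of_real \<beta> * cis \<alpha>) x = g t * r ^ k"
      unfolding t(3) hpoly_polar g_def by (rule mult.commute)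
    then have "u x - hpoly k (of_real \<beta> * cis \<alpha>) x = (f r t - g t) * r ^ k"
      using \<open>u x = f r t * r ^ k\<close> by (simp add: left_diff_distrib)
    ultimately show "\<bar>u x - hpoly k (of_real \<beta> * cis \<alpha>) x\<bar> \<le> \<eta> * norm x ^ k"
      using r by (simp add: abs_mult r_def)
  qed
qed

section \<open>The limit of the normalised capacity\<close>

context
  fixes \<Omega> :: "(real^2) set" and u :: "real^2 \<Rightarrow> real" and k :: nat and \<alpha> \<beta> :: real
  assumes \<Omega>: "open \<Omega>" "0 \<in> \<Omega>" and su: "smooth_on \<Omega> u"
    and z: "zero_of_order u k \<beta> \<alpha>"
begin

text \<open>The profile says nothing about the origin itself; continuity of u - P carries the bound
  there. For k = 0 this identifies u(0)^2 with m.\<close>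

lemma zero_of_order_at_0: "u 0 = hpoly k (of_real \<beta> * cis \<alpha>) 0"
proof -
  define v where "v x = u x - hpoly k (of_real \<beta> * cis \<alpha>) x" for x
  have "continuous_on \<Omega> v"
    unfolding v_def by (intro continuous_intros smooth_on_continuous[OF su] continuous_on_subset[OF smooth_on_continuous[OF smooth_on_hpoly]]) simp
  then have "isCont v 0" using \<Omega> continuous_on_eq_continuous_at by blast
  have "\<bar>v 0\<bar> \<le> e" if "e > 0" for e :: real
  proof -
    obtain \<delta> where \<delta>: "\<delta> > 0" "\<And>x. 0 < norm x \<Longrightarrow> norm x < \<delta> \<Longrightarrow> \<bar>v x\<bar> \<le> (e/2) * norm x ^ k"
      using zero_of_order_near[OF z, of "e/2"] \<open>e > 0\<close> unfolding v_def by auto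
    have "\<exists>d>0. \<forall>x. norm x < d \<longrightarrow> \<bar>v x - v 0\<bar> < e / 2"
      using \<open>isCont v 0\<close>[unfolded continuous_at_eps_delta, rule_format, of "e / 2"] \<open>e > 0\<close>
      by (simp add: dist_norm)
    then obtain d where d: "d > 0" "\<And>x. norm x < d \<Longrightarrow> \<bar>v x - v 0\<bar> < e / 2" by blast
    define r where "r = min 1 (min \<delta> d) / 2"
    define x where "x = r *\<^sub>R (axis 1 1 :: real^2)"
    have r: "0 < r" "r < \<delta>" "r < d" "r \<le> 1" using \<delta> d by (auto simp: r_def)
    have nx: "norm x = r" using r by (simp add: x_def)
    have "\<bar>v x\<bar> \<le> (e/2) * r ^ k" using \<delta>(2)[of x] r nx by simp
    also have "\<dots> \<le> e/2" using r \<open>e > 0\<close> by (simp add: mult_left_le power_le_one)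
    finally show ?thesis using d(2)[of x] r nx by linarith
  qed
  then have "\<bar>v 0\<bar> \<le> 0" by (rule field_le_epsilon[of _ 0, simplified])
  then show ?thesis by (simp add: v_def)
qed

lemma zero_of_order_near':
  assumes "0 < \<eta>"
  shows "\<exists>\<delta>>0. \<forall>x. norm x < \<delta> \<longrightarrow> \<bar>u x - hpoly k (of_real \<beta> * cis \<alpha>) x\<bar> \<le> \<eta> * norm x ^ k"
proof -
  obtain \<delta> where \<delta>: "\<delta> > 0" "\<And>x. 0 < norm x \<Longrightarrow> norm x < \<delta> \<Longrightarrow> \<bar>u x - hpoly k (of_real \<beta> * cis \<alpha>) x\<bar> \<le> \<eta> * norm x ^ k"
    using zero_of_order_near[OF z assms] by auto
  have "\<bar>u x - hpoly k (of_real \<beta> * cis \<alpha>) x\<bar> \<le> \<eta> * norm x ^ k" if "norm x < \<delta>" for x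
    using \<delta>(2)[of x] that zero_of_order_at_0 assms by (cases "x = 0") auto
  then show ?thesis using \<delta>(1) by blast
qed

text \<open>For \<open>k = 0\<close> the convergence of the profile gives no rate; the rate comes from differentiability.\<close>

lemma zero_of_order_remainder:
  assumes \<eta>: "0 < \<eta>"
  shows "\<forall>\<^sub>F \<epsilon> in at_right 0. \<forall>x. norm x \<le> 2 * \<epsilon> \<longrightarrow>
    (u x - hpoly k (of_real \<beta> * cis \<alpha>) x)\<^sup>2 * radial_pot k (\<epsilon>\<^sup>2) \<le> \<eta>"
proof (cases "k = 0")
  case False
  \<comment> \<open>On |x| \<le> 2 \<epsilon> the squared bound is \<theta>^2 4^k \<epsilon>^(2k),
    and \<epsilon>^(2k) times the potential is 1/k \<le> 1.\<close>
  define \<theta> where "\<theta> = sqrt (\<eta> / 4 ^ k)"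
  have \<theta>: "\<theta> > 0" "\<theta>\<^sup>2 = \<eta> / 4 ^ k" using \<eta> by (simp_all add: \<theta>_def)
  obtain \<delta> where \<delta>: "\<delta> > 0" "\<And>x. norm x < \<delta> \<Longrightarrow> \<bar>u x - hpoly k (of_real \<beta> * cis \<alpha>) x\<bar> \<le> \<theta> * norm x ^ k"
    using zero_of_order_near'[OF \<theta>(1)] by auto
  have "\<forall>\<^sub>F \<epsilon> in at_right 0. 0 < \<epsilon> \<and> \<epsilon> < \<delta> / 2" using \<delta>(1) by (intro eventually_small) simp
  then show ?thesis
  proof eventually_elim
    case (elim \<epsilon>)
    show ?case
    proof (intro allI impI)
      fix x :: "real^2" assume x: "norm x \<le> 2 * \<epsilon>"
      have "\<bar>u x - hpoly k (of_real \<beta> * cis \<alpha>) x\<bar> \<le> \<theta> * norm x ^ k" using \<delta>(2)[of x] x elim by simp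
      also have "\<dots> \<le> \<theta> * (2 * \<epsilon>) ^ k" using x \<theta> by (intro mult_left_mono power_mono) auto
      finally have "(u x - hpoly k (of_real \<beta> * cis \<alpha>) x)\<^sup>2 \<le> (\<theta> * (2 * \<epsilon>) ^ k)\<^sup>2"
        by (rule square_le_if_abs_le)
      also have "\<dots> = \<theta>\<^sup>2 * 4 ^ k * (\<epsilon>\<^sup>2) ^ k"
      proof -
        have "((2 * \<epsilon>) ^ k)\<^sup>2 = ((2 * \<epsilon>)\<^sup>2) ^ k" by (simp only: power_mult[symmetric] mult.commute[of k])
        also have "(2 * \<epsilon>)\<^sup>2 = 4 * \<epsilon>\<^sup>2" by (simp add: power_mult_distrib)
        finally show ?thesis by (simp only: power_mult_distrib mult.assoc)
      qed
      also have "\<dots> = \<eta> * (\<epsilon>\<^sup>2) ^ k" by (simp add: \<theta>(2))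
      finally have "(u x - hpoly k (of_real \<beta> * cis \<alpha>) x)\<^sup>2 * radial_pot k (\<epsilon>\<^sup>2) \<le> \<eta> * (\<epsilon>\<^sup>2) ^ k * radial_pot k (\<epsilon>\<^sup>2)"
        using False by (intro mult_right_mono) (auto simp: radial_pot_def)
      also have "\<dots> = \<eta> * ((\<epsilon>\<^sup>2) ^ k * inverse (\<epsilon>\<^sup>2) ^ k) / real k" using False by (simp add: radial_pot_def)
      also have "(\<epsilon>\<^sup>2) ^ k * inverse (\<epsilon>\<^sup>2) ^ k = 1" using elim by (simp add: power_mult_distrib[symmetric])
      also have "\<eta> * 1 / real k \<le> \<eta>" using False \<eta> by (simp add: divide_le_eq mult_le_cancel_left1)
      finally show "(u x - hpoly k (of_real \<beta> * cis \<alpha>) x)\<^sup>2 * radial_pot k (\<epsilon>\<^sup>2) \<le> \<eta>" .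
    qed
  qed
next
  case True
  define v where "v x = u x - hpoly k (of_real \<beta> * cis \<alpha>) x" for x
  have v0: "v 0 = 0" using zero_of_order_at_0 by (simp add: v_def)
  have "v differentiable (at 0)"
    unfolding v_def by (intro differentiable_diff smooth_on_differentiable[OF su \<Omega>(2)] smooth_on_differentiable[OF smooth_on_hpoly]) simp
  then have dv: "(v has_derivative (\<lambda>y. y \<bullet> gradient v 0)) (at 0)" by (rule has_derivative_gradient)
  obtain \<delta> where \<delta>: "\<delta> > 0" "\<And>x. norm x < \<delta> \<Longrightarrow> norm (v x - v 0 - (x - 0) \<bullet> gradient v 0) \<le> 1 * norm (x - 0)"
  proof -
    have "\<exists>d>0. \<forall>y. norm (y - 0) < d \<longrightarrow> norm (v y - v 0 - (y - 0) \<bullet> gradient v 0) \<le> 1 * norm (y - 0)"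
      using dv unfolding has_derivative_at_alt by (meson zero_less_one)
    then show thesis using that by auto
  qed
  \<comment> \<open>Differentiability at 0, with error at most |x|, gives |v| \<le> C |x|. Then v^2
    times the potential is at most (2 C \<epsilon>)^2 (2 / \<epsilon>) = 8 C^2 \<epsilon>.\<close>
  define C where "C = 1 + norm (gradient v 0)"
  have C: "\<bar>v x\<bar> \<le> C * norm x" if "norm x < \<delta>" for x
  proof -
    have "\<bar>v x - x \<bullet> gradient v 0\<bar> \<le> norm x" using \<delta>(2)[OF that] v0 by simp
    moreover have "\<bar>x \<bullet> gradient v 0\<bar> \<le> norm x * norm (gradient v 0)" by (rule Cauchy_Schwarz_ineq2)
    ultimately show ?thesis by (simp add: C_def algebra_simps)
  qed
  have "C > 0" by (simp add: C_def add_pos_nonneg)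
  have "\<forall>\<^sub>F \<epsilon> in at_right 0. 0 < \<epsilon> \<and> \<epsilon> < min (min 1 (\<delta> / 2)) (\<eta> / (8 * C\<^sup>2))"
    using \<delta>(1) \<eta> \<open>C > 0\<close> by (intro eventually_small) simp
  then show ?thesis
  proof eventually_elim
    case (elim \<epsilon>)
    show ?case
    proof (intro allI impI)
      fix x :: "real^2" assume x: "norm x \<le> 2 * \<epsilon>"
      have "\<bar>v x\<bar> \<le> C * norm x" using C[of x] x elim by simp
      also have "\<dots> \<le> C * (2 * \<epsilon>)" using x \<open>C > 0\<close> by simp
      finally have "(v x)\<^sup>2 \<le> (C * (2 * \<epsilon>))\<^sup>2" by (rule square_le_if_abs_le)
      then have "(v x)\<^sup>2 \<le> 4 * C\<^sup>2 * \<epsilon>\<^sup>2" by (simp add: power_mult_distrib)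
      moreover have T: "radial_pot k (\<epsilon>\<^sup>2) \<le> 2 / \<epsilon>" using radial_pot_upper[of \<epsilon> k] elim True by simp
      moreover have "0 \<le> radial_pot k (\<epsilon>\<^sup>2)"
        using elim True by (simp add: radial_pot_def power_le_one)
      ultimately have "(v x)\<^sup>2 * radial_pot k (\<epsilon>\<^sup>2) \<le> (4 * C\<^sup>2 * \<epsilon>\<^sup>2) * (2 / \<epsilon>)" by (intro mult_mono) auto
      also have "\<dots> = 8 * C\<^sup>2 * \<epsilon>" using elim by (simp add: power2_eq_square)
      also have "\<dots> \<le> \<eta>" using elim \<open>C > 0\<close> by (simp add: field_simps)
      finally show "(u x - hpoly k (of_real \<beta> * cis \<alpha>) x)\<^sup>2 * radial_pot k (\<epsilon>\<^sup>2) \<le> \<eta>" by (simp add: v_def)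
    qed
  qed
qed

text \<open>Each bound is proved up to a slack \<kappa>. The auxiliary parameters are chosen from
  \<kappa>, independently of \<epsilon>, and \<epsilon> tends to 0 with them fixed; the freedom in
  \<kappa> then closes the gap.\<close>

lemma capacity_limit:
  assumes bnd: "bounded \<Omega>" and eig: "dirichlet_eigenfunction \<Omega> u" and m: "0 < hmean k (of_real \<beta> * cis \<alpha>)"
  shows "((\<lambda>\<epsilon>. capacity \<Omega> (cball 0 \<epsilon>) u * radial_pot k (\<epsilon>\<^sup>2) / (4 * pi * hmean k (of_real \<beta> * cis \<alpha>))) \<longlongrightarrow> 1) (at_right 0)"
proof -
  define c where "c = of_real \<beta> * cis \<alpha>"
  define m where "m = hmean k c"
  have m0: "0 < m" using m by (simp add: m_def c_def)
  define T where "T \<epsilon> = radial_pot k (\<epsilon>\<^sup>2)" for \<epsilon>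
  define X where "X \<epsilon> = capacity \<Omega> (cball 0 \<epsilon>) u * T \<epsilon> / (4 * pi * m)" for \<epsilon>
  have uH: "u \<in> H10 \<Omega>" using eig by (simp add: dirichlet_eigenfunction_def)
  obtain l where l: "\<And>\<psi>. \<psi> \<in> test_functions \<Omega> \<Longrightarrow>
    (LINT x|lebesgue. gradient \<psi> x \<bullet> gradient u x) = l * (LINT x|lebesgue. \<psi> x * u x)"
    using eigenfunction_weak_equation[OF \<Omega>(1) eig su] by blast
  obtain R where R: "\<And>x. x \<in> \<Omega> \<Longrightarrow> norm x \<le> R" using bnd by (auto simp: bounded_iff)
  define S where "S = R\<^sup>2 + 1"
  have S: "x \<bullet> x < S" if "x \<in> \<Omega>" for x
  proof -
    have "(norm x)\<^sup>2 \<le> R\<^sup>2" using R[OF that] by (intro power_mono) auto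
    then show ?thesis by (simp add: S_def dot_square_norm)
  qed
  have S0: "0 < S" by (simp add: S_def add_nonneg_pos)
  obtain r where r: "r > 0" "cball 0 r \<subseteq> \<Omega>" using \<Omega> open_contains_cball by blast
  define S1 where "S1 = r\<^sup>2"
  have S1: "x \<in> \<Omega>" if "x \<bullet> x \<le> S1" for x
  proof -
    have "norm x \<le> r" using that r(1) by (intro power2_le_imp_le[of "norm x" r]) (auto simp: S1_def dot_square_norm)
    then show ?thesis using r(2) by auto
  qed
  have S10: "0 < S1" using r by (simp add: S1_def)
  have Tpos: "\<forall>\<^sub>F \<epsilon> in at_right 0. 0 < T \<epsilon>"
    using radial_pot_at_top[of k] unfolding T_def filterlim_at_top_dense by blast
  have ratio: "((\<lambda>\<epsilon>. (radial_pot k (a * \<epsilon>\<^sup>2) - C) / T \<epsilon>) \<longlongrightarrow> inverse a ^ k) (at_right 0)" if "0 < a" for a C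
    unfolding T_def by (rule radial_pot_ratio[OF that])
  have lower: "\<forall>\<^sub>F \<epsilon> in at_right 0. 1 - \<kappa> < X \<epsilon>" if \<kappa>: "0 < \<kappa>" "\<kappa> \<le> 1" for \<kappa>
  proof -
    \<comment> \<open>The target is 1 - \<kappa> < a^(k+2): a^k compensates the ratio of potentials
      and a^2 comes from the squared pairing. Bernoulli's inequality gives a^(k+2) \<ge> 1 -
      \<kappa>/2.\<close>
    define \<theta> where "\<theta> = \<kappa> / (2 * real (k + 2))"
    have \<theta>: "0 < \<theta>" "\<theta> \<le> 1/4" using \<kappa> by (auto simp: \<theta>_def field_simps)
    define a where "a = 1 - \<theta>"
    have a: "0 < a" "a < 1" using \<theta> by (auto simp: a_def)
    have "1 + real (k + 2) * (- \<theta>) \<le> (1 + - \<theta>) ^ (k + 2)" using \<theta> by (intro Bernoulli_inequality) simp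
    moreover have "real (k + 2) * (- \<theta>) = - \<kappa> / 2" by (simp add: \<theta>_def field_simps)
    ultimately have "1 - \<kappa> < a ^ (k + 2)" using \<kappa> by (simp add: a_def)
    then have "(1 - \<kappa>) * inverse a ^ k < a ^ (k + 2) * inverse a ^ k" using a by (intro mult_strict_right_mono) auto
    also have "\<dots> = a\<^sup>2" using a by (simp add: power_add power_inverse power2_eq_square field_simps)
    finally have key: "(1 - \<kappa>) * inverse a ^ k < a\<^sup>2" .
    \<comment> \<open>Makes \<eta> |c| at most m \<theta>, so that m - \<eta> |c| is at least m
      a.\<close>
    define \<eta> where "\<eta> = m * \<theta> / (cmod c + 1)"
    have \<eta>: "0 < \<eta>" using m0 \<theta> by (simp add: \<eta>_def add_nonneg_pos)
    have c1: "cmod c + 1 \<noteq> 0" using norm_ge_zero[of c] by linarith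
    have "\<eta> * cmod c \<le> \<eta> * (cmod c + 1)" using \<eta> by simp
    also have "\<dots> = m * \<theta>" using c1 by (simp add: \<eta>_def)
    finally have \<eta>c: "\<eta> * cmod c \<le> m * \<theta>" .
    have "m * \<theta> \<le> m * 1" using m0 \<theta> by (intro mult_left_mono) auto
    with \<eta>c have \<eta>m: "\<eta> * cmod c \<le> hmean k c" by (simp add: m_def)
    obtain \<delta> where \<delta>: "\<delta> > 0" "\<And>x. norm x < \<delta> \<Longrightarrow> \<bar>u x - hpoly k c x\<bar> \<le> \<eta> * norm x ^ k"
      using zero_of_order_near'[OF \<eta>] unfolding c_def by blast
    have "\<forall>\<^sub>F \<epsilon> in at_right 0. 0 < \<epsilon> \<and> \<epsilon> < min (min \<delta> 1) S" using \<delta>(1) S0 by (intro eventually_small) simp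
    moreover have "((\<lambda>\<epsilon>. (1 - \<kappa>) * ((radial_pot k (a * \<epsilon>\<^sup>2) - radial_pot k S) / T \<epsilon>)) \<longlongrightarrow> (1 - \<kappa>) * inverse a ^ k) (at_right 0)"
      by (intro tendsto_intros ratio a)
    from order_tendstoD(2)[OF this key]
    have "\<forall>\<^sub>F \<epsilon> in at_right 0. (1 - \<kappa>) * ((radial_pot k (a * \<epsilon>\<^sup>2) - radial_pot k S) / T \<epsilon>) < a\<^sup>2" .
    moreover have "\<forall>\<^sub>F \<epsilon> in at_right 0. 0 < (radial_pot k (a * \<epsilon>\<^sup>2) - radial_pot k S) / T \<epsilon>"
      by (rule order_tendstoD(1)[OF ratio[OF a(1)]]) (use a in simp)
    ultimately show ?thesis using Tpos
    proof eventually_elim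
      case (elim \<epsilon>)
      define Q where "Q = (radial_pot k (a * \<epsilon>\<^sup>2) - radial_pot k S) / T \<epsilon>"
      have Q: "0 < Q" "(1 - \<kappa>) * Q < a\<^sup>2" and QT: "radial_pot k (a * \<epsilon>\<^sup>2) - radial_pot k S = Q * T \<epsilon>"
        using elim by (auto simp: Q_def)
      have "\<epsilon>\<^sup>2 \<le> \<epsilon>" using elim by (simp add: power2_eq_square mult_left_le)
      then have "\<epsilon>\<^sup>2 < S" using elim by simp
      then have "(4 * pi * (m - \<eta> * cmod c))\<^sup>2 \<le> capacity \<Omega> (cball 0 \<epsilon>) u * (4 * pi * m * (Q * T \<epsilon>))"
        unfolding m_def QT[symmetric]
        using elim a \<eta> \<eta>m \<delta>(2) by (intro capacity_lower_estimate[OF \<Omega>(1) S uH]) auto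
      moreover have "(4 * pi * m * a)\<^sup>2 \<le> (4 * pi * (m - \<eta> * cmod c))\<^sup>2"
      proof (rule power_mono)
        have "m * a \<le> m - \<eta> * cmod c" using \<eta>c by (simp add: a_def algebra_simps)
        then show "4 * pi * m * a \<le> 4 * pi * (m - \<eta> * cmod c)" by simp
      qed (use m0 a in simp)
      \<comment> \<open>In terms of X the lower estimate becomes a^2 \<le> X Q, while (1 - \<kappa>)
        Q < a^2 for small \<epsilon>.\<close>
      moreover have "capacity \<Omega> (cball 0 \<epsilon>) u * (4 * pi * m * (Q * T \<epsilon>)) = (4 * pi * m)\<^sup>2 * (X \<epsilon> * Q)"
        using m0 by (simp add: X_def power2_eq_square field_simps)
      ultimately have "(4 * pi * m)\<^sup>2 * a\<^sup>2 \<le> (4 * pi * m)\<^sup>2 * (X \<epsilon> * Q)" by (simp add: power_mult_distrib)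
      then have "a\<^sup>2 \<le> X \<epsilon> * Q" using m0 by (subst (asm) mult_le_cancel_left_pos) auto
      with Q(2) have "(1 - \<kappa>) * Q < X \<epsilon> * Q" by simp
      then show ?case using Q(1) by simp
    qed
  qed
  obtain M where M: "0 \<le> M" "\<forall>\<epsilon> \<delta> t N N'. 0 < \<epsilon> \<longrightarrow> 8 * \<epsilon>\<^sup>2 \<le> S1 \<longrightarrow> 0 < \<delta> \<longrightarrow> \<delta> \<le> 1 \<longrightarrow> 0 < t \<longrightarrow>
    (\<forall>x. norm x \<le> 2 * \<epsilon> \<longrightarrow> (u x - hpoly k c x)\<^sup>2 \<le> N) \<longrightarrow>
    (\<forall>x. norm x \<le> 2 * \<epsilon> \<longrightarrow> (hpoly k c x)\<^sup>2 \<le> N') \<longrightarrow>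
    capacity \<Omega> (cball 0 \<epsilon>) u \<le>
      (1 + t) * (4 * pi * hmean k c / (radial_pot k ((1 + \<delta>) * \<epsilon>\<^sup>2) - radial_pot k (S1 / 2))) +
      (1 + 1 / t) * (\<bar>l\<bar> * ((2 * N + N') * (4 * pi * \<epsilon>\<^sup>2)) + M * N)"
    using capacity_upper_estimate[OF \<Omega>(1) S1 uH su l, where k=k and c=c] by blast
  have upper: "\<forall>\<^sub>F \<epsilon> in at_right 0. X \<epsilon> < 1 + \<kappa>" if \<kappa>: "0 < \<kappa>" for \<kappa>
  proof -
    \<comment> \<open>The parameter \<delta> is used twice: as width of the annulus it costs (1 +
      \<delta>)^k in the limit, and as weight t it costs 1 + \<delta>.\<close>
    have "((\<lambda>\<delta>. (1 + \<delta>) ^ (k + 1)) \<longlongrightarrow> (1 + 0) ^ (k + 1)) (at_right (0::real))" by (intro tendsto_intros)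
    then have ev: "\<forall>\<^sub>F \<delta> in at_right 0. (1 + \<delta>) ^ (k + 1) < 1 + \<kappa> / 2" using \<kappa> by (intro order_tendstoD) auto
    have "\<forall>\<^sub>F \<delta> in at_right 0. (0 < \<delta> \<and> \<delta> < 1) \<and> (1 + \<delta>) ^ (k + 1) < 1 + \<kappa> / 2"
      by (rule eventually_conj[OF eventually_small[OF zero_less_one] ev])
    then obtain \<delta> where \<delta>: "0 < \<delta>" "\<delta> < 1" "(1 + \<delta>) ^ (k + 1) < 1 + \<kappa> / 2"
      using eventually_happens'[of "at_right (0::real)"] by force
    \<comment> \<open>The factor 1 + 1/t of the remainder energy at t = \<delta>, in the
      normalisation of X.\<close>
    define A where "A = (1 + 1 / \<delta>) / (4 * pi * m)"
    have A: "0 < A" using \<delta> m0 by (simp add: A_def add_pos_pos)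
    \<comment> \<open>The remainder contributes A M \<eta> in the limit; this choice keeps it below
      \<kappa>/8, within the slack left by \<delta>.\<close>
    define \<eta> where "\<eta> = \<kappa> / (8 * A * (M + 1))"
    have \<eta>: "0 < \<eta>" using \<kappa> A M(1) by (simp add: \<eta>_def)
    have "A * (M * \<eta>) \<le> A * ((M + 1) * \<eta>)" using A \<eta> by (intro mult_left_mono mult_right_mono) auto
    also have "\<dots> = \<kappa> / 8" using A M(1) by (simp add: \<eta>_def)
    finally have AM: "A * (M * \<eta>) \<le> \<kappa> / 8" .
    define Q where "Q \<epsilon> = (radial_pot k ((1 + \<delta>) * \<epsilon>\<^sup>2) - radial_pot k (S1 / 2)) / T \<epsilon>" for \<epsilon>
    \<comment> \<open>An upper bound for X whose limit is explicit: the terms with the eigenvalue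
      carry \<epsilon>^2 or \<epsilon> and disappear.\<close>
    define W where "W \<epsilon> = (1 + \<delta>) / Q \<epsilon> + A * (\<bar>l\<bar> * (8 * pi * \<eta> * \<epsilon>\<^sup>2 + 8 * pi * (cmod c)\<^sup>2 * 4 ^ k * \<epsilon>) + M * \<eta>)" for \<epsilon>
    have Q: "(Q \<longlongrightarrow> inverse (1 + \<delta>) ^ k) (at_right 0)" unfolding Q_def using \<delta> by (intro ratio) simp
    have "(W \<longlongrightarrow> (1 + \<delta>) / inverse (1 + \<delta>) ^ k + A * (\<bar>l\<bar> * (8 * pi * \<eta> * 0\<^sup>2 + 8 * pi * (cmod c)\<^sup>2 * 4 ^ k * 0) + M * \<eta>)) (at_right 0)"
      unfolding W_def using \<delta> by (intro tendsto_intros Q) simp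
    moreover have "(1 + \<delta>) / inverse (1 + \<delta>) ^ k = (1 + \<delta>) ^ (k + 1)" using \<delta> by (simp add: power_inverse field_simps)
    ultimately have "(W \<longlongrightarrow> (1 + \<delta>) ^ (k + 1) + A * (M * \<eta>)) (at_right 0)" by simp
    then have "\<forall>\<^sub>F \<epsilon> in at_right 0. W \<epsilon> < 1 + \<kappa>" using \<delta>(3) AM \<kappa> by (intro order_tendstoD) auto
    moreover have "\<forall>\<^sub>F \<epsilon> in at_right 0. 0 < \<epsilon> \<and> \<epsilon> < min 1 (S1 / 8)" using S10 by (intro eventually_small) simp
    moreover have "\<forall>\<^sub>F \<epsilon> in at_right 0. 0 < Q \<epsilon>" by (rule order_tendstoD(1)[OF Q]) (use \<delta> in simp)
    ultimately show ?thesis using Tpos zero_of_order_remainder[OF \<eta>]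
    proof eventually_elim
      case (elim \<epsilon>)
      \<comment> \<open>Multiplied by T, N is exactly \<eta>; N' T is only at most of order
        1/\<epsilon>, but N' meets the area of order \<epsilon>^2.\<close>
      define N N' where "N = \<eta> / T \<epsilon>" and "N' = (cmod c)\<^sup>2 * (4 * \<epsilon>\<^sup>2) ^ k"
      have \<epsilon>: "0 < \<epsilon>" "\<epsilon> < 1" "\<epsilon> < S1 / 8" and T0: "0 < T \<epsilon>" using elim by auto
      have "\<epsilon>\<^sup>2 \<le> \<epsilon>" using \<epsilon> by (simp add: power2_eq_square mult_left_le)
      then have 8: "8 * \<epsilon>\<^sup>2 \<le> S1" using \<epsilon> by simp
      have N: "(u x - hpoly k c x)\<^sup>2 \<le> N" if "norm x \<le> 2 * \<epsilon>" for x
        using elim(5) that T0 unfolding N_def T_def c_def by (simp add: pos_le_divide_eq)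
      have N': "(hpoly k c x)\<^sup>2 \<le> N'" if "norm x \<le> 2 * \<epsilon>" for x
      proof -
        have "(norm x)\<^sup>2 \<le> (2 * \<epsilon>)\<^sup>2" using that by (intro power_mono) auto
        then have "(x \<bullet> x) ^ k \<le> (4 * \<epsilon>\<^sup>2) ^ k" by (intro power_mono) (auto simp: dot_square_norm power_mult_distrib)
        then have "(cmod c)\<^sup>2 * (x \<bullet> x) ^ k \<le> N'" unfolding N'_def by (intro mult_left_mono) auto
        then show ?thesis using hpoly_squared_le[of k c x] by linarith
      qed
      have QT: "radial_pot k ((1 + \<delta>) * \<epsilon>\<^sup>2) - radial_pot k (S1 / 2) = Q \<epsilon> * T \<epsilon>" using T0 by (simp add: Q_def)
      define Y where "Y = \<bar>l\<bar> * ((2 * N + N') * (4 * pi * \<epsilon>\<^sup>2)) + M * N"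
      have "capacity \<Omega> (cball 0 \<epsilon>) u \<le> (1 + \<delta>) * (4 * pi * m / (Q \<epsilon> * T \<epsilon>)) + (1 + 1 / \<delta>) * Y"
        using M(2)[rule_format, OF \<epsilon>(1) 8 \<delta>(1) less_imp_le[OF \<delta>(2)] \<delta>(1) N N'] by (simp add: QT Y_def m_def)
      then have "capacity \<Omega> (cball 0 \<epsilon>) u * (T \<epsilon> / (4 * pi * m)) \<le>
          ((1 + \<delta>) * (4 * pi * m / (Q \<epsilon> * T \<epsilon>)) + (1 + 1 / \<delta>) * Y) * (T \<epsilon> / (4 * pi * m))"
        using T0 m0 by (intro mult_right_mono) auto
      also have "\<dots> = (1 + \<delta>) / Q \<epsilon> + A * (Y * T \<epsilon>)"
      proof -
        have "(d * (p / (q * s)) + e * y) * (s / p) = d / q + (e / p) * (y * s)"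
          if "p \<noteq> 0" "q \<noteq> 0" "s \<noteq> 0" for d p q s e y :: real
          using that by (simp add: field_simps)
        then show ?thesis unfolding A_def using T0 m0 elim(3) by simp
      qed
      finally have X: "X \<epsilon> \<le> (1 + \<delta>) / Q \<epsilon> + A * (Y * T \<epsilon>)" by (simp add: X_def)
      have NT: "N * T \<epsilon> = \<eta>" using T0 by (simp add: N_def)
      have "N' * T \<epsilon> = (cmod c)\<^sup>2 * 4 ^ k * ((\<epsilon>\<^sup>2) ^ k * T \<epsilon>)" by (simp add: N'_def power_mult_distrib)
      also have "\<dots> \<le> (cmod c)\<^sup>2 * 4 ^ k * (2 / \<epsilon>)"
        unfolding T_def using \<epsilon> by (intro mult_left_mono radial_pot_upper) auto
      finally have "(2 * \<eta> + N' * T \<epsilon>) * (4 * pi * \<epsilon>\<^sup>2) \<le> (2 * \<eta> + (cmod c)\<^sup>2 * 4 ^ k * (2 / \<epsilon>)) * (4 * pi * \<epsilon>\<^sup>2)"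
        by (intro mult_right_mono) auto
      also have "\<dots> = 8 * pi * \<eta> * \<epsilon>\<^sup>2 + 8 * pi * (cmod c)\<^sup>2 * 4 ^ k * \<epsilon>"
        using \<epsilon>(1) by (simp add: power2_eq_square field_simps)
      finally have "\<bar>l\<bar> * ((2 * \<eta> + N' * T \<epsilon>) * (4 * pi * \<epsilon>\<^sup>2)) \<le> \<bar>l\<bar> * (8 * pi * \<eta> * \<epsilon>\<^sup>2 + 8 * pi * (cmod c)\<^sup>2 * 4 ^ k * \<epsilon>)"
        by (rule mult_left_mono) simp
      moreover have "Y * T \<epsilon> = \<bar>l\<bar> * ((2 * (N * T \<epsilon>) + N' * T \<epsilon>) * (4 * pi * \<epsilon>\<^sup>2)) + M * (N * T \<epsilon>)"
        by (simp add: Y_def algebra_simps)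
      ultimately have "Y * T \<epsilon> \<le> \<bar>l\<bar> * (8 * pi * \<eta> * \<epsilon>\<^sup>2 + 8 * pi * (cmod c)\<^sup>2 * 4 ^ k * \<epsilon>) + M * \<eta>"
        by (simp add: NT)
      then have "A * (Y * T \<epsilon>) \<le> A * (\<bar>l\<bar> * (8 * pi * \<eta> * \<epsilon>\<^sup>2 + 8 * pi * (cmod c)\<^sup>2 * 4 ^ k * \<epsilon>) + M * \<eta>)"
        using A by (intro mult_left_mono) auto
      then have "X \<epsilon> \<le> W \<epsilon>" using X by (simp add: W_def)
      then show ?case using elim(1) by linarith
    qed
  qed
  have "(X \<longlongrightarrow> 1) (at_right 0)"
  proof (rule order_tendstoI)
    show "\<forall>\<^sub>F \<epsilon> in at_right 0. b < X \<epsilon>" if "b < 1" for b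
    proof -
      define \<kappa> where "\<kappa> = min 1 (1 - b)"
      have "0 < \<kappa>" "\<kappa> \<le> 1" "b \<le> 1 - \<kappa>" using that by (auto simp: \<kappa>_def)
      then show ?thesis using lower[of \<kappa>] by (auto elim: eventually_mono)
    qed
    show "\<forall>\<^sub>F \<epsilon> in at_right 0. X \<epsilon> < b" if "1 < b" for b
      using upper[of "b - 1"] that by simp
  qed
  then show ?thesis by (simp add: X_def[abs_def] T_def m_def c_def)
qed

end

theorem theorem1p13:
  fixes \<Omega> :: "(real ^ 2) set" and u :: "real ^ 2 \<Rightarrow> real"
    and k :: nat and \<alpha> \<beta> :: real
  assumes "open \<Omega>" and "bounded \<Omega>" and "connected \<Omega>" and "0 \<in> \<Omega>"
    and "dirichlet_eigenfunction \<Omega> u"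
    and "smooth_on \<Omega> u"
    and "(LINT x|lebesgue_on \<Omega>. (u x)\<^sup>2) = 1"
    and "\<beta> \<noteq> 0" and "0 \<le> \<alpha>" and "\<alpha> < pi"
    and "zero_of_order u k \<beta> \<alpha>"
  shows "(k = 0 \<longrightarrow> (\<lambda>\<epsilon>. capacity \<Omega> (cball 0 \<epsilon>) u)
            \<sim>[at_right 0] (\<lambda>\<epsilon>. 2 * pi / \<bar>ln \<epsilon>\<bar> * (u 0)\<^sup>2)) \<and>
         (k \<ge> 1 \<longrightarrow> (\<lambda>\<epsilon>. capacity \<Omega> (cball 0 \<epsilon>) u)
            \<sim>[at_right 0] (\<lambda>\<epsilon>. 2 * real k * pi * \<epsilon> ^ (2 * k) * \<beta>\<^sup>2))"
proof -
  define m where "m = hmean k (of_real \<beta> * cis \<alpha>)"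
  \<comment> \<open>A nonzero value of the profile excludes k = 0 with sin \<alpha> = 0, the one
    case in which m would vanish although \<beta> \<noteq> 0.\<close>
  obtain t where t: "\<beta> * sin (\<alpha> - real k * t) \<noteq> 0" using assms(11) by (auto simp: zero_of_order_def)
  have m0: "0 < m" using t assms(8) by (auto simp: m_def hmean_def norm_mult)
  note lim = capacity_limit[OF assms(1,4,6,11,2,5) m0[unfolded m_def], folded m_def]
  show ?thesis
  proof (intro conjI impI)
    assume k: "k = 0"
    \<comment> \<open>For k = 0 the polynomial is the constant \<beta> sin \<alpha>, which equals
      u(0).\<close>
    have u0: "(u 0)\<^sup>2 = m"
      using zero_of_order_at_0[OF assms(1,4,6,11)] k by (simp add: m_def hmean_def hpoly_def)
    show "(\<lambda>\<epsilon>. capacity \<Omega> (cball 0 \<epsilon>) u) \<sim>[at_right 0] (\<lambda>\<epsilon>. 2 * pi / \<bar>ln \<epsilon>\<bar> * (u 0)\<^sup>2)"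
    proof (rule asymp_equivI', rule Lim_transform_eventually[OF lim])
      show "\<forall>\<^sub>F \<epsilon> in at_right 0. capacity \<Omega> (cball 0 \<epsilon>) u * radial_pot k (\<epsilon>\<^sup>2) / (4 * pi * m) =
          capacity \<Omega> (cball 0 \<epsilon>) u / (2 * pi / \<bar>ln \<epsilon>\<bar> * (u 0)\<^sup>2)"
        using eventually_small[OF zero_less_one]
      proof eventually_elim
        case (elim \<epsilon>)
        \<comment> \<open>The sign turns the potential at \<epsilon>^2 into 2 |ln \<epsilon>|, so 4
          \<pi> m divided by it is the stated rate.\<close>
        have "ln \<epsilon> < 0" using elim by (simp add: ln_less_zero)
        moreover have "radial_pot k (\<epsilon>\<^sup>2) = 2 * \<bar>ln \<epsilon>\<bar>" using k elim calculation by (simp add: radial_pot_def ln_realpow)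
        ultimately show ?case using m0 by (simp add: u0 field_simps)
      qed
    qed
  next
    assume k: "1 \<le> k"
    then have m: "m = \<beta>\<^sup>2 / 2" by (simp add: m_def hmean_def norm_mult)
    show "(\<lambda>\<epsilon>. capacity \<Omega> (cball 0 \<epsilon>) u) \<sim>[at_right 0] (\<lambda>\<epsilon>. 2 * real k * pi * \<epsilon> ^ (2 * k) * \<beta>\<^sup>2)"
    proof (rule asymp_equivI', rule Lim_transform_eventually[OF lim])
      show "\<forall>\<^sub>F \<epsilon> in at_right 0. capacity \<Omega> (cball 0 \<epsilon>) u * radial_pot k (\<epsilon>\<^sup>2) / (4 * pi * m) =
          capacity \<Omega> (cball 0 \<epsilon>) u / (2 * real k * pi * \<epsilon> ^ (2 * k) * \<beta>\<^sup>2)"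
        using eventually_small[OF zero_less_one]
      proof eventually_elim
        case (elim \<epsilon>)
        \<comment> \<open>With m = \<beta>^2 / 2 the quotient of 4 \<pi> m by the potential is 2 k
          \<pi> \<epsilon>^(2k) \<beta>^2.\<close>
        have "radial_pot k (\<epsilon>\<^sup>2) = 1 / (real k * \<epsilon> ^ (2 * k))"
          using k elim by (simp add: radial_pot_def power_mult[symmetric] power_inverse divide_inverse)
        then show ?case using k elim assms(8) by (simp add: m field_simps)
      qed
    qed
  qed
qed

end
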